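(* Let $t\geq1$ and $n\geq400t$ be integers. If $\mathcal{F}\subseteq S_n$ is a non-trivial $t$-intersecting family, then $$|\mathcal{F}|\leq(n-t)!-d_{n-t}-d_{n-t-1}+t.$$ Moreover, equality holds if and only if $\mathcal{F}\cong\mathcal{H}(n,t)$.
   Context: $S_n$ is the symmetric group on $[n]=\{1,\dots,n\}$. A family $\mathcal F\subseteq S_n$ is $t$-intersecting if any two of its members agree on at least $t$ points. A $t$-coset is a coset of the pointwise stabilizer of $t$ points, i.e. a set $\{\sigma\in S_n:\sigma(i_k)=j_k,\ k=1,\dots,t\}$ with distinct $i_1,\dots,i_t$ and distinct $j_1,\dots,j_t$. A subset of $S_n$ is non-trivial if it is not contained in any $t$-coset. $d_m=m!\sum_{i=0}^m\frac{(-1)^i}{i!}$ is the $m$-th derangement number. Families $\mathcal F_1,\mathcal F_2\subseteq S_n$ are isomorphic, $\mathcal F_1\cong\mathcal F_2$, if $\mathcal F_2=\{\rho\sigma\pi:\sigma\in\mathcal F_1\}$ for some $\rho,\pi\in S_n$. Define $$\mathcal{H}(n,t)=\{\sigma\in S_n:\sigma(i)=i\text{ for all }i\in[t],\ \sigma(j)=j\text{ for some }j\in\{t+1,\dots,n-1\}\}\cup\{(i\ n):i\in[t]\},$$ where $(i\ n)$ is a transposition. *)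

theory Defs
  imports Complex_Main "HOL-Combinatorics.Permutations"
begin

(* Elements of S_n are functions on nat that permute {1..n}; by the definition of
   permutes they are the identity outside {1..n}, so equality of functions is equality in S_n. *)
definition Sym :: "nat \<Rightarrow> (nat \<Rightarrow> nat) set" where
  "Sym n = {\<sigma>. \<sigma> permutes {1..n}}"

(* Counting agreements only inside {1..n} matters: outside, all members of S_n agree. *)
definition t_intersecting :: "nat \<Rightarrow> nat \<Rightarrow> (nat \<Rightarrow> nat) set \<Rightarrow> bool" where
  "t_intersecting n t F \<longleftrightarrow>
     (\<forall>\<sigma>\<in>F. \<forall>\<tau>\<in>F. t \<le> card {x \<in> {1..n}. \<sigma> x = \<tau> x})"

definition t_coset :: "nat \<Rightarrow> nat \<Rightarrow> (nat \<Rightarrow> nat) set \<Rightarrow> bool" where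
  "t_coset n t C \<longleftrightarrow>
     (\<exists>i j. inj_on i {1..t} \<and> i ` {1..t} \<subseteq> {1..n} \<and>
            inj_on j {1..t} \<and> j ` {1..t} \<subseteq> {1..n} \<and>
            C = {\<sigma> \<in> Sym n. \<forall>k\<in>{1..t}. \<sigma> (i k) = j k})"

definition nontrivial :: "nat \<Rightarrow> nat \<Rightarrow> (nat \<Rightarrow> nat) set \<Rightarrow> bool" where
  "nontrivial n t F \<longleftrightarrow> \<not> (\<exists>C. t_coset n t C \<and> F \<subseteq> C)"

definition derangement_number :: "nat \<Rightarrow> real" where
  "derangement_number m = fact m * (\<Sum>i=0..m. (-1) ^ i / fact i)"

definition isomorphic_families ::
    "nat \<Rightarrow> (nat \<Rightarrow> nat) set \<Rightarrow> (nat \<Rightarrow> nat) set \<Rightarrow> bool" where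
  "isomorphic_families n F\<^sub>1 F\<^sub>2 \<longleftrightarrow>
     (\<exists>\<rho>\<in>Sym n. \<exists>\<pi>\<in>Sym n. F\<^sub>2 = {\<rho> \<circ> \<sigma> \<circ> \<pi> | \<sigma>. \<sigma> \<in> F\<^sub>1})"

definition HM_family :: "nat \<Rightarrow> nat \<Rightarrow> (nat \<Rightarrow> nat) set" where
  "HM_family n t =
     {\<sigma> \<in> Sym n. (\<forall>i\<in>{1..t}. \<sigma> i = i) \<and> (\<exists>j\<in>{t+1..n-1}. \<sigma> j = j)} \<union>
     {Transposition.transpose i n | i. i \<in> {1..t}}"

end

theory Submission
  imports Defs "HOL-Probability.Hoeffding"
begin

text \<open>
  A permutation is identified with its graph, a set of \<open>n\<close> cells of the \<open>n \<times> n\<close> grid. For a family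
  \<open>F\<close> and a set \<open>S\<close> of cells, \<open>link n F S\<close> consists of the members containing \<open>S\<close>, and its density is
  its proportion among all \<open>(n - card S)!\<close> permutations containing \<open>S\<close>.

  The first half of the proof shows that a \<open>t\<close>-intersecting family with at least \<open>0.62 (n - t)!\<close>
  members fills more than half of some \<open>t\<close>-coset (\<open>large_family_concentrates_on_coset\<close>). Call \<open>Q\<close>
  a core if nearly all members contain at least \<open>t\<close> cells of \<open>Q\<close>. The graph of any member is a core of
  size \<open>n\<close>, and the claim is that a core with more than \<open>t\<close> cells can be replaced by a smaller one.
  By pigeonhole some \<open>t\<close>-subset \<open>T\<close> of \<open>Q\<close> has a link of density about \<open>1 / (card Q choose t)\<close>. Adding
  cells to \<open>T\<close> while this multiplies the density by a large factor leads to a set \<open>Q'\<close> beyond which no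
  cell is popular. Densities are at most one, so few cells are added and \<open>Q'\<close> is smaller than \<open>Q\<close>.
  If \<open>Q'\<close> were not a core, the members missing it would also have a fairly dense link at some
  \<open>t\<close>-subset of \<open>Q\<close>. Two such separated links are impossible
  (\<open>no_dense_link_separated_from_spread_link\<close>): all their members would have to agree outside \<open>Q'\<close>.
  The reason is concentration of measure (\<open>cross_agreeing_family_small\<close>). If no cell is contained in
  more than a fraction \<open>K / n\<close> of the members of \<open>A\<close>, then the proportion of members of \<open>A\<close> disjoint from
  a random permutation \<open>b\<close> has mean about \<open>1/e\<close> and changes by at most \<open>2 K / n\<close> when two values of
  \<open>b\<close> are exchanged, so it vanishes only with a probability exponentially small in \<open>n\<close>. All densities
  that occur are at least \<open>exp (- C t log (n / t))\<close>, which is larger once \<open>n / t\<close> exceeds a constant;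
  the constant 400 leaves room for all losses.

  In the second half the members in the dense coset are, after normalization, permutations of a set \<open>R\<close>
  of \<open>m = n - t\<close> points, and by non-triviality there is a member outside. Each outsider restricts the
  members inside to the permutations agreeing with it on \<open>R\<close>. If it moved two of the \<open>t\<close> points, it would
  leave at most half of \<open>m!\<close>. So it moves exactly one, and on \<open>R\<close> it is a partial bijection of size
  \<open>m - 1\<close>, leaving \<open>m! - d\<^sub>m - d\<^sub>m\<^sub>-\<^sub>1\<close> permutations. Two outsiders with different partial bijections
  force a further loss: if they differ in \<open>0.8 m\<close> places the loss is a constant proportion, which
  contradicts the density; so any two agree in many places and there are far fewer than
  \<open>(m - 1)!\<close> of them; but then even one place of difference, which costs at least \<open>d\<^sub>m\<^sub>-\<^sub>1\<close> permutations,
  cannot be compensated. Hence in a family of maximal size all outsiders induce the same partial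
  bijection, there are at most \<open>t\<close> of them, and the family is the Hilton-Milner family up to
  isomorphism.
\<close>

section \<open>Permutations avoiding a partial bijection\<close>

lemma perms_agreeing_eq_image:
  assumes "b permutes R" "C \<subseteq> R"
  shows "{\<sigma>. \<sigma> permutes R \<and> (\<forall>k\<in>C. \<sigma> k = b k)} = (\<lambda>\<pi>. b \<circ> \<pi>) ` {\<pi>. \<pi> permutes R - C}"
proof (intro set_eqI iffI)
  fix \<sigma> assume "\<sigma> \<in> {\<sigma>. \<sigma> permutes R \<and> (\<forall>k\<in>C. \<sigma> k = b k)}"
  then have s: "\<sigma> permutes R" "\<And>k. k \<in> C \<Longrightarrow> \<sigma> k = b k" by auto
  have p: "inv b \<circ> \<sigma> permutes R"
    using s(1) assms(1) permutes_compose permutes_inv by blast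
  have "inv b \<circ> \<sigma> permutes R - C"
    using p by (rule permutes_superset) (use s assms permutes_inverses(2)[OF assms(1)] in auto)
  moreover have "\<sigma> = b \<circ> (inv b \<circ> \<sigma>)"
    using assms(1) by (auto simp: permutes_inverses fun_eq_iff)
  ultimately show "\<sigma> \<in> (\<lambda>\<pi>. b \<circ> \<pi>) ` {\<pi>. \<pi> permutes R - C}" by blast
next
  fix \<sigma> assume "\<sigma> \<in> (\<lambda>\<pi>. b \<circ> \<pi>) ` {\<pi>. \<pi> permutes R - C}"
  then obtain \<pi> where p: "\<pi> permutes R - C" "\<sigma> = b \<circ> \<pi>" by auto
  have "\<pi> permutes R" using p(1) by (rule permutes_subset) auto
  then have "\<sigma> permutes R" using p(2) assms(1) permutes_compose by blast
  moreover have "\<forall>k\<in>C. \<sigma> k = b k" using p by (auto simp: permutes_not_in)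
  ultimately show "\<sigma> \<in> {\<sigma>. \<sigma> permutes R \<and> (\<forall>k\<in>C. \<sigma> k = b k)}" by auto
qed

lemma inj_on_comp_left_permutes: "b permutes R \<Longrightarrow> inj_on (\<lambda>\<pi>. b \<circ> \<pi>) X"
  by (rule inj_onI) (metis comp_assoc id_comp permutes_inv_o(2))

text \<open>
  This lets a partial bijection be treated as the identity after composition with a permutation,
  so that every count below reduces to counting permutations without fixed points in a given set.
\<close>
lemma partial_injection_extends_to_permutation:
  fixes g :: "'a \<Rightarrow> 'a"
  assumes "finite R" "D \<subseteq> R" "inj_on g D" "g ` D \<subseteq> R"
  shows "\<exists>\<gamma>. \<gamma> permutes R \<and> (\<forall>k\<in>D. \<gamma> k = g k)"
proof -
  have "card (R - D) = card (R - g ` D)"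
    using assms by (simp add: card_Diff_subset finite_subset card_image)
  then obtain h where h: "bij_betw h (R - D) (R - g ` D)"
    using assms finite_same_card_bij by (metis finite_Diff)
  define f where "f = (\<lambda>k. if k \<in> D then g k else h k)"
  have "bij_betw f (D \<union> (R - D)) (g ` D \<union> (R - g ` D))"
  proof (rule bij_betw_combine)
    show "bij_betw f D (g ` D)"
      using assms(3) by (auto simp: f_def bij_betw_def inj_on_def)
    show "bij_betw f (R - D) (R - g ` D)"
      using h by (rule bij_betw_cong[THEN iffD1, rotated]) (auto simp: f_def)
  qed auto
  moreover have "D \<union> (R - D) = R" "g ` D \<union> (R - g ` D) = R" using assms by auto
  ultimately have "bij_betw f R R" by simp
  then have "restrict_id f R permutes R" by (rule permutes_restrict_id)
  moreover have "\<forall>k\<in>D. restrict_id f R k = g k" using assms(2) by (auto simp: f_def)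
  ultimately show ?thesis by blast
qed

text \<open>
  For \<open>k \<le> m\<close>, this is the number of permutations of an \<open>m\<close>-set that avoid a given partial bijection
  of size \<open>k\<close>; it interpolates between \<open>m!\<close> and the derangement number. The recursion splits off
  the permutations that use the last pair of the partial bijection. Outside that range the values are
  meaningless.
\<close>
fun avoid_count :: "nat \<Rightarrow> nat \<Rightarrow> real" where
  "avoid_count m 0 = fact m"
| "avoid_count m (Suc k) = avoid_count m k - avoid_count (m - 1) k"

lemma finite_perms_filter: "finite R \<Longrightarrow> finite {\<pi>. \<pi> permutes R \<and> P \<pi>}"
  by (rule finite_subset[OF _ finite_permutations]) auto

lemma card_perms_without_fixpoints_in:
  assumes "finite R" "D \<subseteq> R"
  shows "real (card {\<pi>. \<pi> permutes R \<and> (\<forall>k\<in>D. \<pi> k \<noteq> k)}) = avoid_count (card R) (card D)"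
proof -
  have "finite D" using assms finite_subset by blast
  then show ?thesis using assms
  proof (induction D arbitrary: R rule: finite_induct)
    case empty
    then show ?case by (simp add: card_permutations)
  next
    case (insert d D)
    let ?X = "\<lambda>R D. {\<pi>. \<pi> permutes R \<and> (\<forall>k\<in>D. \<pi> k \<noteq> k)}"
    have "?X R D = ?X R (insert d D) \<union> ?X (R - {d}) D"
    proof (intro set_eqI iffI)
      fix \<pi> assume a: "\<pi> \<in> ?X R D"
      show "\<pi> \<in> ?X R (insert d D) \<union> ?X (R - {d}) D"
      proof (cases "\<pi> d = d")
        case True
        then have "\<pi> permutes R - {d}" using a by (auto intro: permutes_superset)
        then show ?thesis using a by auto
      qed (use a in auto)
    next
      fix \<pi> assume a: "\<pi> \<in> ?X R (insert d D) \<union> ?X (R - {d}) D"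
      then show "\<pi> \<in> ?X R D" using permutes_subset[of \<pi> "R - {d}" R] by auto
    qed
    moreover have "?X R (insert d D) \<inter> ?X (R - {d}) D = {}"
      by (auto simp: permutes_not_in)
    moreover have "finite (?X R (insert d D))" "finite (?X (R - {d}) D)"
      using insert.prems(1) by (auto intro: finite_perms_filter)
    ultimately have "card (?X R D) = card (?X R (insert d D)) + card (?X (R - {d}) D)"
      using card_Un_disjoint[of "?X R (insert d D)" "?X (R - {d}) D"] by presburger
    moreover have "real (card (?X R D)) = avoid_count (card R) (card D)"
      using insert by auto
    moreover have "real (card (?X (R - {d}) D)) = avoid_count (card R - 1) (card D)"
      using insert.IH[of "R - {d}"] insert.prems insert.hyps by (auto simp: card_Diff_singleton)
    ultimately show ?case using insert.hyps by simp
  qed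
qed

lemma avoid_count_nonneg: "k \<le> m \<Longrightarrow> 0 \<le> avoid_count m k"
  using card_perms_without_fixpoints_in[of "{..<m}" "{..<k}", symmetric] by simp

lemma avoid_count_antimono: "k \<le> l \<Longrightarrow> l \<le> m \<Longrightarrow> avoid_count m l \<le> avoid_count m k"
proof (induction l rule: dec_induct)
  case (step j)
  then have "0 \<le> avoid_count (m - 1) j" by (intro avoid_count_nonneg) linarith
  then show ?case using step by simp
qed simp

text \<open>
  Inclusion-exclusion over the used pairs, obtained here by solving the recursion with Pascal's rule.
\<close>
lemma avoid_count_eq_sum:
  "avoid_count m k = (\<Sum>i\<le>k. (-1) ^ i * real (k choose i) * fact (m - i))"
proof (induction k arbitrary: m)
  case (Suc k)
  have A: "(\<Sum>i\<le>Suc k. (-1) ^ i * real (Suc k choose i) * fact (m - i)) =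
     fact m + (\<Sum>i\<le>k. (-1) ^ Suc i * real (Suc k choose Suc i) * fact (m - Suc i))"
    by (subst sum.atMost_Suc_shift) simp
  have B: "avoid_count m k = fact m + (\<Sum>i\<le>k. (-1) ^ Suc i * real (k choose Suc i) * fact (m - Suc i))"
  proof -
    have "avoid_count m k = (\<Sum>i\<le>Suc k. (-1) ^ i * real (k choose i) * fact (m - i))"
      by (simp add: Suc)
    also have "\<dots> = fact m + (\<Sum>i\<le>k. (-1) ^ Suc i * real (k choose Suc i) * fact (m - Suc i))"
      by (subst sum.atMost_Suc_shift) simp
    finally show ?thesis .
  qed
  have C: "avoid_count (m - 1) k = (\<Sum>i\<le>k. (-1) ^ i * real (k choose i) * fact (m - Suc i))"
    by (simp add: Suc)
  show ?case unfolding A avoid_count.simps B C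
    by (simp add: sum.distrib algebra_simps sum_subtractf sum_negf)
qed simp

lemma avoid_count_full: "avoid_count m m = derangement_number m"
proof -
  have "avoid_count m m = (\<Sum>i\<le>m. fact m * ((-1) ^ i / fact i))"
    unfolding avoid_count_eq_sum
  proof (rule sum.cong[OF refl])
    fix i assume "i \<in> {..m}"
    then have "real (m choose i) = fact m / (fact i * fact (m - i))"
      by (simp add: binomial_fact)
    then show "(-1) ^ i * real (m choose i) * fact (m - i) = fact m * ((-1) ^ i / fact i)"
      by (simp add: field_simps)
  qed
  then show ?thesis
    by (simp add: derangement_number_def sum_distrib_left atLeast0AtMost)
qed

lemma avoid_count_all_but_one:
  assumes "m \<ge> 1"
  shows "avoid_count m (m - 1) = derangement_number m + derangement_number (m - 1)"
  using assms avoid_count.simps(2)[of m "m - 1"] by (simp add: avoid_count_full)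

text \<open>
  Prescribing the values on \<open>C\<close> removes these rows and columns, and with them every forbidden pair that
  lies in one of the columns; only the surviving forbidden pairs influence the count. After two
  compositions with permutations these pairs become fixed points.
\<close>
lemma card_perms_prescribed_avoiding:
  assumes R: "finite R" and C: "C \<subseteq> R" and b: "b permutes R"
    and D: "D \<subseteq> R - C" and g: "inj_on g D" "g ` D \<subseteq> R"
  shows "real (card {\<pi>. \<pi> permutes R \<and> (\<forall>k\<in>C. \<pi> k = b k) \<and> (\<forall>k\<in>D. \<pi> k \<noteq> g k)})
       = avoid_count (card R - card C) (card {k\<in>D. g k \<notin> b ` C})"
proof -
  define g' where "g' = inv b \<circ> g"
  define D' where "D' = {k\<in>D. g k \<notin> b ` C}"
  have bij: "bij b" using b permutes_bij by auto
  have invb: "\<And>y. y \<in> R \<Longrightarrow> inv b y \<in> R" using b by (simp add: permutes_in_image permutes_inv)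
  have D'R: "D' \<subseteq> R - C" using D by (auto simp: D'_def)
  have g'img: "g' ` D' \<subseteq> R - C"
  proof
    fix y assume "y \<in> g' ` D'"
    then obtain k where k: "k \<in> D" "g k \<notin> b ` C" "y = inv b (g k)"
      unfolding g'_def D'_def by auto
    have "y \<in> R" using k g invb by auto
    moreover have "y \<notin> C" using k permutes_inverses(1)[OF b, of "g k"] by force
    ultimately show "y \<in> R - C" by auto
  qed
  have "inj_on g' D'"
    unfolding g'_def
  proof (rule comp_inj_on)
    show "inj_on g D'" using g(1) by (rule inj_on_subset) (auto simp: D'_def)
    show "inj_on (inv b) (g ` D')" using permutes_inj_on[OF permutes_inv[OF b]] .
  qed
  then obtain \<gamma> where \<gamma>: "\<gamma> permutes R - C" "\<forall>k\<in>D'. \<gamma> k = g' k"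
    using partial_injection_extends_to_permutation[of "R - C" D' g'] R D'R g'img by auto
  let ?X = "{\<pi>. \<pi> permutes R \<and> (\<forall>k\<in>C. \<pi> k = b k) \<and> (\<forall>k\<in>D. \<pi> k \<noteq> g k)}"
  let ?Y = "{\<pi>. \<pi> permutes R - C \<and> (\<forall>k\<in>D. \<pi> k \<noteq> g' k)}"
  let ?Z = "{\<pi>. \<pi> permutes R - C \<and> (\<forall>k\<in>D'. \<pi> k \<noteq> k)}"
  have "?X = {\<sigma>. \<sigma> permutes R \<and> (\<forall>k\<in>C. \<sigma> k = b k)} \<inter> {\<pi>. \<forall>k\<in>D. \<pi> k \<noteq> g k}" by auto
  also have "\<dots> = (\<lambda>\<pi>. b \<circ> \<pi>) ` ?Y"
  proof -
    have "b y = g k \<longleftrightarrow> y = g' k" for y k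
      unfolding g'_def comp_def using permutes_inverses[OF b] by metis
    then show ?thesis unfolding perms_agreeing_eq_image[OF b C] by auto
  qed
  finally have 1: "card ?X = card ?Y"
    by (simp add: card_image inj_on_comp_left_permutes[OF b])
  have Y: "?Y = (\<lambda>\<pi>. \<gamma> \<circ> \<pi>) ` ?Z"
  proof (intro set_eqI iffI)
    fix \<pi> assume a: "\<pi> \<in> ?Y"
    have "inv \<gamma> \<circ> \<pi> permutes R - C" using a \<gamma>(1) permutes_compose permutes_inv by blast
    moreover have "(inv \<gamma> \<circ> \<pi>) k \<noteq> k" if "k \<in> D'" for k
    proof
      assume "(inv \<gamma> \<circ> \<pi>) k = k"
      then have "\<pi> k = \<gamma> k" using permutes_inverses(1)[OF \<gamma>(1), of "\<pi> k"] by simp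
      then show False using a that \<gamma>(2) by (auto simp: D'_def)
    qed
    moreover have "\<pi> = \<gamma> \<circ> (inv \<gamma> \<circ> \<pi>)" using \<gamma>(1) by (auto simp: fun_eq_iff permutes_inverses)
    ultimately show "\<pi> \<in> (\<lambda>\<pi>. \<gamma> \<circ> \<pi>) ` ?Z" by blast
  next
    fix \<pi> assume "\<pi> \<in> (\<lambda>\<pi>. \<gamma> \<circ> \<pi>) ` ?Z"
    then obtain \<pi>' where p: "\<pi>' permutes R - C" "\<forall>k\<in>D'. \<pi>' k \<noteq> k" "\<pi> = \<gamma> \<circ> \<pi>'" by auto
    have q: "\<pi> permutes R - C" using p \<gamma>(1) permutes_compose by blast
    have "\<pi> k \<noteq> g' k" if "k \<in> D" for k
    proof (cases "k \<in> D'")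
      case True
      then show ?thesis using p(2,3) \<gamma>(2) permutes_inj[OF \<gamma>(1), THEN injD] by fastforce
    next
      case False
      then have "g k \<in> b ` C" using that by (auto simp: D'_def)
      then obtain c where "c \<in> C" "g k = b c" by auto
      then have "g' k \<in> C" using b by (simp add: g'_def permutes_inverses)
      moreover have "\<pi> k \<in> R - C" using q that D by (metis permutes_in_image subsetD)
      ultimately show ?thesis by auto
    qed
    then show "\<pi> \<in> ?Y" using q by auto
  qed
  have "card ?Y = card ?Z" unfolding Y by (rule card_image[OF inj_on_comp_left_permutes[OF \<gamma>(1)]])
  moreover have "real (card ?Z) = avoid_count (card (R - C)) (card D')"
    using R D'R by (intro card_perms_without_fixpoints_in) auto
  moreover have "card (R - C) = card R - card C" using R C by (simp add: card_Diff_subset finite_subset)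
  ultimately show ?thesis using 1 by (simp add: D'_def)
qed

text \<open>
  The ratio is a partial sum of the alternating series of \<open>1/e\<close>. Beyond the sixth partial sum the
  terms are dominated by the telescoping differences \<open>1/j! - 1/(j+1)!\<close>.
\<close>
lemma derangement_ratio_bounds:
  assumes "m \<ge> 6"
  shows "(183/500) * fact m \<le> derangement_number m" "derangement_number m \<le> (37/100) * fact m"
proof -
  define S where "S = (\<lambda>m. \<Sum>i=0..m. (-1) ^ i / fact i :: real)"
  have "\<bar>S m - S 6\<bar> \<le> 1 / fact 6 - 1 / fact m" using assms
  proof (induction m rule: dec_induct)
    case (step j)
    have "S (Suc j) = S j + (-1) ^ Suc j / fact (Suc j)" by (simp add: S_def)
    then have "\<bar>S (Suc j) - S 6\<bar> \<le> \<bar>S j - S 6\<bar> + \<bar>(-1) ^ Suc j / fact (Suc j)\<bar>" by linarith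
    also have "\<bar>(-1) ^ Suc j / fact (Suc j) :: real\<bar> = 1 / fact (Suc j)" by (simp add: abs_mult power_abs)
    also have "1 / fact (Suc j) \<le> (1 / fact j - 1 / fact (Suc j) :: real)"
    proof -
      have "2 / fact (Suc j) \<le> (1 / fact j :: real)"
        using step.hyps by (simp add: divide_le_eq)
      then show ?thesis by simp
    qed
    finally show ?case using step.IH by linarith
  qed simp
  moreover have "S 6 = 265/720" "(fact 6 :: real) = 720" by (simp_all add: S_def eval_nat_numeral)
  moreover have "0 \<le> 1 / (fact m :: real)" by simp
  ultimately have "\<bar>S m - 265/720\<bar> \<le> 1/720" by (simp only:)
  then have "183/500 \<le> S m" "S m \<le> 37/100" unfolding abs_le_iff by argo+
  then show "(183/500) * fact m \<le> derangement_number m" "derangement_number m \<le> (37/100) * fact m"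
    by (simp_all add: derangement_number_def S_def mult.commute)
qed

section \<open>Concentration for functions of a random permutation\<close>

text \<open>
  Hoeffding's lemma for the uniform distribution on a finite set, without centring the variable.
\<close>
lemma hoeffding_lemma_finite_average:
  fixes v :: "'a \<Rightarrow> real"
  assumes Y: "finite Y" "Y \<noteq> {}" and l: "l > 0"
    and osc: "\<And>y y'. y \<in> Y \<Longrightarrow> y' \<in> Y \<Longrightarrow> v y - v y' \<le> c"
  shows "(\<Sum>y\<in>Y. exp (l * v y)) \<le> card Y * exp (l * ((\<Sum>y\<in>Y. v y) / card Y) + l\<^sup>2 * c\<^sup>2 / 8)"
proof -
  define a where "a = Min (v ` Y)"
  define b where "b = Max (v ` Y)"
  let ?M = "measure_pmf (pmf_of_set Y)"
  have bounded: "interval_bounded_random_variable ?M v a b"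
  proof
    show "AE x in ?M. v x \<in> {a..b}"
      using Y by (auto simp: AE_measure_pmf_iff a_def b_def)
  qed auto
  define \<mu> where "\<mu> = (\<Sum>y\<in>Y. v y) / card Y"
  have mu: "\<mu> = integral\<^sup>L ?M v"
    unfolding \<mu>_def using integral_pmf_of_set[OF Y(2,1), of v] by simp
  have "(\<integral>\<^sup>+x. exp (l * (v x - \<mu>)) \<partial>?M) \<le> ennreal (exp (l\<^sup>2 * (b - a)\<^sup>2 / 8))"
    unfolding mu by (rule interval_bounded_random_variable.Hoeffdings_lemma_nn_integral[OF bounded l])
  moreover have "(\<integral>\<^sup>+x. exp (l * (v x - \<mu>)) \<partial>?M) = ennreal ((\<Sum>y\<in>Y. exp (l * (v y - \<mu>))) / card Y)"
    using Y by (simp add: nn_integral_pmf_of_set sum_ennreal sum_nonneg divide_ennreal card_gt_0_iff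
        ennreal_of_nat_eq_real_of_nat)
  ultimately have "(\<Sum>y\<in>Y. exp (l * (v y - \<mu>))) / card Y \<le> exp (l\<^sup>2 * (b - a)\<^sup>2 / 8)"
    by (simp add: ennreal_le_iff)
  also have "b - a \<le> c"
  proof -
    have "a \<in> v ` Y" "b \<in> v ` Y" using Y by (auto simp: a_def b_def)
    then show ?thesis using osc by auto
  qed
  moreover have "a \<le> b" using Y by (auto simp: a_def b_def)
  ultimately have "(\<Sum>y\<in>Y. exp (l * (v y - \<mu>))) / card Y \<le> exp (l\<^sup>2 * c\<^sup>2 / 8)"
    by (smt (verit, best) divide_right_mono exp_le_cancel_iff mult_left_mono power_mono zero_le_power2)
  then have "(\<Sum>y\<in>Y. exp (l * (v y - \<mu>))) \<le> card Y * exp (l\<^sup>2 * c\<^sup>2 / 8)"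
    using Y by (simp add: divide_le_eq card_gt_0_iff mult.commute)
  moreover have "(\<Sum>y\<in>Y. exp (l * v y)) = exp (l * \<mu>) * (\<Sum>y\<in>Y. exp (l * (v y - \<mu>)))"
    by (simp add: sum_distrib_left algebra_simps flip: exp_add)
  ultimately have "(\<Sum>y\<in>Y. exp (l * v y)) \<le> exp (l * \<mu>) * (card Y * exp (l\<^sup>2 * c\<^sup>2 / 8))"
    by simp
  then show ?thesis by (simp add: exp_add \<mu>_def mult_ac)
qed

text \<open>
  A martingale bound of Azuma-Hoeffding type: reveal a uniformly random permutation one value at a
  time. Conditioning on two different values \<open>y\<close>, \<open>y'\<close> of the point \<open>x\<close> gives two copies of the
  permutations of \<open>R\<close>, matched by one transposition of values, so the conditional means differ by at
  most \<open>c\<close>. Hoeffding's lemma then contributes one factor \<open>exp (l\<^sup>2 c\<^sup>2 / 8)\<close> per revealed value.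
\<close>
lemma permutation_exponential_moment:
  fixes h :: "('a \<Rightarrow> 'a) \<Rightarrow> real" and c :: real
  assumes "finite R" and l: "l > 0"
    and "\<And>\<pi> y y'. \<pi> permutes R \<Longrightarrow> y \<in> R \<Longrightarrow> y' \<in> R \<Longrightarrow> \<bar>h \<pi> - h (Transposition.transpose y y' \<circ> \<pi>)\<bar> \<le> c"
  shows "(\<Sum>\<pi> | \<pi> permutes R. exp (l * h \<pi>))
      \<le> fact (card R) * exp (l * ((\<Sum>\<pi> | \<pi> permutes R. h \<pi>) / fact (card R)) + l\<^sup>2 * c\<^sup>2 * card R / 8)"
  using assms(1,3)
proof (induction R arbitrary: h rule: finite_induct)
  case empty
  then show ?case by simp
next
  case (insert x R)
  define H where "H = (\<lambda>y \<pi>. h (Transposition.transpose x y \<circ> \<pi>))"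
  define k where "k = card R"
  define M where "M = (\<lambda>y. (\<Sum>\<pi> | \<pi> permutes R. H y \<pi>) / fact k)"
  have comp: "Transposition.transpose x y \<circ> \<pi> permutes insert x R" if "y \<in> insert x R" "\<pi> permutes R" for y \<pi>
    using that permutes_compose[OF permutes_subset[OF that(2)] permutes_swap_id] by blast
  have IH: "(\<Sum>\<pi> | \<pi> permutes R. exp (l * H y \<pi>)) \<le> fact k * exp (l * M y + l\<^sup>2 * c\<^sup>2 * k / 8)"
    if y: "y \<in> insert x R" for y
    unfolding M_def k_def
  proof (rule insert.IH)
    fix \<pi> z z' assume a: "\<pi> permutes R" "z \<in> R" "z' \<in> R"
    let ?t = "Transposition.transpose x y"
    have "?t \<circ> (Transposition.transpose z z' \<circ> \<pi>) = Transposition.transpose (?t z) (?t z') \<circ> (?t \<circ> \<pi>)"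
      by (auto simp: fun_eq_iff Transposition.transpose_def)
    moreover have "?t z \<in> insert x R" "?t z' \<in> insert x R" using a y by (auto simp: Transposition.transpose_def)
    ultimately show "\<bar>H y \<pi> - H y (Transposition.transpose z z' \<circ> \<pi>)\<bar> \<le> c"
      unfolding H_def using insert.prems[OF comp[OF y a(1)]] by metis
  qed
  have osc: "M y - M y' \<le> c" if y: "y \<in> insert x R" "y' \<in> insert x R" for y y'
  proof -
    define s where "s = Transposition.transpose x y' \<circ> (Transposition.transpose y y' \<circ> Transposition.transpose x y)"
    have "s permutes insert x R"
      unfolding s_def using y by (intro permutes_compose permutes_swap_id) auto
    then have s: "s permutes R"
      by (rule permutes_superset) (use y in \<open>auto simp: s_def Transposition.transpose_def\<close>)
    have "(\<Sum>\<pi> | \<pi> permutes R. H y' \<pi>) = (\<Sum>\<pi> | \<pi> permutes R. H y' (s \<circ> \<pi>))"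
      by (rule setum_permutations_compose_left[OF s])
    then have "(\<Sum>\<pi> | \<pi> permutes R. H y \<pi>) - (\<Sum>\<pi> | \<pi> permutes R. H y' \<pi>)
        = (\<Sum>\<pi> | \<pi> permutes R. H y \<pi> - H y' (s \<circ> \<pi>))"
      by (simp add: sum_subtractf)
    also have "\<dots> \<le> (\<Sum>\<pi> | \<pi> permutes R. c)"
    proof (rule sum_mono)
      fix \<pi> assume "\<pi> \<in> {\<pi>. \<pi> permutes R}"
      moreover have "Transposition.transpose x y' \<circ> (s \<circ> \<pi>) = Transposition.transpose y y' \<circ> (Transposition.transpose x y \<circ> \<pi>)"
        by (auto simp: s_def fun_eq_iff)
      ultimately show "H y \<pi> - H y' (s \<circ> \<pi>) \<le> c"
        using insert.prems[OF comp[OF y(1)], of \<pi> y y'] y unfolding H_def by fastforce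
    qed
    also have "\<dots> = fact k * c" using insert.hyps by (simp add: card_permutations k_def)
    finally show ?thesis by (simp add: M_def field_simps)
  qed
  have "(\<Sum>\<pi> | \<pi> permutes insert x R. exp (l * h \<pi>))
      = (\<Sum>y\<in>insert x R. \<Sum>\<pi> | \<pi> permutes R. exp (l * H y \<pi>))"
    using sum_over_permutations_insert[OF insert.hyps, of "\<lambda>\<pi>. exp (l * h \<pi>)"] by (simp add: H_def)
  also have "\<dots> \<le> (\<Sum>y\<in>insert x R. fact k * exp (l * M y + l\<^sup>2 * c\<^sup>2 * k / 8))"
    by (rule sum_mono) (rule IH)
  also have "\<dots> = fact k * exp (l\<^sup>2 * c\<^sup>2 * k / 8) * (\<Sum>y\<in>insert x R. exp (l * M y))"
    by (simp add: sum_distrib_left sum_distrib_right exp_add mult_ac)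
  also have "\<dots> \<le> fact k * exp (l\<^sup>2 * c\<^sup>2 * k / 8) * (card (insert x R) *
      exp (l * ((\<Sum>y\<in>insert x R. M y) / card (insert x R)) + l\<^sup>2 * c\<^sup>2 / 8))"
    by (intro mult_left_mono hoeffding_lemma_finite_average) (use insert.hyps l osc in auto)
  also have "\<dots> = fact (card (insert x R)) * exp (l * ((\<Sum>y\<in>insert x R. M y) / card (insert x R))
      + l\<^sup>2 * c\<^sup>2 * card (insert x R) / 8)"
  proof -
    have e: "l\<^sup>2 * c\<^sup>2 * card (insert x R) / 8 = l\<^sup>2 * c\<^sup>2 * k / 8 + l\<^sup>2 * c\<^sup>2 / 8"
      using insert.hyps by (simp add: k_def field_simps)
    have f: "fact (card (insert x R)) = real (card (insert x R)) * fact k"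
      using insert.hyps by (simp add: k_def)
    show ?thesis unfolding e f exp_add by (simp only: mult_ac)
  qed
  also have "(\<Sum>y\<in>insert x R. M y) / card (insert x R)
     = (\<Sum>\<pi> | \<pi> permutes insert x R. h \<pi>) / fact (card (insert x R))"
    using sum_over_permutations_insert[OF insert.hyps, of h] insert.hyps
    by (simp add: M_def H_def k_def sum_divide_distrib[symmetric] field_simps)
  finally show ?case .
qed

text \<open>
  Markov's inequality for the exponential moment of \<open>- h\<close>. A function that is positive on average and
  changes little under transpositions vanishes only on an exponentially small set.
\<close>
lemma permutation_lower_tail:
  fixes h :: "('a \<Rightarrow> 'a) \<Rightarrow> real" and c \<mu> :: real
  assumes R: "finite R" "R \<noteq> {}" and c: "c > 0" and \<mu>: "\<mu> > 0"
    and lip: "\<And>\<pi> y y'. \<pi> permutes R \<Longrightarrow> y \<in> R \<Longrightarrow> y' \<in> R \<Longrightarrow> \<bar>h \<pi> - h (Transposition.transpose y y' \<circ> \<pi>)\<bar> \<le> c"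
    and mean: "(\<Sum>\<pi> | \<pi> permutes R. h \<pi>) \<ge> \<mu> * fact (card R)"
    and B: "B \<subseteq> {\<pi>. \<pi> permutes R}" "\<And>\<pi>. \<pi> \<in> B \<Longrightarrow> h \<pi> = 0"
  shows "card B \<le> fact (card R) * exp (- 2 * \<mu>\<^sup>2 / (card R * c\<^sup>2))"
proof -
  define N where "N = real (card R)"
  have N: "N > 0" using R by (simp add: N_def card_gt_0_iff)
  \<comment> \<open>the minimizer of the quadratic exponent in \<open>l\<close>\<close>
  define l where "l = 4 * \<mu> / (N * c\<^sup>2)"
  have l: "l > 0" using N c \<mu> by (simp add: l_def)
  have "real (card B) = (\<Sum>\<pi>\<in>B. exp (l * - h \<pi>))" using B(2) by simp
  also have "\<dots> \<le> (\<Sum>\<pi> | \<pi> permutes R. exp (l * - h \<pi>))"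
    using B(1) R by (intro sum_mono2) (auto simp: finite_permutations)
  also have "\<dots> \<le> fact (card R) * exp (l * ((\<Sum>\<pi> | \<pi> permutes R. - h \<pi>) / fact (card R)) + l\<^sup>2 * c\<^sup>2 * card R / 8)"
    by (rule permutation_exponential_moment[OF R(1) l]) (use lip in \<open>simp add: abs_minus_commute\<close>)
  also have "\<dots> \<le> fact (card R) * exp (l * (- \<mu>) + l\<^sup>2 * c\<^sup>2 * N / 8)"
  proof -
    have "(\<Sum>\<pi> | \<pi> permutes R. - h \<pi>) / fact (card R) \<le> - \<mu>"
      using mean by (simp add: sum_negf field_simps)
    then have "l * ((\<Sum>\<pi> | \<pi> permutes R. - h \<pi>) / fact (card R)) \<le> l * (- \<mu>)"
      using l by (intro mult_left_mono) auto
    then show ?thesis by (simp add: N_def)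
  qed
  also have "l * (- \<mu>) + l\<^sup>2 * c\<^sup>2 * N / 8 = - 2 * \<mu>\<^sup>2 / (N * c\<^sup>2)"
    using N c by (simp add: l_def field_simps power2_eq_square)
  finally show ?thesis by (simp add: N_def)
qed

section \<open>Graphs of permutations and cross-agreeing families\<close>

text \<open>
  The graph of a permutation as a set of cells of the \<open>n \<times> n\<close> grid. Agreements of permutations become
  intersections of graphs, and \<open>t\<close>-cosets become the permutations containing a given set of \<open>t\<close> cells.
\<close>
definition gr :: "nat \<Rightarrow> (nat \<Rightarrow> nat) \<Rightarrow> (nat \<times> nat) set" where
  "gr n \<sigma> = (\<lambda>k. (k, \<sigma> k)) ` {1..n}"

lemma mem_gr [simp]: "(k, v) \<in> gr n \<sigma> \<longleftrightarrow> k \<in> {1..n} \<and> v = \<sigma> k"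
  by (auto simp: gr_def)

lemma finite_gr [simp]: "finite (gr n \<sigma>)" by (simp add: gr_def)

lemma card_gr [simp]: "card (gr n \<sigma>) = n"
  by (simp add: gr_def card_image inj_on_def)

lemma card_gr_Int: "card (gr n \<sigma> \<inter> gr n \<tau>) = card {x \<in> {1..n}. \<sigma> x = \<tau> x}"
proof -
  have "gr n \<sigma> \<inter> gr n \<tau> = (\<lambda>k. (k, \<sigma> k)) ` {x \<in> {1..n}. \<sigma> x = \<tau> x}" by (auto simp: gr_def)
  then show ?thesis by (simp add: card_image inj_on_def)
qed

lemma finite_Sym [simp]: "finite (Sym n)"
  by (simp add: Sym_def finite_permutations)

lemma finite_family: "F \<subseteq> Sym n \<Longrightarrow> finite F"
  using finite_Sym finite_subset by blast

lemma card_fst_image_gr: "S \<subseteq> gr n \<sigma> \<Longrightarrow> card (fst ` S) = card S"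
proof (rule card_image, rule inj_onI)
  fix x y assume "S \<subseteq> gr n \<sigma>" "x \<in> S" "y \<in> S" "fst x = fst y"
  then have "x \<in> gr n \<sigma>" "y \<in> gr n \<sigma>" by auto
  then show "x = y" using \<open>fst x = fst y\<close> by (cases x; cases y) simp
qed

lemma coset_eq_image:
  assumes "b \<in> Sym n" "S \<subseteq> gr n b"
  shows "{\<sigma> \<in> Sym n. S \<subseteq> gr n \<sigma>} = (\<lambda>\<pi>. b \<circ> \<pi>) ` {\<pi>. \<pi> permutes {1..n} - fst ` S}"
proof -
  have "S \<subseteq> gr n \<sigma> \<longleftrightarrow> (\<forall>k\<in>fst ` S. \<sigma> k = b k)" for \<sigma>
    using assms(2) by (fastforce simp: gr_def)
  moreover have "fst ` S \<subseteq> {1..n}" using assms(2) by (auto simp: gr_def)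
  ultimately show ?thesis
    using perms_agreeing_eq_image[of b "{1..n}" "fst ` S"] assms(1) by (simp add: Sym_def)
qed

lemma card_rows_complement:
  assumes "S \<subseteq> gr n b"
  shows "card ({1..n} - fst ` S) = n - card S"
proof -
  have "fst ` S \<subseteq> {1..n}" using assms by (auto simp: gr_def)
  then show ?thesis using card_fst_image_gr[OF assms] by (simp add: card_Diff_subset finite_subset)
qed

text \<open>
  The analytic core of the proof. Let \<open>h(\<pi>)\<close> be the proportion of those \<open>a \<in> A\<close> that have no agreement
  with \<open>b0 \<circ> \<pi>\<close> off \<open>S\<close> and \<open>S'\<close>. Its mean is at least the proportion of derangements, since a fixed
  \<open>a\<close> forbids at most one value per row. Composing \<open>\<pi>\<close> with a transposition changes two cells, and
  each of them lies in at most a fraction \<open>\<theta>\<close> of the members of \<open>A\<close>; so \<open>h\<close> changes by at most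
  \<open>2 \<theta>\<close>. But \<open>h\<close> vanishes on \<open>B\<close>, which is therefore exponentially small.
\<close>
lemma cross_agreeing_family_small:
  fixes \<theta> :: real
  assumes A: "A \<noteq> {}" "A \<subseteq> Sym n" and \<theta>: "\<theta> > 0"
    and spread: "\<And>x. x \<notin> S \<Longrightarrow> card {a\<in>A. x \<in> gr n a} \<le> \<theta> * card A"
    and b0: "b0 \<in> Sym n" "S' \<subseteq> gr n b0" and n: "card S' + 6 \<le> n"
    and B: "B \<subseteq> {b \<in> Sym n. S' \<subseteq> gr n b}"
    and hit: "\<And>a b. a \<in> A \<Longrightarrow> b \<in> B \<Longrightarrow> \<exists>x\<in>gr n a \<inter> gr n b. x \<notin> S \<and> x \<notin> S'"
  shows "card B \<le> fact (n - card S') * exp (- 2 * (183/500)\<^sup>2 / ((n - card S') * (2 * \<theta>)\<^sup>2))"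
proof -
  have finA: "finite A" using A(2) by (rule finite_family)
  define cA where "cA = real (card A)"
  have cA: "cA > 0" using A finA by (simp add: cA_def card_gt_0_iff)
  define R where "R = {1..n} - fst ` S'"
  have finR: "finite R" by (simp add: R_def)
  have cR: "card R = n - card S'" unfolding R_def by (rule card_rows_complement[OF b0(2)])
  have Rne: "R \<noteq> {}" using cR n by auto
  have b0perm: "b0 permutes {1..n}" using b0 by (simp add: Sym_def)
  define Hit where "Hit = (\<lambda>k v. {a\<in>A. a k = v \<and> (k, v) \<notin> S})"
  define good where "good = (\<lambda>\<pi>. {a\<in>A. \<forall>k\<in>R. a \<notin> Hit k (b0 (\<pi> k))})"
  define h where "h = (\<lambda>\<pi>. card (good \<pi>) / cA)"
  have Hit_le: "card (Hit k v) \<le> \<theta> * cA" if "k \<in> R" for k v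
  proof (cases "(k, v) \<in> S")
    case True
    then show ?thesis using \<theta> cA by (simp add: Hit_def)
  next
    case False
    have "card (Hit k v) \<le> card {a\<in>A. (k, v) \<in> gr n a}"
      using that finA by (intro card_mono) (auto simp: Hit_def R_def)
    then show ?thesis using spread[OF False] by (simp add: cA_def)
  qed
  have lip1: "h \<pi> \<le> h (Transposition.transpose y y' \<circ> \<pi>) + 2 * \<theta>"
    if p: "\<pi> permutes R" "y \<in> R" "y' \<in> R" for \<pi> y y'
  proof -
    define \<pi>' where "\<pi>' = Transposition.transpose y y' \<circ> \<pi>"
    define k1 where "k1 = inv \<pi> y"
    define k2 where "k2 = inv \<pi> y'"
    have k: "k1 \<in> R" "k2 \<in> R" using p by (auto simp: k1_def k2_def permutes_in_image permutes_inv)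
    have same: "\<pi>' k = \<pi> k" if "k \<noteq> k1" "k \<noteq> k2" for k
    proof -
      have "\<pi> k \<noteq> y" "\<pi> k \<noteq> y'"
        using that permutes_inverses(2)[OF p(1), of k] by (auto simp: k1_def k2_def)
      then show ?thesis by (simp add: \<pi>'_def)
    qed
    have "good \<pi> \<subseteq> good \<pi>' \<union> (Hit k1 (b0 (\<pi>' k1)) \<union> Hit k2 (b0 (\<pi>' k2)))"
    proof
      fix a assume a: "a \<in> good \<pi>"
      show "a \<in> good \<pi>' \<union> (Hit k1 (b0 (\<pi>' k1)) \<union> Hit k2 (b0 (\<pi>' k2)))"
      proof (cases "a \<in> good \<pi>'")
        case False
        then obtain k' where k': "k' \<in> R" "a \<in> Hit k' (b0 (\<pi>' k'))" using a by (auto simp: good_def)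
        have "k' = k1 \<or> k' = k2"
        proof (rule ccontr)
          assume "\<not> ?thesis"
          then have "\<pi>' k' = \<pi> k'" using same by auto
          then show False using k' a by (auto simp: good_def)
        qed
        then show ?thesis using k' by auto
      qed simp
    qed
    then have "card (good \<pi>) \<le> card (good \<pi>' \<union> (Hit k1 (b0 (\<pi>' k1)) \<union> Hit k2 (b0 (\<pi>' k2))))"
      by (rule card_mono[rotated]) (use finA in \<open>auto simp: good_def Hit_def\<close>)
    also have "\<dots> \<le> card (good \<pi>') + (card (Hit k1 (b0 (\<pi>' k1))) + card (Hit k2 (b0 (\<pi>' k2))))"
      by (meson add_left_mono card_Un_le order_trans)
    finally have "real (card (good \<pi>)) \<le> card (good \<pi>') + 2 * \<theta> * cA"
      using Hit_le[OF k(1), of "b0 (\<pi>' k1)"] Hit_le[OF k(2), of "b0 (\<pi>' k2)"] by linarith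
    then show ?thesis using cA by (simp add: h_def field_simps flip: \<pi>'_def)
  qed
  have lip: "\<bar>h \<pi> - h (Transposition.transpose y y' \<circ> \<pi>)\<bar> \<le> 2 * \<theta>"
    if p: "\<pi> permutes R" "y \<in> R" "y' \<in> R" for \<pi> y y'
  proof -
    let ?\<pi>' = "Transposition.transpose y y' \<circ> \<pi>"
    have "?\<pi>' permutes R" using permutes_compose[OF p(1) permutes_swap_id[OF p(2,3)]] .
    moreover have "Transposition.transpose y y' \<circ> ?\<pi>' = \<pi>" by (simp add: fun_eq_iff)
    ultimately have "h ?\<pi>' \<le> h \<pi> + 2 * \<theta>" using lip1[of ?\<pi>' y y'] p by simp
    then show ?thesis using lip1[OF p] by linarith
  qed
  have mean: "(\<Sum>\<pi> | \<pi> permutes R. h \<pi>) \<ge> (183/500) * fact (card R)"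
  proof -
    have each: "real (card {\<pi>. \<pi> permutes R \<and> a \<in> good \<pi>}) \<ge> (183/500) * fact (card R)" if a: "a \<in> A" for a
    proof -
      define g where "g = inv b0 \<circ> a"
      define D where "D = {k\<in>R. g k \<in> R}"
      have aperm: "a permutes {1..n}" using a A by (auto simp: Sym_def)
      have "inj g" unfolding g_def using aperm b0perm
        by (meson inj_compose permutes_inj permutes_inv)
      then have g: "inj_on g D" "g ` D \<subseteq> R" by (auto simp: D_def intro: inj_on_subset)
      have "(183/500) * fact (card R) \<le> avoid_count (card R) (card R)"
        unfolding avoid_count_full using derangement_ratio_bounds(1)[of "card R"] cR n by simp
      also have "\<dots> \<le> avoid_count (card R) (card D)"
        by (rule avoid_count_antimono) (auto simp: D_def intro!: card_mono finR)
      also have "\<dots> = card {\<pi>. \<pi> permutes R \<and> (\<forall>k\<in>D. \<pi> k \<noteq> g k)}"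
        using card_perms_prescribed_avoiding[OF finR empty_subsetI permutes_id _ g] by (simp add: D_def)
      also have "\<dots> \<le> card {\<pi>. \<pi> permutes R \<and> a \<in> good \<pi>}"
      proof (intro of_nat_mono card_mono finite_perms_filter finR, intro subsetI CollectI)
        fix \<pi> assume \<pi>: "\<pi> \<in> {\<pi>. \<pi> permutes R \<and> (\<forall>k\<in>D. \<pi> k \<noteq> g k)}"
        have "a k \<noteq> b0 (\<pi> k)" if k: "k \<in> R" for k
        proof
          assume "a k = b0 (\<pi> k)"
          then have "g k = \<pi> k" using permutes_inverses(2)[OF b0perm] by (simp add: g_def)
          moreover have "\<pi> k \<in> R" using \<pi> k by (simp add: permutes_in_image)
          ultimately show False using \<pi> k by (auto simp: D_def)
        qed
        then show "\<pi> permutes R \<and> a \<in> good \<pi>" using \<pi> a by (auto simp: good_def Hit_def)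
      qed
      finally show ?thesis .
    qed
    have "cA * ((183/500) * fact (card R)) \<le> (\<Sum>a\<in>A. real (card {\<pi>. \<pi> permutes R \<and> a \<in> good \<pi>}))"
      unfolding cA_def using sum_mono[of A "\<lambda>_. (183/500) * fact (card R)", OF each] by simp
    also have "\<dots> = (\<Sum>a\<in>A. \<Sum>\<pi> | \<pi> permutes R. if a \<in> good \<pi> then 1 else 0)"
    proof (rule sum.cong[OF refl])
      fix a
      have "(\<Sum>\<pi> | \<pi> permutes R. if a \<in> good \<pi> then 1 else 0)
          = (\<Sum>\<pi>\<in>{\<pi> \<in> {\<pi>. \<pi> permutes R}. a \<in> good \<pi>}. 1::real)"
        by (rule sum.inter_filter[symmetric]) (simp add: finR finite_permutations)
      then show "real (card {\<pi>. \<pi> permutes R \<and> a \<in> good \<pi>})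
          = (\<Sum>\<pi> | \<pi> permutes R. if a \<in> good \<pi> then 1 else 0)" by simp
    qed
    also have "\<dots> = (\<Sum>\<pi> | \<pi> permutes R. \<Sum>a\<in>A. if a \<in> good \<pi> then 1 else 0)"
      by (rule sum.swap)
    also have "\<dots> = (\<Sum>\<pi> | \<pi> permutes R. real (card (good \<pi>)))"
    proof (rule sum.cong[OF refl])
      fix \<pi>
      have "good \<pi> = {a\<in>A. a \<in> good \<pi>}" by (auto simp: good_def)
      moreover have "(\<Sum>a\<in>A. if a \<in> good \<pi> then 1 else 0) = (\<Sum>a\<in>{a\<in>A. a \<in> good \<pi>}. 1::real)"
        by (rule sum.inter_filter[symmetric]) (rule finA)
      ultimately show "(\<Sum>a\<in>A. if a \<in> good \<pi> then 1 else 0) = real (card (good \<pi>))" by simp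
    qed
    also have "\<dots> = cA * (\<Sum>\<pi> | \<pi> permutes R. h \<pi>)"
      using cA by (simp add: h_def sum_distrib_left)
    finally show ?thesis using cA by simp
  qed
  define P where "P = {\<pi>. \<pi> permutes R \<and> b0 \<circ> \<pi> \<in> B}"
  have "B = (\<lambda>\<pi>. b0 \<circ> \<pi>) ` P"
    using B unfolding coset_eq_image[OF b0] by (auto simp: P_def R_def)
  then have "card B = card P" by (simp add: card_image inj_on_comp_left_permutes[OF b0perm])
  also have "real (card P) \<le> fact (card R) * exp (- 2 * (183/500)\<^sup>2 / (card R * (2 * \<theta>)\<^sup>2))"
  proof (rule permutation_lower_tail[OF finR Rne _ _ lip mean])
    show "h \<pi> = 0" if "\<pi> \<in> P" for \<pi>
    proof -
      have "a \<notin> good \<pi>" if a: "a \<in> A" for a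
      proof -
        from \<open>\<pi> \<in> P\<close> have bB: "b0 \<circ> \<pi> \<in> B" by (simp add: P_def)
        obtain k where k: "k \<in> {1..n}" "a k = b0 (\<pi> k)" "(k, a k) \<notin> S" "(k, a k) \<notin> S'"
        proof -
          obtain x where "x \<in> gr n a" "x \<in> gr n (b0 \<circ> \<pi>)" "x \<notin> S" "x \<notin> S'"
            using hit[OF a bB] by blast
          then show thesis using that[of "fst x"] by (cases x) auto
        qed
        have "k \<notin> fst ` S'"
        proof
          assume "k \<in> fst ` S'"
          then obtain v where "(k, v) \<in> S'" by auto
          moreover from this have "(k, v) \<in> gr n (b0 \<circ> \<pi>)" using B bB by blast
          then have "v = b0 (\<pi> k)" by simp
          ultimately show False using k by auto
        qed
        then have "k \<in> R" using k by (simp add: R_def)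
        then show ?thesis using k a by (auto simp: good_def Hit_def)
      qed
      then have "good \<pi> = {}" by (auto simp: good_def)
      then show ?thesis by (simp add: h_def)
    qed
  qed (use \<theta> in \<open>auto simp: P_def\<close>)
  finally show ?thesis by (simp add: cR)
qed

section \<open>Density increments\<close>

definition link :: "nat \<Rightarrow> (nat \<Rightarrow> nat) set \<Rightarrow> (nat \<times> nat) set \<Rightarrow> (nat \<Rightarrow> nat) set" where
  "link n F S = {\<sigma> \<in> F. S \<subseteq> gr n \<sigma>}"

text \<open>
  Density relative to the coset of all permutations that contain \<open>S\<close>. It is at most one, which is
  what stops the density increments below.
\<close>
definition dens :: "nat \<Rightarrow> (nat \<Rightarrow> nat) set \<Rightarrow> (nat \<times> nat) set \<Rightarrow> real" where
  "dens n F S = card (link n F S) / fact (n - card S)"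

lemma card_link_le:
  assumes "F \<subseteq> Sym n"
  shows "card (link n F S) \<le> fact (n - card S)"
proof (cases "link n F S = {}")
  case False
  then obtain b where b: "b \<in> Sym n" "S \<subseteq> gr n b" using assms by (auto simp: link_def)
  have "link n F S \<subseteq> {\<sigma> \<in> Sym n. S \<subseteq> gr n \<sigma>}" using assms by (auto simp: link_def)
  then have "card (link n F S) \<le> card ((\<lambda>\<pi>. b \<circ> \<pi>) ` {\<pi>. \<pi> permutes {1..n} - fst ` S})"
    unfolding coset_eq_image[OF b] by (rule card_mono[rotated]) (simp add: finite_permutations)
  also have "\<dots> \<le> card {\<pi>. \<pi> permutes {1..n} - fst ` S}"
    by (rule card_image_le) (simp add: finite_permutations)
  also have "\<dots> = fact (n - card S)"
    using card_rows_complement[OF b(2)] by (intro card_permutations) auto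
  finally show ?thesis .
qed simp

lemma dens_le_1: "F \<subseteq> Sym n \<Longrightarrow> dens n F S \<le> 1"
  using card_link_le[of F n S, THEN of_nat_mono[where 'a=real]]
  by (simp add: dens_def divide_le_eq)

lemma card_le_if_link_nonempty:
  assumes "link n F S \<noteq> {}"
  shows "finite S" "card S \<le> n"
proof -
  obtain \<sigma> where "S \<subseteq> gr n \<sigma>" using assms by (auto simp: link_def)
  then show "finite S" "card S \<le> n"
    using finite_subset[OF _ finite_gr] card_mono[of "gr n \<sigma>" S] by auto
qed

text \<open>
  Density increment: as long as some further cell raises the density by more than a factor \<open>K\<close>, add
  it. The process stops at a set \<open>S\<close> for which every cell off \<open>S\<close> lies in at most a fraction
  \<open>K / (n - card S)\<close> of the remaining family. Since densities never exceed one, few cells are added.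
\<close>
lemma spread_extension_exists:
  fixes K :: real
  assumes F: "F \<subseteq> Sym n" and T: "link n F T \<noteq> {}" and K: "K \<ge> 1"
  obtains S where "T \<subseteq> S" "link n F S \<noteq> {}" "K ^ (card S - card T) * dens n F T \<le> dens n F S"
    "\<And>x. x \<notin> S \<Longrightarrow> card (link n F (insert x S)) * (n - card S) \<le> K * card (link n F S)"
proof -
  have "\<exists>S. T \<subseteq> S \<and> link n F S \<noteq> {} \<and> K ^ (card S - card T) * dens n F T \<le> dens n F S \<and>
    (\<forall>x. x \<notin> S \<longrightarrow> card (link n F (insert x S)) * (n - card S) \<le> K * card (link n F S))"
    using T
  proof (induction "n - card T" arbitrary: T rule: less_induct)
    case less
    show ?case
    proof (cases "\<forall>x. x \<notin> T \<longrightarrow> card (link n F (insert x T)) * (n - card T) \<le> K * card (link n F T)")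
      case True
      then show ?thesis using less.prems by (intro exI[of _ T]) auto
    next
      case False
      then obtain x where x: "x \<notin> T" "card (link n F (insert x T)) * (n - card T) > K * card (link n F T)"
        by (auto simp: not_le)
      have "link n F (insert x T) \<noteq> {}" using x(2) K by (auto simp: mult_less_0_iff)
      note ne = this card_le_if_link_nonempty[OF this] card_le_if_link_nonempty[OF less.prems]
      have cT: "card (insert x T) = Suc (card T)" using x(1) ne by simp
      then have lt: "card T < n" using ne by simp
      obtain S where S: "insert x T \<subseteq> S" "link n F S \<noteq> {}"
        "K ^ (card S - card (insert x T)) * dens n F (insert x T) \<le> dens n F S"
        "\<forall>y. y \<notin> S \<longrightarrow> card (link n F (insert y S)) * (n - card S) \<le> K * card (link n F S)"
      proof -
        have "n - card (insert x T) < n - card T" using cT lt by simp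
        from less.hyps[OF this ne(1)] show thesis using that by blast
      qed
      have "K * dens n F T \<le> dens n F (insert x T)"
      proof -
        have f: "(fact (n - card T) :: real) = (n - card T) * fact (n - card T - 1)"
          using lt by (simp add: fact_reduce)
        have "K * dens n F T = K * card (link n F T) / ((n - card T) * fact (n - card T - 1))"
          by (simp add: dens_def f)
        also have "\<dots> \<le> (card (link n F (insert x T)) * (n - card T)) / ((n - card T) * fact (n - card T - 1))"
          using x(2) by (intro divide_right_mono) auto
        also have "\<dots> = dens n F (insert x T)" using lt cT by (simp add: dens_def)
        finally show ?thesis .
      qed
      moreover have "card S \<ge> Suc (card T)"
        using card_mono[OF card_le_if_link_nonempty(1)[OF S(2)] S(1)] cT by simp
      then have "card S - card T = Suc (card S - card (insert x T))" using cT by simp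
      ultimately have "K ^ (card S - card T) * dens n F T
          \<le> K ^ (card S - card (insert x T)) * dens n F (insert x T)"
        using K by (simp add: mult.assoc mult.left_commute mult_left_mono)
      then show ?thesis using S by (intro exI[of _ S]) auto
    qed
  qed
  then show ?thesis using that by blast
qed

lemma finite_link [simp]: "finite F \<Longrightarrow> finite (link n F S)" by (simp add: link_def)

lemma link_insert: "link n F (insert x S) = {\<sigma> \<in> link n F S. x \<in> gr n \<sigma>}"
  by (auto simp: link_def)

lemma half_avoids_few_light_cells:
  fixes c :: real
  assumes "finite H" "finite X" "\<And>x. x \<in> X \<Longrightarrow> card {\<sigma>\<in>H. x \<in> gr n \<sigma>} \<le> c * card H"
    and "card X * c \<le> 1/2"
  shows "card H \<le> 2 * real (card {\<sigma>\<in>H. gr n \<sigma> \<inter> X = {}})"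
proof -
  let ?good = "{\<sigma>\<in>H. gr n \<sigma> \<inter> X = {}}"
  have "H \<subseteq> ?good \<union> (\<Union>x\<in>X. {\<sigma>\<in>H. x \<in> gr n \<sigma>})" by blast
  then have "card H \<le> card (?good \<union> (\<Union>x\<in>X. {\<sigma>\<in>H. x \<in> gr n \<sigma>}))"
    by (rule card_mono[rotated]) (use assms(1,2) in auto)
  also have "\<dots> \<le> card ?good + card (\<Union>x\<in>X. {\<sigma>\<in>H. x \<in> gr n \<sigma>})" by (rule card_Un_le)
  also have "card (\<Union>x\<in>X. {\<sigma>\<in>H. x \<in> gr n \<sigma>}) \<le> (\<Sum>x\<in>X. card {\<sigma>\<in>H. x \<in> gr n \<sigma>})"
    by (rule card_UN_le) (rule assms(2))
  finally have "real (card H) \<le> card ?good + (\<Sum>x\<in>X. real (card {\<sigma>\<in>H. x \<in> gr n \<sigma>}))"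
    by (simp flip: of_nat_sum of_nat_add)
  also have "(\<Sum>x\<in>X. real (card {\<sigma>\<in>H. x \<in> gr n \<sigma>})) \<le> (\<Sum>x\<in>X. c * card H)"
    by (rule sum_mono) (rule assms(3))
  also have "\<dots> = (card X * c) * card H" by simp
  also have "\<dots> \<le> 1/2 * card H" by (rule mult_right_mono) (use assms(4) in auto)
  finally show ?thesis by simp
qed

lemma exponent_le_of_power_mult_le_1:
  fixes K d x :: real
  assumes "K ^ j * d \<le> 1" "1 \<le> exp x * d" "K > 1"
  shows "j \<le> x / ln K"
proof -
  have d: "d > 0" using assms(2) by (smt (verit) exp_gt_zero mult_nonneg_nonpos)
  have "K ^ j * d \<le> exp x * d" using assms by linarith
  then have "K ^ j \<le> exp x" using d by simp
  then have "ln (K ^ j) \<le> ln (exp x)" using assms(3) by (subst ln_le_cancel_iff) auto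
  then have "j * ln K \<le> x" using assms(3) by (simp add: ln_realpow)
  then show ?thesis using assms(3) by (simp add: le_divide_eq ln_gt_zero)
qed

text \<open>
  Two parts of a \<open>t\<close>-intersecting family cannot be separated. Suppose that \<open>F\<close> contains many members
  through \<open>Q\<close>, no cell off \<open>Q\<close> being popular among them, and that \<open>G\<close> has many members through \<open>T\<close> but
  all of them meet \<open>Q\<close> in fewer than \<open>t\<close> cells. Density increments give \<open>S' \<supseteq> T\<close> and \<open>S \<supseteq> Q\<close> such
  that the members of \<open>G\<close> through \<open>S'\<close> and of \<open>F\<close> through \<open>S\<close> are \<open>K\<close>-spread. Both enlargements are
  short, so one can insist that the first members avoid \<open>S - Q\<close> and the second ones avoid \<open>S' - Q\<close>,
  losing at most half of each. Then every agreement outside \<open>Q\<close> lies outside \<open>S\<close> and \<open>S'\<close>, and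
  there must be one for each pair, contradicting the concentration bound.
\<close>
lemma no_dense_link_separated_from_spread_link:
  fixes K x L \<theta> :: real
  assumes F: "F \<subseteq> Sym n" "t_intersecting n t F"
    and Q: "link n F Q \<noteq> {}" "\<theta> \<ge> 0"
      "\<And>x. x \<notin> Q \<Longrightarrow> card (link n F (insert x Q)) \<le> \<theta> * card (link n F Q)"
    and G: "G \<subseteq> F" "\<And>\<sigma>. \<sigma> \<in> G \<Longrightarrow> card (gr n \<sigma> \<inter> Q) < t"
    and T: "link n G T \<noteq> {}"
    and K: "K > 1" and L: "x / ln K \<le> L"
    and dT: "2 \<le> exp x * dens n G T" and dQ: "2 \<le> exp x * dens n F Q"
    and few_cells: "(card (T - Q) + L) * \<theta> \<le> 1/2"
    and light: "2 * L * K \<le> real n - card T - L"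
    and room: "card T + L + 6 \<le> n" "card Q + L < n"
    and tail: "x * K\<^sup>2 * (real n - card T) < (66/1000) * (real n - card Q - L)\<^sup>2"
  shows False
proof -
  have GS: "G \<subseteq> Sym n" using F G by auto
  have fin: "finite F" "finite G" using finite_family F GS by auto
  obtain S' where S': "T \<subseteq> S'" "link n G S' \<noteq> {}" "K ^ (card S' - card T) * dens n G T \<le> dens n G S'"
    and spread': "\<And>x. x \<notin> S' \<Longrightarrow> card (link n G (insert x S')) * (n - card S') \<le> K * card (link n G S')"
    using spread_extension_exists[OF GS T, of K] K by (metis less_imp_le)
  note S'fin = card_le_if_link_nonempty[OF S'(2)]
  note Tfin = card_le_if_link_nonempty[OF T]
  have dT0: "dens n G T \<ge> 0" by (simp add: dens_def)
  have "card S' - card T \<le> x / ln K"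
    using S'(3) dens_le_1[OF GS, of S'] dT K
    by (intro exponent_le_of_power_mult_le_1[of K _ "dens n G T"]) auto
  with L have "card S' - card T \<le> L" by linarith
  then have s'L: "real (card (S' - T)) \<le> L" "real (card S') \<le> card T + L"
    using S'(1) S'fin Tfin card_mono[OF S'fin(1) S'(1)] by (auto simp: card_Diff_subset of_nat_diff)
  have "dens n G T \<le> K ^ (card S' - card T) * dens n G T"
    using K dT0 by (simp add: mult_le_cancel_right1)
  then have dS': "2 \<le> exp x * dens n G S'" using S'(3) dT
    by (smt (verit) exp_gt_zero mult_left_mono)
  \<comment> \<open>Cells of \<open>S' - Q\<close> are avoided before \<open>S\<close> is chosen, so that \<open>S \<inter> S' \<subseteq> Q\<close> below.\<close>
  define A0 where "A0 = {\<sigma>\<in>link n F Q. gr n \<sigma> \<inter> (S' - Q) = {}}"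
  have L0: "L \<ge> 0" using s'L(1) by linarith
  have A0: "card (link n F Q) \<le> 2 * real (card A0)" unfolding A0_def
  proof (rule half_avoids_few_light_cells)
    have "card (S' - Q) \<le> card ((T - Q) \<union> (S' - T))"
      using Tfin S'fin by (intro card_mono) auto
    also have "\<dots> \<le> card (T - Q) + card (S' - T)" by (rule card_Un_le)
    finally have "card (S' - Q) \<le> card (T - Q) + L" using s'L(1) by linarith
    then show "card (S' - Q) * \<theta> \<le> 1/2"
      using few_cells Q(2) by (meson mult_right_mono order_trans)
    show "card {\<sigma> \<in> link n F Q. x \<in> gr n \<sigma>} \<le> \<theta> * card (link n F Q)" if "x \<in> S' - Q" for x
      using Q(3)[of x] that by (simp add: link_insert)
  qed (use fin S'fin in auto)
  have A0S: "A0 \<subseteq> Sym n" using F by (auto simp: A0_def link_def)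
  have lA0: "link n A0 Q = A0" by (auto simp: A0_def link_def)
  have "card (link n F Q) > 0" using Q fin by (simp add: card_gt_0_iff)
  then have "card A0 > 0" using A0 by linarith
  then have A0ne: "link n A0 Q \<noteq> {}" unfolding lA0 by auto
  have dA0: "1 \<le> exp x * dens n A0 Q"
  proof -
    have "dens n F Q \<le> 2 * dens n A0 Q"
      using A0 by (simp add: dens_def lA0 divide_right_mono)
    then have "exp x * dens n F Q \<le> exp x * (2 * dens n A0 Q)" by (intro mult_left_mono) auto
    then show ?thesis using dQ by linarith
  qed
  obtain S where S: "Q \<subseteq> S" "link n A0 S \<noteq> {}" "K ^ (card S - card Q) * dens n A0 Q \<le> dens n A0 S"
    and spread: "\<And>x. x \<notin> S \<Longrightarrow> card (link n A0 (insert x S)) * (n - card S) \<le> K * card (link n A0 S)"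
    using spread_extension_exists[OF A0S A0ne, of K] K by (metis less_imp_le)
  note Sfin = card_le_if_link_nonempty[OF S(2)]
  note Qfin = card_le_if_link_nonempty[OF Q(1)]
  have "card S - card Q \<le> x / ln K"
    using S(3) dens_le_1[OF A0S, of S] dA0 K
    by (intro exponent_le_of_power_mult_le_1[of K _ "dens n A0 Q"]) auto
  with L have "card S - card Q \<le> L" by linarith
  then have sL: "real (card (S - Q)) \<le> L" "real (card S) \<le> card Q + L"
    using S(1) Sfin Qfin card_mono[OF Sfin(1) S(1)] by (auto simp: card_Diff_subset of_nat_diff)
  define A where "A = link n A0 S"
  obtain a0 where a0: "a0 \<in> A" using S(2) by (auto simp: A_def)
  have SS': "S \<inter> S' \<subseteq> Q" using a0 by (auto simp: A_def A0_def link_def)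
  define B where "B = {\<sigma>\<in>link n G S'. gr n \<sigma> \<inter> (S - Q) = {}}"
  have s'n: "real (card S') < n" using s'L room by linarith
  have B: "card (link n G S') \<le> 2 * real (card B)" unfolding B_def
  proof (rule half_avoids_few_light_cells)
    show "card {\<sigma> \<in> link n G S'. x \<in> gr n \<sigma>} \<le> (K / (n - card S')) * card (link n G S')"
      if "x \<in> S - Q" for x
    proof -
      have "x \<notin> S'" using that SS' by auto
      from spread'[OF this] show ?thesis
        using s'n by (simp add: link_insert field_simps of_nat_diff)
    qed
    have "card (S - Q) * K \<le> L * K" using sL(1) K by (intro mult_right_mono) auto
    also have "\<dots> \<le> (n - card S') / 2" using light s'L(2) s'n by (simp add: of_nat_diff)
    finally show "card (S - Q) * (K / (n - card S')) \<le> 1 / 2"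
      using s'n by (simp add: divide_le_eq)
  qed (use fin Sfin in auto)
  have "card (link n G S') > 0" using S' fin by (simp add: card_gt_0_iff)
  then have "card B > 0" using B by linarith
  then obtain b0 where b0: "b0 \<in> B" by (metis card.empty equals0I less_irrefl)
  define \<theta>' where "\<theta>' = K / (n - card S)"
  have sn: "real (card S) < n" using sL(2) room(2) by linarith
  then have \<theta>'0: "\<theta>' > 0" using K by (simp add: \<theta>'_def)
  have "card B \<le> fact (n - card S') * exp (- 2 * (183/500)\<^sup>2 / ((n - card S') * (2 * \<theta>')\<^sup>2))"
  proof (rule cross_agreeing_family_small[of A _ \<theta>' S b0 S' B])
    show "A \<noteq> {}" "A \<subseteq> Sym n" using a0 A0S by (auto simp: A_def link_def)
    show "card {a \<in> A. y \<in> gr n a} \<le> \<theta>' * card A" if "y \<notin> S" for y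
      using spread[OF that] sn by (simp add: \<theta>'_def A_def link_insert field_simps)
    show "b0 \<in> Sym n" "S' \<subseteq> gr n b0" "B \<subseteq> {b \<in> Sym n. S' \<subseteq> gr n b}"
      using b0 GS by (auto simp: B_def link_def)
    show "card S' + 6 \<le> n" using s'L(2) room(1) by linarith
    show "\<exists>y\<in>gr n a \<inter> gr n b. y \<notin> S \<and> y \<notin> S'" if ab: "a \<in> A" "b \<in> B" for a b
    proof -
      have "a \<in> F" "b \<in> F" "b \<in> G" using ab G by (auto simp: A_def A0_def B_def link_def)
      then have "t \<le> card (gr n a \<inter> gr n b)" "card (gr n b \<inter> Q) < t"
        using F(2) G(2) by (auto simp: t_intersecting_def card_gr_Int)
      then have "\<not> gr n a \<inter> gr n b \<subseteq> gr n b \<inter> Q"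
        by (metis card_mono finite_Int finite_gr leD order_trans)
      then obtain y where y: "y \<in> gr n a" "y \<in> gr n b" "y \<notin> Q" by auto
      then show ?thesis using ab by (auto simp: A_def A0_def B_def link_def)
    qed
  qed (rule \<theta>'0)
  moreover have "exp (-x) * fact (n - card S') \<le> card B"
  proof -
    have "2 * fact (n - card S') \<le> exp x * card (link n G S')"
      using dS' by (simp add: dens_def field_simps)
    also have "\<dots> \<le> exp x * (2 * card B)" using B by (intro mult_left_mono) auto
    finally show ?thesis by (simp add: exp_minus field_simps)
  qed
  ultimately have "exp (-x) \<le> exp (- 2 * (183/500)\<^sup>2 / ((n - card S') * (2 * \<theta>')\<^sup>2))"
    by (smt (verit) fact_gt_zero mult.commute mult_le_cancel_left_pos)
  then have le: "2 * (183/500)\<^sup>2 / ((n - card S') * (2 * \<theta>')\<^sup>2) \<le> x" by simp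
  have "2 * (183/500)\<^sup>2 / ((n - card S') * (2 * \<theta>')\<^sup>2)
      = (66978/1000000) * (real n - card S)\<^sup>2 / ((n - card S') * K\<^sup>2)"
    using sn by (simp add: \<theta>'_def power_divide power_mult_distrib power2_eq_square field_simps)
  with le have "(66978/1000000) * (real n - card S)\<^sup>2 / ((n - card S') * K\<^sup>2) \<le> x" by (simp only:)
  moreover have "(n - card S') * K\<^sup>2 > 0" using s'n K by simp
  ultimately have "(66978/1000000) * (real n - card S)\<^sup>2 \<le> x * ((n - card S') * K\<^sup>2)"
    by (simp only: pos_divide_le_eq)
  also have "\<dots> \<le> x * ((n - card T) * K\<^sup>2)"
  proof -
    have "exp x * dens n G T \<le> exp x * 1" using dens_le_1[OF GS] by (intro mult_left_mono) auto
    then have "exp x \<ge> 1" using dT by linarith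
    then have "x \<ge> 0" by simp
    moreover have "n - card S' \<le> n - card T" using card_mono[OF S'fin(1) S'(1)] by simp
    ultimately show ?thesis by (intro mult_left_mono mult_right_mono) auto
  qed
  also have "\<dots> < (66/1000) * (real n - card Q - L)\<^sup>2"
    using tail Tfin Qfin by (simp add: of_nat_diff mult_ac)
  also have "\<dots> \<le> (66978/1000000) * (real n - card S)\<^sup>2"
    using sL(2) room(2) by (intro mult_mono power_mono) auto
  finally show False by simp
qed

section \<open>Cores and their improvement\<close>

text \<open>
  The members of \<open>F\<close> for which \<open>Q\<close> fails to be a core. A core is a set of cells that nearly all
  members meet in at least \<open>t\<close> cells; the aim is a core with exactly \<open>t\<close> cells.
\<close>
definition misses :: "nat \<Rightarrow> nat \<Rightarrow> (nat \<Rightarrow> nat) set \<Rightarrow> (nat \<times> nat) set \<Rightarrow> (nat \<Rightarrow> nat) set" where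
  "misses n t F Q = {\<sigma> \<in> F. card (gr n \<sigma> \<inter> Q) < t}"

lemma dens_nonneg: "0 \<le> dens n F S"
  by (simp add: dens_def)

lemma dens_eq_0: "link n F S = {} \<Longrightarrow> dens n F S = 0"
  by (simp add: dens_def)

text \<open>
  Every member of \<open>H\<close> contains a \<open>t\<close>-subset of \<open>Q\<close>, so some \<open>t\<close>-subset is contained in an average
  share of them.
\<close>
lemma popular_subset_of_core:
  assumes "finite H" "H \<noteq> {}" "finite Q" "\<And>\<sigma>. \<sigma> \<in> H \<Longrightarrow> t \<le> card (gr n \<sigma> \<inter> Q)"
  obtains T where "T \<subseteq> Q" "card T = t" "card H \<le> (card Q choose t) * card (link n H T)"
proof -
  define \<T> where "\<T> = {T. T \<subseteq> Q \<and> card T = t}"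
  have fin: "finite \<T>" using assms(3) by (simp add: \<T>_def)
  have c: "card \<T> = card Q choose t" unfolding \<T>_def by (rule n_subsets[OF assms(3)])
  have sub: "H \<subseteq> (\<Union>T\<in>\<T>. link n H T)"
  proof
    fix \<sigma> assume s: "\<sigma> \<in> H"
    obtain T where "T \<subseteq> gr n \<sigma> \<inter> Q" "card T = t"
      using obtain_subset_with_card_n[OF assms(4)[OF s]] by metis
    then show "\<sigma> \<in> (\<Union>T\<in>\<T>. link n H T)" using s by (auto simp: \<T>_def link_def)
  qed
  have ne: "\<T> \<noteq> {}" using sub assms(2) by auto
  have "\<exists>T\<in>\<T>. card H \<le> card \<T> * card (link n H T)"
  proof (rule ccontr)
    assume "\<not> ?thesis"
    then have no: "card \<T> * card (link n H T) < card H" if "T \<in> \<T>" for T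
      using that by (simp add: not_le)
    have "card H \<le> card (\<Union>T\<in>\<T>. link n H T)"
      by (rule card_mono[OF _ sub]) (use fin assms(1) in auto)
    also have "\<dots> \<le> (\<Sum>T\<in>\<T>. card (link n H T))" by (rule card_UN_le[OF fin])
    finally have "card \<T> * card H \<le> (\<Sum>T\<in>\<T>. card \<T> * card (link n H T))"
      by (simp flip: sum_distrib_left)
    also have "\<dots> < (\<Sum>T\<in>\<T>. card H)" by (rule sum_strict_mono[OF fin ne no])
    finally show False by simp
  qed
  then show thesis using that unfolding c by (auto simp: \<T>_def)
qed

text \<open>
  One step of the descent. Start from the most popular \<open>t\<close>-subset \<open>T\<close> of the core \<open>Q\<close>; its density is
  at least about one over \<open>N = card Q choose t\<close>, so that enlarging it with increments by the factor
  \<open>K2\<close> adds at most \<open>J\<close> cells and yields \<open>Q'\<close>. If \<open>Q'\<close> were missed by many more members than \<open>Q\<close>,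
  then some \<open>t\<close>-subset \<open>T'\<close> of \<open>Q\<close> would be popular among these, and the family through \<open>Q'\<close> would be
  separated from a dense one. As \<open>T\<close> and \<open>T'\<close> are \<open>t\<close>-subsets of the same set \<open>Q\<close>, they differ in at
  most \<open>w\<close> cells, which makes the lack of popular cells at the coarse scale \<open>K2\<close> sufficient.

  The numerical hypotheses collect what the separation lemma requires; \<open>K\<close> is the fine scale, \<open>L\<close>
  bounds the length of fine enlargements, and \<open>exp (- x)\<close> is a lower bound for the densities involved.
\<close>
lemma core_improvement:
  fixes K K2 x L J w \<epsilon> :: real
  assumes F: "F \<subseteq> Sym n" "t_intersecting n t F" and nt: "t \<le> n"
    and big: "(62/100) * fact (n - t) \<le> card F"
    and Q: "finite Q" "t \<le> card Q" "card (misses n t F Q) \<le> (19/100) * card F"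
    and eps: "\<epsilon> > 0" "\<epsilon> \<le> 8/10"
    and N: "N = card Q choose t"
    and K: "K > 1" "K2 > 1"
    and x: "2 * N \<le> (62/100) * \<epsilon> * exp x"
    and L: "x / ln K \<le> L" and J: "ln (2 * N) / ln K2 \<le> J"
    and w: "real (min (card Q - t) t) \<le> w"
    and few_cells: "(w + L) * K2 * 2 \<le> real n - t - J"
    and light: "2 * L * K \<le> real n - t - L"
    and room: "t + L + 6 \<le> n" "t + J + L < n"
    and tail: "x * K\<^sup>2 * (real n - t) < (66/1000) * (real n - t - J - L)\<^sup>2"
  shows "\<exists>Q'. finite Q' \<and> t \<le> card Q' \<and> card Q' \<le> t + J \<and>
     card (misses n t F Q') \<le> card (misses n t F Q) + \<epsilon> * card F"
proof -
  have finF: "finite F" using F(1) by (rule finite_family)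
  have f0: "(fact (n - t) :: real) > 0" by simp
  have cF: "real (card F) > 0" using big f0 by linarith
  define H where "H = F - misses n t F Q"
  have Hmem: "t \<le> card (gr n \<sigma> \<inter> Q)" if "\<sigma> \<in> H" for \<sigma> using that by (auto simp: H_def misses_def)
  have "card H = card F - card (misses n t F Q)"
    unfolding H_def using finF by (intro card_Diff_subset) (auto simp: misses_def)
  then have cH: "(81/100) * card F \<le> card H" using Q(3) by linarith
  have Hne: "H \<noteq> {}" using cH cF by auto
  have finH: "finite H" using finF by (simp add: H_def)
  obtain T where T: "T \<subseteq> Q" "card T = t" "card H \<le> N * card (link n H T)"
    using popular_subset_of_core[OF finH Hne Q(1) Hmem] unfolding N by blast
  have N0: "N > 0" unfolding N using Q(2) by (simp add: zero_less_binomial)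
  have "card (link n H T) \<le> card (link n F T)"
    using finF by (intro card_mono) (auto simp: link_def H_def)
  then have "N * card (link n H T) \<le> N * card (link n F T)" by simp
  with T(3) have "card H \<le> N * card (link n F T)" by linarith
  then have "real (card H) \<le> N * real (card (link n F T))" by (simp only: of_nat_le_iff flip: of_nat_mult)
  \<comment> \<open>as \<open>0.81 * 0.62 > 1/2\<close>\<close>
  with cH big have "(1/2) * fact (n - t) \<le> N * real (card (link n F T))"
    using f0 by linarith
  then have dT: "1 \<le> 2 * N * dens n F T"
    using f0 by (simp add: dens_def T(2) field_simps)
  then have Tne: "link n F T \<noteq> {}" using dens_eq_0[of n F T] by auto
  obtain Q' where Q': "T \<subseteq> Q'" "link n F Q' \<noteq> {}" "K2 ^ (card Q' - card T) * dens n F T \<le> dens n F Q'"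
    and spread: "\<And>y. y \<notin> Q' \<Longrightarrow> card (link n F (insert y Q')) * (n - card Q') \<le> K2 * card (link n F Q')"
    using spread_extension_exists[OF F(1) Tne, of K2] K by (metis less_imp_le)
  note Q'fin = card_le_if_link_nonempty[OF Q'(2)]
  have tQ': "t \<le> card Q'" using card_mono[OF Q'fin(1) Q'(1)] T(2) by simp
  have "card Q' - card T \<le> ln (2 * N) / ln K2"
    by (rule exponent_le_of_power_mult_le_1[of K2 _ "dens n F T"])
      (use Q'(3) dens_le_1[OF F(1), of Q'] dT N0 K in auto)
  then have Q'J: "card Q' \<le> t + J" using J T(2) tQ' by (simp add: of_nat_diff)
  have "card (misses n t F Q') \<le> card (misses n t F Q) + \<epsilon> * card F"
  proof (rule ccontr)
    assume many: "\<not> ?thesis"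
    define G where "G = {\<sigma>\<in>H. card (gr n \<sigma> \<inter> Q') < t}"
    have "misses n t F Q' \<subseteq> misses n t F Q \<union> G" by (auto simp: misses_def G_def H_def)
    then have "card (misses n t F Q') \<le> card (misses n t F Q \<union> G)"
      using finF finH by (intro card_mono) (auto simp: misses_def G_def)
    also have "\<dots> \<le> card (misses n t F Q) + card G" by (rule card_Un_le)
    finally have cG: "\<epsilon> * card F < card G" using many by linarith
    moreover have "0 < \<epsilon> * card F" using eps cF by simp
    ultimately have Gne: "G \<noteq> {}" by auto
    have finG: "finite G" using finH by (simp add: G_def)
    obtain T' where T': "T' \<subseteq> Q" "card T' = t" "card G \<le> N * card (link n G T')"
      using popular_subset_of_core[OF finG Gne Q(1), of t n] Hmem unfolding N G_def by blast
    have dT': "2 \<le> exp x * dens n G T'"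
    proof -
      have "\<epsilon> * ((62/100) * fact (n - t)) \<le> \<epsilon> * card F" using big eps by (intro mult_left_mono) auto
      also have "\<dots> \<le> N * real (card (link n G T'))"
      proof -
        have "real (card G) \<le> N * real (card (link n G T'))"
          using T'(3) by (simp only: of_nat_le_iff flip: of_nat_mult)
        then show ?thesis using cG by linarith
      qed
      finally have "\<epsilon> * (62/100) \<le> N * dens n G T'"
        by (simp add: dens_def T'(2) field_simps)
      then have "exp x * (\<epsilon> * (62/100)) \<le> exp x * (N * dens n G T')" by (intro mult_left_mono) auto
      moreover have "2 * real N \<le> exp x * (\<epsilon> * (62/100))" using x by (simp only: mult_ac)
      ultimately have "2 * real N \<le> (exp x * dens n G T') * N" by (simp only: mult_ac)
      then show ?thesis using N0 by simp
    qed
    have T'ne: "link n G T' \<noteq> {}" using dT' dens_eq_0[of n G T'] by auto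
    have dQ': "2 \<le> exp x * dens n F Q'"
    proof -
      have "dens n F T \<le> K2 ^ (card Q' - card T) * dens n F T"
        using mult_right_mono[of 1 "K2 ^ (card Q' - card T)" "dens n F T"] K by (simp add: dens_nonneg)
      then have "dens n F T \<le> dens n F Q'" using Q'(3) by linarith
      have "(62/100) * \<epsilon> * exp x \<le> (1/2) * exp x" using eps by (intro mult_right_mono) auto
      then have "4 * N \<le> exp x" using x by linarith
      have "2 * 1 \<le> 2 * (2 * N * dens n F T)" using dT by simp
      also have "\<dots> = 4 * N * dens n F T" by simp
      also have "\<dots> \<le> exp x * dens n F Q'"
        using \<open>4 * N \<le> exp x\<close> \<open>dens n F T \<le> dens n F Q'\<close>
        by (intro mult_mono) (auto simp: dens_def)
      finally show ?thesis by simp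
    qed
    have "card (T' - Q') \<le> card (T' - T)"
      using T'(1) Q(1) Q'(1) by (intro card_mono) (auto intro: finite_subset)
    moreover have "card (T' - T) \<le> t"
      using T' Q(1) card_mono[of T' "T' - T"] finite_subset[of T' Q] by auto
    moreover have "card (T' - T) \<le> card Q - t"
    proof -
      have "card (T' - T) \<le> card (Q - T)" using T' Q(1) by (intro card_mono) auto
      then show ?thesis using T(1,2) Q(1) by (simp add: card_Diff_subset finite_subset)
    qed
    ultimately have wT: "real (card (T' - Q')) \<le> w" using w by linarith
    have "x \<ge> 0"
    proof -
      have "exp x * dens n F Q' \<le> exp x * 1" using dens_le_1[OF F(1)] by (intro mult_left_mono) auto
      then have "exp x \<ge> 1" using dQ' by linarith
      then show ?thesis by simp
    qed
    then have "0 \<le> x / ln K" using K by simp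
    then have "L \<ge> 0" using L by linarith
    have Q'n: "real (card Q') < n" using Q'J room(2) \<open>L \<ge> 0\<close> by linarith
    show False
    proof (rule no_dense_link_separated_from_spread_link[OF F Q'(2), of "K2 / (n - card Q')" G T' K x L])
      show "0 \<le> K2 / (n - card Q')" using K by simp
      show "card (link n F (insert y Q')) \<le> K2 / (n - card Q') * card (link n F Q')" if "y \<notin> Q'" for y
        using spread[OF that] Q'n by (simp add: field_simps of_nat_diff)
      show "G \<subseteq> F" by (auto simp: G_def H_def)
      show "card (gr n \<sigma> \<inter> Q') < t" if "\<sigma> \<in> G" for \<sigma> using that by (simp add: G_def)
      show "(card (T' - Q') + L) * (K2 / (n - card Q')) \<le> 1 / 2"
      proof -
        have "(card (T' - Q') + L) * K2 \<le> (w + L) * K2" using wT K by (intro mult_right_mono) auto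
        also have "\<dots> \<le> (n - card Q') / 2" using few_cells Q'J Q'n by (simp add: of_nat_diff)
        finally show ?thesis using Q'n by (simp add: divide_le_eq)
      qed
      show "2 * L * K \<le> real n - card T' - L" using light T'(2) by simp
      show "real (card T') + L + 6 \<le> n" using room T'(2) by simp
      show "real (card Q') + L < n" using room Q'J by linarith
      have "(66/1000) * (real n - t - J - L)\<^sup>2 \<le> (66/1000) * (real n - card Q' - L)\<^sup>2"
        using Q'J room(2) by (intro mult_left_mono power_mono) auto
      then show "x * K\<^sup>2 * (real n - card T') < (66/1000) * (real n - card Q' - L)\<^sup>2"
        using tail T'(2) by simp
    qed (use K L dT' dQ' T'ne in auto)
  qed
  then show ?thesis using Q'fin(1) tQ' Q'J by blast
qed

section \<open>Numerical estimates\<close>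

lemma exp_one_lower: "(2716/1000 :: real) \<le> exp 1"
  using e_approx_32 by (simp add: abs_if split: if_split_asm)

lemma exp_nat_lower: "(2716/1000 :: real) ^ k \<le> exp (real k)"
  using power_mono[OF exp_one_lower, of k] by (simp flip: exp_of_nat_mult)

lemma exp_frac_lower:
  fixes c :: real
  assumes "c ^ b \<le> (2716/1000) ^ a" "0 < b"
  shows "c \<le> exp (real a / real b)"
proof -
  have "exp (real a / real b) ^ b = exp (real a)" using assms(2) by (simp flip: exp_of_nat_mult)
  then have "c ^ b \<le> exp (real a / real b) ^ b" using assms(1) exp_nat_lower[of a] by simp
  then show ?thesis
    using power_strict_mono[of "exp (real a / real b)" c b] assms(2) by (meson exp_ge_zero linorder_not_le)
qed

lemma exp_frac_upper:
  fixes c :: real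
  assumes "(272/100) ^ a \<le> c ^ b" "0 < b" "c \<ge> 0"
  shows "exp (real a / real b) \<le> c"
proof -
  have "exp (real a / real b) ^ b = exp 1 ^ a" using assms(2) by (simp flip: exp_of_nat_mult)
  also have "\<dots> \<le> (272/100) ^ a" using e_less_272 by (intro power_mono) auto
  finally have "exp (real a / real b) ^ b \<le> c ^ b" using assms(1) by simp
  then show ?thesis
    using power_strict_mono[of c "exp (real a / real b)" b] assms(2,3) by (meson linorder_not_le)
qed

text \<open>
  These constants come from the parameter choices in the three regimes of the descent.
\<close>
lemma numeric_exp_bounds:
  "400 \<le> exp (6::real)" "359/10 \<le> exp (36/10::real)" "66 \<le> exp (42/10::real)" "6 \<le> exp (18/10::real)"
  "906 \<le> exp (78/10::real)" "exp (3/10::real) \<le> 11/8" "exp (16/10::real) \<le> 5" "exp (2/3::real) \<le> 195/100"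
proof -
  show "400 \<le> exp (6::real)" using exp_frac_lower[of 400 1 6] by (simp add: eval_nat_numeral)
  show "359/10 \<le> exp (36/10::real)" using exp_frac_lower[of "359/10" 5 18] by (simp add: eval_nat_numeral)
  show "66 \<le> exp (42/10::real)" using exp_frac_lower[of 66 5 21] by (simp add: eval_nat_numeral)
  show "6 \<le> exp (18/10::real)" using exp_frac_lower[of 6 5 9] by (simp add: eval_nat_numeral)
  have "906 \<le> exp (7::real)" using exp_frac_lower[of 906 1 7] by (simp add: eval_nat_numeral)
  also have "\<dots> \<le> exp (78/10)" by simp
  finally show "906 \<le> exp (78/10::real)" .
  show "exp (3/10::real) \<le> 11/8" using exp_frac_upper[of 3 "11/8" 10] by (simp add: eval_nat_numeral)
  show "exp (16/10::real) \<le> 5" using exp_frac_upper[of 8 5 5] by (simp add: eval_nat_numeral)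
  show "exp (2/3::real) \<le> 195/100" using exp_frac_upper[of 2 "195/100" 3] by (simp add: eval_nat_numeral)
qed

lemma power_div_fact_le_exp: "x \<ge> 0 \<Longrightarrow> x ^ k / fact k \<le> exp (x::real)"
proof -
  assume x: "x \<ge> 0"
  have s: "(\<lambda>n. x ^ n / fact n) sums exp x" using exp_converges[of x] by (simp add: divide_inverse mult.commute)
  have "(\<Sum>n\<in>{k}. x ^ n / fact n) \<le> (\<Sum>n. x ^ n / fact n)"
    by (rule sum_le_suminf) (use s x in \<open>auto simp: sums_iff\<close>)
  then show ?thesis using s by (simp add: sums_iff)
qed

text \<open>
  The estimate \<open>(n choose k) \<le> (e n / k)\<^sup>k\<close>, in logarithmic form.
\<close>
lemma choose_le_exp:
  assumes "real n \<le> real k * exp y"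
  shows "real (n choose k) \<le> exp (real k * (1 + y))"
proof -
  have "real (n choose k) * fact k \<le> real n ^ k"
    using binomial_fact_pow[of n k] by (metis of_nat_fact of_nat_le_iff of_nat_mult of_nat_power)
  also have "\<dots> \<le> (real k * exp y) ^ k" using assms by (intro power_mono) auto
  also have "\<dots> = real k ^ k * exp (real k * y)" by (simp add: power_mult_distrib exp_of_nat_mult)
  finally have "real (n choose k) \<le> (real k ^ k / fact k) * exp (real k * y)" by (simp add: field_simps)
  also have "\<dots> \<le> exp (real k) * exp (real k * y)"
    by (intro mult_right_mono power_div_fact_le_exp) auto
  finally show ?thesis by (simp add: algebra_simps flip: exp_add)
qed

text \<open>
  Pascal's rule halves the trivial bound \<open>2 ^ Suc n\<close>; the gain pays for the factor 2 in the bound on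
  the number of added cells.
\<close>
lemma binomial_Suc_le_pow2: "Suc n choose k \<le> 2 ^ n"
proof (induction n arbitrary: k)
  case 0
  have "0 choose j \<le> 1" for j :: nat by (cases j) auto
  then show ?case by (cases k) auto
next
  case (Suc n)
  show ?case
  proof (cases k)
    case (Suc j)
    then show ?thesis using Suc.IH[of j] Suc.IH[of "Suc j"] by simp
  qed simp
qed

section \<open>Descent to a core of size t\<close>

text \<open>
  The graph of any member is a core of size \<open>n\<close> that no member misses: this is the hypothesis that the
  family is \<open>t\<close>-intersecting. One improvement step brings the size down to a multiple of \<open>t\<close>. Here
  \<open>n choose t\<close> is only exponential in \<open>t log (n / t)\<close>, whereas concentration gains a factor exponential
  in \<open>n\<close>; this is why a linear lower bound on \<open>n\<close> suffices.
\<close>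
lemma initial_core:
  assumes F: "F \<subseteq> Sym n" "t_intersecting n t F" and t: "t \<ge> 1" "n \<ge> 400 * t"
    and big: "(62/100) * fact (n - t) \<le> real (card F)"
  shows "\<exists>Q. finite Q \<and> t \<le> card Q \<and> card Q \<le> t + (482/100) * real t \<and>
    card (misses n t F Q) \<le> (9/100) * card F"
proof -
  have "(fact (n - t) :: real) > 0" by simp
  then have "real (card F) > 0" using big by linarith
  then have "F \<noteq> {}" by auto
  then obtain b where b: "b \<in> F" by blast
  define \<tau> where "\<tau> = real t"
  have \<tau>: "\<tau> \<ge> 1" using t by (simp add: \<tau>_def)
  define l where "l = ln (real n / (400 * \<tau>))"
  \<comment> \<open>Writing \<open>n = 400 t E\<^sup>5\<close> turns all conditions into polynomial ones in \<open>E \<ge> 1\<close>; for \<open>E = 1\<close> they are numerical.\<close>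
  define E where "E = exp (l / 5)"
  have ratio: "real n / (400 * \<tau>) \<ge> 1" using t \<tau> by (simp add: \<tau>_def le_divide_eq)
  then have l0: "l \<ge> 0" by (simp add: l_def)
  have el: "exp l = real n / (400 * \<tau>)" using ratio by (simp add: l_def)
  have "E ^ 5 = exp l" unfolding E_def by (simp flip: exp_of_nat_mult)
  then have nE: "real n = 400 * \<tau> * E ^ 5" using el \<tau> by simp
  have E1: "E \<ge> 1 + l / 5" unfolding E_def by (rule exp_ge_add_one_self)
  then have lE: "l \<le> 5 * E - 5" "E \<ge> 1" using l0 by auto
  define P where "P = E ^ 5"
  have P4: "E ^ 4 \<le> P" unfolding P_def using lE by (intro power_increasing) auto
  have P1: "E \<le> P" unfolding P_def using lE power_increasing[of 1 5 E] by simp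
  have P0: "P \<ge> 1" using P1 lE by linarith
  have nP: "real n = 400 * (\<tau> * P)" using nE by (simp add: P_def)
  define K2 where "K2 = 5 * E ^ 4"
  define L where "L = \<tau> * (187/10 + (167/10) * E)"
  define J where "J = (482/100) * \<tau>"
  \<comment> \<open>\<open>N \<le> (e * 400 * exp l) ^ t\<close> accounts for \<open>7 + l\<close>, the factor \<open>2 / (0.62 * 0.09) < 36\<close> for the other 3.6.\<close>
  define x where "x = \<tau> * (106/10 + l)"
  define N where "N = n choose t"
  have xE: "x \<le> \<tau> * (56/10 + 5 * E)" unfolding x_def using lE \<tau> by (intro mult_left_mono) auto
  have x0: "x \<ge> 0" using \<tau> l0 by (simp add: x_def)
  have lnK: "3/10 \<le> ln (11/8 :: real)"
    using numeric_exp_bounds(6) by (subst ln_ge_iff) auto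
  have Nle: "real N \<le> exp (\<tau> * (7 + l))"
  proof -
    have "real n = \<tau> * (400 * exp l)" using el \<tau> by simp
    also have "\<dots> \<le> \<tau> * (exp 6 * exp l)"
      using \<tau> numeric_exp_bounds(1) by (intro mult_left_mono mult_right_mono) auto
    finally have "real n \<le> real t * exp (6 + l)" by (simp add: exp_add \<tau>_def)
    from choose_le_exp[OF this] show ?thesis by (simp add: N_def \<tau>_def add.assoc)
  qed
  have "\<exists>Q'. finite Q' \<and> t \<le> card Q' \<and> card Q' \<le> t + J \<and>
     card (misses n t F Q') \<le> card (misses n t F (gr n b)) + (9/100) * card F"
  proof (rule core_improvement[OF F _ big, of "gr n b" "9/100" N "11/8" K2 x L J \<tau>])
    have "misses n t F (gr n b) = {}"
      using F(2) b by (fastforce simp: misses_def t_intersecting_def card_gr_Int)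
    then show "card (misses n t F (gr n b)) \<le> (19/100) * card F" by simp
    show "t \<le> n" "t \<le> card (gr n b)" using t by auto
    show "N = card (gr n b) choose t" by (simp add: N_def)
    have "1 \<le> E ^ 4" using lE(2) by (rule one_le_power)
    then show "1 < K2" unfolding K2_def by linarith
    have "2 * real N \<le> 2 * exp (\<tau> * (7 + l))" using Nle by simp
    also have "2 \<le> (62/100) * (9/100) * exp (36/10 * \<tau>)"
    proof -
      have "exp (36/10 :: real) \<le> exp (36/10 * \<tau>)" using \<tau> by simp
      then show ?thesis using numeric_exp_bounds(2) by linarith
    qed
    then have "2 * exp (\<tau> * (7 + l)) \<le> (62/100) * (9/100) * exp (36/10 * \<tau>) * exp (\<tau> * (7 + l))"
      by (intro mult_right_mono) auto
    also have "\<dots> = (62/100) * (9/100) * exp x"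
      by (simp add: x_def algebra_simps flip: exp_add)
    finally show "2 * real N \<le> (62/100) * (9/100) * exp x" .
    have "x / ln (11/8) \<le> x / (3/10)" using lnK x0 by (intro divide_left_mono) auto
    also have "\<dots> \<le> L"
    proof -
      have "\<tau> * (56/10 + 5 * E) \<le> \<tau> * ((3/10) * (187/10 + (167/10) * E))"
        using lE \<tau> by (intro mult_left_mono) auto
      then show ?thesis using xE by (simp add: L_def field_simps)
    qed
    finally show "x / ln (11/8) \<le> L" .
    have lnK2: "16/10 + (8/10) * l \<le> ln K2"
    proof -
      have "16/10 \<le> ln (5 :: real)" using numeric_exp_bounds(7) by (subst ln_ge_iff) auto
      moreover have "ln K2 = ln 5 + (8/10) * l"
        unfolding K2_def using lE by (subst ln_mult) (auto simp: ln_realpow E_def)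
      ultimately show ?thesis by simp
    qed
    have N0: "N > 0" using t by (simp add: N_def zero_less_binomial)
    have "ln (2 * real N) \<le> ln (exp (\<tau> * (77/10 + l)))"
    proof (subst ln_le_cancel_iff)
      have "2 * real N \<le> 2 * exp (\<tau> * (7 + l))" using Nle by simp
      also have "2 \<le> exp (7/10 * \<tau>)"
      proof -
        have "exp (7/10) \<le> exp (7/10 * \<tau>)" using \<tau> by simp
        moreover have "2 \<le> exp (7/10 :: real)" using exp_frac_lower[of 2 10 7] by (simp add: eval_nat_numeral)
        ultimately show ?thesis by linarith
      qed
      then have "2 * exp (\<tau> * (7 + l)) \<le> exp (7/10 * \<tau>) * exp (\<tau> * (7 + l))" by (intro mult_right_mono) auto
      also have "\<dots> = exp (\<tau> * (77/10 + l))" by (simp add: algebra_simps flip: exp_add)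
      finally show "2 * real N \<le> exp (\<tau> * (77/10 + l))" .
    qed (use N0 in auto)
    then have "ln (2 * real N) \<le> \<tau> * (77/10 + l)" by simp
    also have "\<dots> \<le> \<tau> * ((482/100) * (16/10 + (8/10) * l))" using \<tau> l0 by (intro mult_left_mono) auto
    also have "\<dots> \<le> J * ln K2"
      unfolding J_def using lnK2 \<tau> by (simp add: mult.assoc mult.left_commute)
    finally show "ln (2 * real N) / ln K2 \<le> J"
      using lnK2 l0 by (subst pos_divide_le_eq) auto
    show "real (min (card (gr n b) - t) t) \<le> \<tau>" by (simp add: \<tau>_def)
    have mono: "\<tau> * a \<le> \<tau> * c" if "a \<le> c" for a c using that \<tau> by (intro mult_left_mono) auto
    have EE: "E * E ^ 4 = P" by (simp add: P_def eval_nat_numeral)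
    have "(\<tau> + L) * K2 * 2 = \<tau> * (197 * E ^ 4 + 167 * (E * E ^ 4))"
      by (simp add: L_def K2_def algebra_simps)
    also have "\<dots> \<le> \<tau> * (400 * P - 582/100)" unfolding EE by (rule mono) (use P4 P0 in linarith)
    also have "\<dots> = real n - real t - J" unfolding nP by (simp add: J_def \<tau>_def algebra_simps)
    finally show "(\<tau> + L) * K2 * 2 \<le> real n - real t - J" .
    have "2 * L * (11/8) + L + \<tau> = \<tau> * ((15/4) * (187/10 + (167/10) * E) + 1)"
      by (simp add: L_def algebra_simps)
    also have "\<dots> \<le> \<tau> * (400 * P)" by (rule mono) (use P1 P0 in \<open>simp add: algebra_simps\<close>)
    finally show "2 * L * (11/8) \<le> real n - real t - L" unfolding nP by (simp add: \<tau>_def algebra_simps)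
    have "\<tau> + L + 6 * \<tau> = \<tau> * (257/10 + (167/10) * E)" by (simp add: L_def algebra_simps)
    also have "\<dots> \<le> \<tau> * (400 * P)" by (rule mono) (use P1 P0 in linarith)
    finally show "real t + L + 6 \<le> real n" unfolding nP using \<tau> by (simp add: \<tau>_def)
    have rem: "\<tau> * ((3587/10) * P) \<le> real n - real t - J - L"
    proof -
      have "\<tau> * ((3587/10) * P) \<le> \<tau> * (400 * P - 582/100 - (187/10 + (167/10) * E))"
        by (rule mono) (use P1 P0 in linarith)
      then show ?thesis unfolding nP by (simp add: J_def L_def \<tau>_def algebra_simps)
    qed
    have pos: "0 < \<tau> * ((3587/10) * P)" using \<tau> P0 by simp
    then show "real t + J + L < real n" using rem by linarith
    have "x * (11/8)\<^sup>2 * (real n - real t) \<le> (\<tau> * ((106/10) * P)) * (11/8)\<^sup>2 * (400 * (\<tau> * P))"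
    proof (intro mult_mono)
      show "x \<le> \<tau> * ((106/10) * P)" using xE mono[of "56/10 + 5 * E" "(106/10) * P"] P1 P0 by linarith
      show "real n - real t \<le> 400 * (\<tau> * P)" using nP by simp
    qed (use x0 \<tau> P0 t in auto)
    also have "\<dots> = (\<tau> * P)\<^sup>2 * (801625/100)" by (simp add: power2_eq_square)
    also have "\<dots> < (\<tau> * P)\<^sup>2 * ((66/1000) * (3587/10)\<^sup>2)"
      using \<tau> P0 by (intro mult_strict_left_mono) (auto simp: power2_eq_square)
    also have "\<dots> = (66/1000) * (\<tau> * ((3587/10) * P))\<^sup>2" by (simp add: power2_eq_square)
    also have "\<dots> \<le> (66/1000) * (real n - real t - J - L)\<^sup>2"
      using rem pos by (intro mult_left_mono power_mono) auto
    finally show "x * (11/8)\<^sup>2 * (real n - real t) < (66/1000) * (real n - real t - J - L)\<^sup>2" .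
  qed auto
  moreover have "misses n t F (gr n b) = {}"
    using F(2) b by (fastforce simp: misses_def t_intersecting_def card_gr_Int)
  ultimately show ?thesis by (simp add: J_def \<tau>_def)
qed

lemma le_mult_inverse: "a * c \<le> r * X \<Longrightarrow> c > 0 \<Longrightarrow> a \<le> r * (1 / c) * (X :: real)"
  by (simp add: field_simps)

text \<open>
  For \<open>t \<le> i\<close> the bound \<open>2 (t + i choose t) \<le> 4\<^sup>i\<close> shows that a factor 5 per added cell exhausts the
  density before \<open>i\<close> cells have been added.
\<close>
lemma shrink_large_core:
  assumes F: "F \<subseteq> Sym n" "t_intersecting n t F" and t: "t \<ge> 1" "n \<ge> 400 * t"
    and big: "(62/100) * fact (n - t) \<le> real (card F)"
    and Q: "finite Q" "card Q = t + i" "card (misses n t F Q) \<le> (19/100) * card F"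
    and i: "t \<le> i" "real i \<le> (482/100) * real t"
  shows "\<exists>Q'. finite Q' \<and> t \<le> card Q' \<and> card Q' < t + i \<and>
    card (misses n t F Q') \<le> card (misses n t F Q) + (1 / (10 * (real i * (real i + 1)))) * card F"
proof -
  define \<tau> where "\<tau> = real t"
  have \<tau>: "\<tau> \<ge> 1" using t by (simp add: \<tau>_def)
  have i1: "real i \<ge> 1" using i t by simp
  define \<epsilon> where "\<epsilon> = 1 / (10 * (real i * (real i + 1)))"
  define N where "N = (t + i) choose t"
  define L where "L = (354/10) * \<tau>"
  \<comment> \<open>\<open>N \<le> (6 e) ^ t\<close> accounts for 2.8, the factor \<open>2 / (0.62 * \<epsilon>)\<close>, quadratic in \<open>t\<close>, for the other 7.8.\<close>
  define x where "x = (106/10) * \<tau>"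
  define J where "J = ln (2 * real N) / ln 5"
  have lnK: "3/10 \<le> ln (11/8 :: real)"
    using numeric_exp_bounds(6) by (subst ln_ge_iff) auto
  have ln5: "0 < ln (5::real)" by simp
  have N0: "N > 0" by (simp add: N_def zero_less_binomial)
  have "t + i = Suc (t + i - 1)" using t by simp
  then have "N \<le> 2 ^ (t + i - 1)" unfolding N_def using binomial_Suc_le_pow2 by metis
  then have "2 * N \<le> 2 ^ Suc (t + i - 1)" by simp
  also have "\<dots> = 2 ^ (t + i)" using t by simp
  also have "\<dots> \<le> 2 ^ (2 * i)" using i by (intro power_increasing) auto
  also have "\<dots> = 4 ^ i" by (simp add: power_mult)
  finally have "2 * N \<le> 4 ^ i" .
  then have "real (2 * N) \<le> real (4 ^ i)" by (simp only: of_nat_le_iff)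
  then have "2 * real N \<le> 4 ^ i" by simp
  also have "4 ^ i < (5::real) ^ i" using i t by (intro power_strict_mono) auto
  finally have "ln (2 * real N) < ln (5 ^ i)" using N0 by (subst ln_less_cancel_iff) auto
  then have Ji: "J < i" using ln5 by (simp add: J_def divide_less_eq ln_realpow)
  have Nle: "real N \<le> exp (\<tau> * (28/10))"
  proof -
    have "real (t + i) \<le> real t * 6" using i by simp
    also have "\<dots> \<le> real t * exp (18/10)" using numeric_exp_bounds(4) by (intro mult_left_mono) auto
    finally show ?thesis using choose_le_exp[of "t + i" t "18/10"] by (simp add: N_def \<tau>_def)
  qed
  have m: "real n - real t \<ge> 399 * \<tau>" using t by (simp add: \<tau>_def)
  have J5: "J \<le> (482/100) * \<tau>" using Ji i by (simp add: \<tau>_def)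
  have "\<exists>Q'. finite Q' \<and> t \<le> card Q' \<and> card Q' \<le> t + J \<and>
     card (misses n t F Q') \<le> card (misses n t F Q) + \<epsilon> * card F"
  proof (rule core_improvement[OF F _ big Q(1) _ Q(3), of \<epsilon> N "11/8" 5 x L J \<tau>])
    have "1 * 1 \<le> real i * (real i + 1)" using i1 by (intro mult_mono) auto
    then show "\<epsilon> > 0" "\<epsilon> \<le> 8/10" unfolding \<epsilon>_def using i1 by (auto simp: divide_le_eq)
    show "N = card Q choose t" using Q by (simp add: N_def)
    have "real i * (real i + 1) \<le> ((482/100) * \<tau>) * ((582/100) * \<tau>)"
      using i \<tau> by (intro mult_mono) (auto simp: \<tau>_def)
    also have "\<dots> = (280524/10000) * \<tau>\<^sup>2" by (simp add: power2_eq_square)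
    also have "\<tau>\<^sup>2 \<le> (exp (\<tau> - 1))\<^sup>2" using exp_ge_add_one_self[of "\<tau> - 1"] \<tau> by (intro power_mono) auto
    also have "\<dots> = exp (2 * \<tau> - 2)" by (simp add: algebra_simps flip: exp_double)
    finally have ii: "real i * (real i + 1) \<le> (280524/10000) * exp (2 * \<tau> - 2)" by simp
    have "2 * real N * (10 * (real i * (real i + 1))) \<le>
        2 * exp (\<tau> * (28/10)) * (10 * ((280524/10000) * exp (2 * \<tau> - 2)))"
      by (rule mult_mono) (use Nle ii in auto)
    also have "\<dots> = (62/100) * ((20 * 280524/6200) * exp (\<tau> * (28/10) + (2 * \<tau> - 2)))"
      unfolding exp_add by simp
    also have "(20 * 280524/6200) \<le> exp (58/10 * \<tau> + 2)"
    proof -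
      have "exp (78/10) \<le> exp (58/10 * \<tau> + 2)" using \<tau> by simp
      then show ?thesis using numeric_exp_bounds(5) by linarith
    qed
    then have "(20 * 280524/6200) * exp (\<tau> * (28/10) + (2 * \<tau> - 2)) \<le>
        exp (58/10 * \<tau> + 2) * exp (\<tau> * (28/10) + (2 * \<tau> - 2))" by (intro mult_right_mono) auto
    also have "\<dots> = exp x" by (simp add: x_def algebra_simps flip: exp_add)
    finally have "2 * real N * (10 * (real i * (real i + 1))) \<le> (62/100) * exp x" by simp
    then show "2 * real N \<le> (62/100) * \<epsilon> * exp x"
      unfolding \<epsilon>_def by (rule le_mult_inverse) (use i1 in auto)
    have "x / ln (11/8) \<le> x / (3/10)" using lnK \<tau> by (intro divide_left_mono) (auto simp: x_def)
    also have "\<dots> \<le> L" using \<tau> by (simp add: x_def L_def)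
    finally show "x / ln (11/8) \<le> L" .
    show "(\<tau> + L) * 5 * 2 \<le> real n - real t - J" using m J5 \<tau> by (simp add: L_def)
    show "2 * L * (11/8) \<le> real n - real t - L" using m \<tau> by (simp add: L_def)
    show "real t + L + 6 \<le> real n" "real t + J + L < real n" using m J5 \<tau> by (auto simp: L_def \<tau>_def)
    define M where "M = real n - real t"
    have M: "M \<ge> 399 * \<tau>" using m by (simp add: M_def)
    have "x * (11/8)\<^sup>2 * M = M * (\<tau> * (20040625/1000000))"
      by (simp add: x_def power2_eq_square)
    also have "\<dots> < M * ((66/1000) * (M - (8044/100) * \<tau>))"
      using M \<tau> by (intro mult_strict_left_mono) auto
    also have "\<dots> \<le> (66/1000) * (M - (4022/100) * \<tau>)\<^sup>2"
      by (simp add: power2_eq_square algebra_simps)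
    also have "\<dots> \<le> (66/1000) * (M - J - L)\<^sup>2"
      using M J5 \<tau> by (intro mult_left_mono power_mono) (auto simp: L_def)
    finally show "x * (11/8)\<^sup>2 * (real n - real t) < (66/1000) * (real n - real t - J - L)\<^sup>2"
      by (simp add: M_def)
  qed (use t Q in \<open>auto simp: J_def \<tau>_def\<close>)
  then obtain Q' where "finite Q'" "t \<le> card Q'" "real (card Q') \<le> t + J"
     "card (misses n t F Q') \<le> card (misses n t F Q) + \<epsilon> * card F" by blast
  moreover from this Ji have "card Q' < t + i" by linarith
  ultimately show ?thesis unfolding \<epsilon>_def by blast
qed

lemma four_power_bound: "i \<ge> 1 \<Longrightarrow> 2 * (real i * (real i + 1)) \<le> 4 ^ i"
proof (induction i rule: dec_induct)
  case (step j)
  have "real j \<ge> 1" using step.hyps by simp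
  then have "1 * real j \<le> real j * real j" by (intro mult_right_mono) auto
  then have "2 * ((real j + 1) * (real j + 2)) \<le> 4 * (2 * (real j * (real j + 1)))"
  proof -
    have "4 * (2 * (real j * (real j + 1))) - 2 * ((real j + 1) * (real j + 2))
        = 6 * (real j * real j) + 2 * real j - 4" by (simp add: algebra_simps)
    then show ?thesis using \<open>real j \<ge> 1\<close> \<open>1 * real j \<le> real j * real j\<close> by linarith
  qed
  also have "\<dots> \<le> 4 * 4 ^ j" using step.IH by simp
  finally show ?case by (simp add: algebra_simps)
qed simp

text \<open>
  For \<open>i < t\<close> put \<open>u = (t + i) / i\<close>, so that \<open>t + i choose t\<close> is at most \<open>(e u)\<^sup>i\<close>. A factor slightly above
  \<open>2 e u\<close> per added cell exhausts the density before \<open>i\<close> cells have been added. The fine scale \<open>K\<close>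
  grows like the cube root of \<open>u\<close>: with a constant \<open>K\<close> the fine enlargements would have length
  \<open>i log u\<close> up to constants, too long when \<open>t / i\<close> is huge, while \<open>K\<^sup>2\<close> must stay below \<open>u / log u\<close> up to
  constants for concentration to win.
\<close>
lemma shrink_small_core:
  assumes F: "F \<subseteq> Sym n" "t_intersecting n t F" and t: "t \<ge> 1" "n \<ge> 400 * t"
    and big: "(62/100) * fact (n - t) \<le> real (card F)"
    and Q: "finite Q" "card Q = t + i" "card (misses n t F Q) \<le> (19/100) * card F"
    and i: "1 \<le> i" "i < t"
  shows "\<exists>Q'. finite Q' \<and> t \<le> card Q' \<and> card Q' < t + i \<and>
    card (misses n t F Q') \<le> card (misses n t F Q) + (1 / (10 * (real i * (real i + 1)))) * card F"
proof -
  define \<iota> where "\<iota> = real i"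
  have \<iota>: "\<iota> \<ge> 1" using i by (simp add: \<iota>_def)
  define u where "u = real (t + i) / \<iota>"
  have u2: "u \<ge> 2" using i \<iota> by (simp add: u_def \<iota>_def le_divide_eq)
  have ti: "real t = \<iota> * u - \<iota>" using \<iota> by (simp add: u_def \<iota>_def)
  define l where "l = ln u"
  have l0: "l \<ge> 0" using u2 by (simp add: l_def)
  have el: "exp l = u" using u2 by (simp add: l_def)
  \<comment> \<open>\<open>v\<close> is the cube root of \<open>u\<close>\<close>
  define v where "v = exp (l / 3)"
  have v3: "v ^ 3 = u" unfolding v_def using el by (simp flip: exp_of_nat_mult)
  have v1: "1 + l / 3 \<le> v" unfolding v_def by (rule exp_ge_add_one_self)
  define K where "K = exp (1/3 + l / 3)"
  have K2: "K\<^sup>2 \<le> (195/100) * v\<^sup>2"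
  proof -
    have "K\<^sup>2 = exp (2/3) * v\<^sup>2" by (simp add: K_def v_def algebra_simps flip: exp_add exp_double)
    then show ?thesis using mult_right_mono[OF numeric_exp_bounds(8), of "v\<^sup>2"] by simp
  qed
  define \<epsilon> where "\<epsilon> = 1 / (10 * (\<iota> * (\<iota> + 1)))"
  define N where "N = (t + i) choose t"
  define L where "L = (156/10) * \<iota>"
  \<comment> \<open>\<open>N \<le> (e u) ^ i\<close> accounts for \<open>1 + l\<close>, the factor \<open>2 / (0.62 * \<epsilon>)\<close>, quadratic in \<open>i\<close>, for the other 4.2.\<close>
  define x where "x = \<iota> * (52/10 + l)"
  define K2 where "K2 = (55/10) * u"
  define J where "J = ln (2 * real N) / ln K2"
  have N0: "N > 0" by (simp add: N_def zero_less_binomial)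
  have Nle: "real N \<le> exp (\<iota> * (1 + l))"
  proof -
    have "N = (t + i) choose i" unfolding N_def by (metis add.commute binomial_symmetric diff_add_inverse2 le_add1)
    moreover have "real (t + i) \<le> real i * exp l" using el \<iota> by (simp add: u_def \<iota>_def)
    ultimately show ?thesis using choose_le_exp[of "t + i" i l] by (simp add: \<iota>_def)
  qed
  have lnK2: "0 < ln K2" using u2 by (simp add: K2_def)
  have Ji: "J < \<iota>"
  proof -
    have "2 * real N \<le> 2 * exp (\<iota> * (1 + l))" using Nle by simp
    also have "\<dots> \<le> 2 ^ i * exp (\<iota> * (1 + l))" using i power_increasing[of 1 i "2::real"] by (intro mult_right_mono) auto
    also have "\<dots> = (2 * (exp 1 * u)) ^ i"
      by (simp add: \<iota>_def exp_of_nat_mult exp_add el power_mult_distrib)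
    also have "\<dots> < K2 ^ i"
      using e_less_272 u2 i by (intro power_strict_mono) (auto simp: K2_def)
    finally have "ln (2 * real N) < ln (K2 ^ i)" using N0 by (subst ln_less_cancel_iff) auto
    also have "\<dots> = \<iota> * ln K2" using u2 by (simp add: ln_realpow K2_def \<iota>_def)
    finally show ?thesis using lnK2 by (simp add: J_def divide_less_eq)
  qed
  define M where "M = real n - real t"
  have iu: "2 * \<iota> \<le> \<iota> * u" using \<iota> u2 by simp
  have M: "M \<ge> (1995/10) * (\<iota> * u)"
  proof -
    have "M \<ge> 399 * real t" using t by (simp add: M_def)
    then show ?thesis using ti iu by simp
  qed
  have M0: "0 \<le> M" using M iu \<iota> by linarith
  have J_half: "J \<le> (1/2) * (\<iota> * u)" using Ji iu by linarith
  have "\<exists>Q'. finite Q' \<and> t \<le> card Q' \<and> card Q' \<le> t + J \<and>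
     card (misses n t F Q') \<le> card (misses n t F Q) + \<epsilon> * card F"
  proof (rule core_improvement[OF F _ big Q(1) _ Q(3), of \<epsilon> N K K2 x L J \<iota>])
    have "1 * 1 \<le> \<iota> * (\<iota> + 1)" using \<iota> by (intro mult_mono) auto
    then show "\<epsilon> > 0" "\<epsilon> \<le> 8/10" unfolding \<epsilon>_def using \<iota> by (auto simp: divide_le_eq)
    show "N = card Q choose t" using Q by (simp add: N_def)
    show "1 < K" using l0 by (simp add: K_def)
    show "1 < K2" using u2 by (simp add: K2_def)
    have "2 * real N * (10 * (\<iota> * (\<iota> + 1))) = 10 * (real N * (2 * (\<iota> * (\<iota> + 1))))" by simp
    also have "\<dots> \<le> 10 * (exp (\<iota> * (1 + l)) * 4 ^ i)"
      using Nle four_power_bound[OF i(1)] by (intro mult_left_mono mult_mono) (auto simp: \<iota>_def)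
    also have "\<dots> = (62/100) * (exp (\<iota> * (1 + l)) * ((1000/62) * 4 ^ i))" by simp
    also have "(1000/62 :: real) * 4 ^ i \<le> exp (42/10) ^ i"
    proof -
      have "(1000/62 :: real) * 4 ^ i \<le> (33/2) ^ i * 4 ^ i"
        using i power_increasing[of 1 i "33/2::real"] by (intro mult_right_mono) auto
      also have "\<dots> = 66 ^ i" by (simp flip: power_mult_distrib)
      also have "\<dots> \<le> exp (42/10) ^ i" using numeric_exp_bounds(3) by (intro power_mono) auto
      finally show ?thesis .
    qed
    then have "exp (\<iota> * (1 + l)) * ((1000/62) * 4 ^ i) \<le> exp (\<iota> * (1 + l)) * exp (42/10) ^ i"
      by (intro mult_left_mono) auto
    also have "\<dots> = exp x"
      by (simp add: x_def \<iota>_def algebra_simps flip: exp_add exp_of_nat_mult)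
    finally have "2 * real N * (10 * (\<iota> * (\<iota> + 1))) \<le> (62/100) * exp x" by simp
    then show "2 * real N \<le> (62/100) * \<epsilon> * exp x"
      unfolding \<epsilon>_def by (rule le_mult_inverse) (use \<iota> in auto)
    have lnK: "ln K = (1 + l) / 3" by (simp add: K_def)
    have "\<iota> * (52/10 + l) \<le> \<iota> * ((52/10) * (1 + l))" using \<iota> l0 by (intro mult_left_mono) auto
    then show "x / ln K \<le> L" unfolding lnK using l0 by (simp add: x_def L_def divide_le_eq algebra_simps)
    show "(\<iota> + L) * K2 * 2 \<le> real n - real t - J"
    proof -
      have "(\<iota> + L) * K2 * 2 = (1826/10) * (\<iota> * u)" by (simp add: L_def K2_def algebra_simps)
      then show ?thesis using M J_half \<iota> u2 iu unfolding M_def by linarith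
    qed
    show "2 * L * K \<le> real n - real t - L"
    proof -
      have "K \<le> K\<^sup>2" using l0 by (intro self_le_power) (auto simp: K_def)
      also have "\<dots> \<le> (195/100) * u"
      proof -
        have "v\<^sup>2 \<le> v ^ 3" using v1 l0 by (intro power_increasing) auto
        then show ?thesis using \<open>K\<^sup>2 \<le> (195/100) * v\<^sup>2\<close> v3 by simp
      qed
      finally have "\<iota> * K \<le> \<iota> * ((195/100) * u)" using \<iota> by (intro mult_left_mono) auto
      then have "2 * L * K \<le> 62 * (\<iota> * u)" using iu \<iota> by (simp add: L_def)
      then show ?thesis using M iu \<iota> unfolding M_def L_def by linarith
    qed
    show "real t + L + 6 \<le> real n" "real t + J + L < real n"
      using M J_half iu \<iota> unfolding M_def L_def by linarith+
    show "real (min (card Q - t) t) \<le> \<iota>" using Q by (simp add: \<iota>_def)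
    have "x \<le> \<iota> * (22/10 + 3 * v)" unfolding x_def using v1 \<iota> by (intro mult_left_mono) auto
    then have "x * K\<^sup>2 * M \<le> (\<iota> * (22/10 + 3 * v)) * ((195/100) * v\<^sup>2) * M"
      using \<open>K\<^sup>2 \<le> (195/100) * v\<^sup>2\<close> M0 \<iota> l0 v1 by (intro mult_right_mono mult_mono) auto
    also have "\<dots> = M * (\<iota> * ((429/100) * v\<^sup>2 + (585/100) * v ^ 3))"
      by (simp add: algebra_simps power2_eq_square power3_eq_cube)
    also have "\<dots> \<le> M * (\<iota> * ((1014/100) * u))"
    proof -
      have "v\<^sup>2 \<le> v ^ 3" using v1 l0 by (intro power_increasing) auto
      then have "(429/100) * v\<^sup>2 + (585/100) * v ^ 3 \<le> (1014/100) * u" using v3 by linarith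
      then show ?thesis using M0 \<iota> by (intro mult_left_mono) auto
    qed
    also have "\<dots> < M * ((66/1000) * (M - (332/10) * \<iota>))"
    proof (rule mult_strict_left_mono)
      have "\<iota> * ((1014/100) * u) = (1014/100) * (\<iota> * u)" by simp
      then show "\<iota> * ((1014/100) * u) < (66/1000) * (M - (332/10) * \<iota>)" using M iu \<iota> by argo
      show "0 < M" using M iu \<iota> by linarith
    qed
    also have "\<dots> \<le> (66/1000) * (M - (166/10) * \<iota>)\<^sup>2"
    proof -
      have "(M - (166/10) * \<iota>)\<^sup>2 - M * (M - (332/10) * \<iota>) = ((166/10) * \<iota>)\<^sup>2"
        by (simp add: power2_eq_square field_simps)
      then have "M * (M - (332/10) * \<iota>) \<le> (M - (166/10) * \<iota>)\<^sup>2"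
        using zero_le_power2[of "(166/10) * \<iota>"] by linarith
      then have "(66/1000) * (M * (M - (332/10) * \<iota>)) \<le> (66/1000) * (M - (166/10) * \<iota>)\<^sup>2"
        by (intro mult_left_mono) auto
      then show ?thesis by (simp only: mult.left_commute)
    qed
    also have "\<dots> \<le> (66/1000) * (M - J - L)\<^sup>2"
    proof -
      have "0 \<le> M - (166/10) * \<iota>" using M iu \<iota> by linarith
      moreover have "M - (166/10) * \<iota> \<le> M - J - L" using Ji unfolding L_def by linarith
      ultimately show ?thesis by (intro mult_left_mono power_mono) auto
    qed
    finally show "x * K\<^sup>2 * (real n - real t) < (66/1000) * (real n - real t - J - L)\<^sup>2"
      by (simp add: M_def)
  qed (use t Q in \<open>auto simp: J_def\<close>)
  then obtain Q' where "finite Q'" "t \<le> card Q'" "real (card Q') \<le> t + J"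
     "card (misses n t F Q') \<le> card (misses n t F Q) + \<epsilon> * card F" by blast
  moreover from this Ji have "card Q' < t + i" unfolding \<iota>_def by linarith
  ultimately show ?thesis unfolding \<epsilon>_def \<iota>_def by blast
qed

lemma unit_fraction_sum:
  fixes y :: real
  assumes "y > 0"
  shows "1 / (10 * (1 + y)) + 1 / (10 * (y * (y + 1))) = 1 / (10 * y)"
proof -
  have "1 / (10 * (1 + y)) = y / (10 * (y * (y + 1)))" using assms by (simp add: add.commute)
  then have "1 / (10 * (1 + y)) + 1 / (10 * (y * (y + 1))) = (y + 1) / (10 * (y * (y + 1)))"
    by (simp add: add_divide_distrib)
  also have "\<dots> = 1 / (10 * y)" using assms by simp
  finally show ?thesis .
qed

text \<open>
  A step from excess \<open>i\<close> may add a proportion \<open>1 / (10 i (i + 1))\<close> of exceptional members. As these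
  proportions telescope, the total is at most 0.19 however many steps are made.
\<close>
lemma core_descent:
  assumes F: "F \<subseteq> Sym n" "t_intersecting n t F" and t: "t \<ge> 1" "n \<ge> 400 * t"
    and big: "(62/100) * fact (n - t) \<le> real (card F)"
  shows "finite Q \<Longrightarrow> card Q = t + i \<Longrightarrow> real i \<le> (482/100) * real t \<Longrightarrow>
    card (misses n t F Q) \<le> (9/100 + 1 / (10 * (1 + real i))) * card F \<Longrightarrow>
    \<exists>T. finite T \<and> card T = t \<and> card (misses n t F T) \<le> (19/100) * card F"
proof (induction i arbitrary: Q rule: less_induct)
  case (less i)
  show ?case
  proof (cases "i = 0")
    case True
    then show ?thesis using less.prems by (intro exI[of _ Q]) auto
  next
    case False
    have "1 / (10 * (1 + real i)) \<le> 1/10" by (rule frac_le) auto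
    then have "9/100 + 1 / (10 * (1 + real i)) \<le> 19/100" by linarith
    then have "(9/100 + 1 / (10 * (1 + real i))) * card F \<le> (19/100) * card F"
      by (intro mult_right_mono of_nat_0_le_iff)
    then have m: "card (misses n t F Q) \<le> (19/100) * card F" using less.prems(4) by linarith
    have "\<exists>Q'. finite Q' \<and> t \<le> card Q' \<and> card Q' < t + i \<and>
      card (misses n t F Q') \<le> card (misses n t F Q) + (1 / (10 * (real i * (real i + 1)))) * card F"
    proof (cases "t \<le> i")
      case True
      show ?thesis by (rule shrink_large_core[OF F t big less.prems(1,2) m True less.prems(3)])
    next
      case small: False
      show ?thesis by (rule shrink_small_core[OF F t big less.prems(1,2) m]) (use False small in auto)
    qed
    then obtain Q' where Q': "finite Q'" "t \<le> card Q'" "card Q' < t + i"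
      "card (misses n t F Q') \<le> card (misses n t F Q) + (1 / (10 * (real i * (real i + 1)))) * card F" by blast
    define j where "j = card Q' - t"
    have j: "j < i" "card Q' = t + j" using Q' by (auto simp: j_def)
    have step: "1 / (10 * (1 + real i)) + 1 / (10 * (real i * (real i + 1))) \<le> 1 / (10 * (1 + real j))"
    proof -
      have "1 / (10 * (1 + real i)) + 1 / (10 * (real i * (real i + 1))) = 1 / (10 * real i)"
        by (rule unit_fraction_sum) (use False in simp)
      also have "\<dots> \<le> 1 / (10 * (1 + real j))" using j by (intro frac_le) auto
      finally show ?thesis .
    qed
    have "card (misses n t F Q') \<le> (9/100 + 1 / (10 * (1 + real i)) + 1 / (10 * (real i * (real i + 1)))) * card F"
      using Q'(4) less.prems(4) by (simp add: algebra_simps)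
    also have "\<dots> \<le> (9/100 + 1 / (10 * (1 + real j))) * card F"
      using step by (intro mult_right_mono) auto
    finally have "card (misses n t F Q') \<le> (9/100 + 1 / (10 * (1 + real j))) * card F" .
    moreover have "real j \<le> (482/100) * real t" using less.prems(3) j(1) by linarith
    ultimately show ?thesis using less.IH[OF j(1) Q'(1) j(2)] by blast
  qed
qed

lemma large_family_concentrates_on_coset:
  assumes F: "F \<subseteq> Sym n" "t_intersecting n t F" and t: "t \<ge> 1" "n \<ge> 400 * t"
    and big: "(62/100) * fact (n - t) \<le> real (card F)"
  shows "\<exists>T. card T = t \<and> (1/2) * fact (n - t) < real (card (link n F T))"
proof -
  obtain Q where Q: "finite Q" "t \<le> card Q" "card Q \<le> t + (482/100) * real t"
    "card (misses n t F Q) \<le> (9/100) * card F" using initial_core[OF F t big] by blast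
  define i where "i = card Q - t"
  have i: "card Q = t + i" "real i \<le> (482/100) * real t" using Q by (auto simp: i_def)
  have "(9/100) * real (card F) \<le> (9/100 + 1 / (10 * (1 + real i))) * card F"
    by (intro mult_right_mono) auto
  then have "card (misses n t F Q) \<le> (9/100 + 1 / (10 * (1 + real i))) * card F"
    using Q(4) by linarith
  from core_descent[OF F t big Q(1) i this] obtain T where
    T: "finite T" "card T = t" "card (misses n t F T) \<le> (19/100) * card F" by blast
  have finF: "finite F" using F(1) by (rule finite_family)
  have "F = link n F T \<union> misses n t F T"
  proof
    show "F \<subseteq> link n F T \<union> misses n t F T"
    proof
      fix \<sigma> assume s: "\<sigma> \<in> F"
      show "\<sigma> \<in> link n F T \<union> misses n t F T"
      proof (cases "T \<subseteq> gr n \<sigma>")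
        case False
        then have "gr n \<sigma> \<inter> T \<subset> T" by blast
        then have "card (gr n \<sigma> \<inter> T) < t" using psubset_card_mono[OF T(1)] T(2) by auto
        then show ?thesis using s by (simp add: misses_def)
      qed (use s in \<open>simp add: link_def\<close>)
    qed
  qed (auto simp: link_def misses_def)
  then have "card F \<le> card (link n F T) + card (misses n t F T)"
    by (metis card_Un_le)
  moreover have "(fact (n - t) :: real) > 0" by simp
  ultimately have "(1/2) * fact (n - t) < real (card (link n F T))" using T(3) big by linarith
  then show ?thesis using T(2) by blast
qed

section \<open>Counting permutations that agree with given ones\<close>

lemma card_perms_prescribed_le:
  assumes R: "finite R" and C: "C \<subseteq> R"
  shows "card {a. a permutes R \<and> (\<forall>k\<in>C. a k = f k)} \<le> fact (card R - card C)"
proof (cases "{a. a permutes R \<and> (\<forall>k\<in>C. a k = f k)} = {}")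
  case False
  then obtain b where b: "b permutes R" "\<forall>k\<in>C. b k = f k" by auto
  have "{a. a permutes R \<and> (\<forall>k\<in>C. a k = f k)} = {a. a permutes R \<and> (\<forall>k\<in>C. a k = b k)}"
    using b(2) by auto
  also have "\<dots> = (\<lambda>\<pi>. b \<circ> \<pi>) ` {\<pi>. \<pi> permutes R - C}" by (rule perms_agreeing_eq_image[OF b(1) C])
  finally have "card {a. a permutes R \<and> (\<forall>k\<in>C. a k = f k)} = card {\<pi>. \<pi> permutes R - C}"
    by (simp add: card_image inj_on_comp_left_permutes[OF b(1)])
  also have "\<dots> = fact (card R - card C)"
    using R C by (intro card_permutations) (auto simp: card_Diff_subset finite_subset)
  finally show ?thesis by simp
qed (simp only: card.empty zero_le)

lemma card_perms_agreeing_often_le: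
  assumes R: "finite R"
  shows "card {a. a permutes R \<and> v \<le> card {k\<in>R. a k = f k}} \<le> (card R choose v) * fact (card R - v)"
proof -
  define \<C> where "\<C> = {C. C \<subseteq> R \<and> card C = v}"
  have fin: "finite \<C>" using R by (simp add: \<C>_def)
  have "{a. a permutes R \<and> v \<le> card {k\<in>R. a k = f k}}
      \<subseteq> (\<Union>C\<in>\<C>. {a. a permutes R \<and> (\<forall>k\<in>C. a k = f k)})"
  proof
    fix a assume a: "a \<in> {a. a permutes R \<and> v \<le> card {k\<in>R. a k = f k}}"
    then obtain C where "C \<subseteq> {k\<in>R. a k = f k}" "card C = v"
      using obtain_subset_with_card_n by blast
    then show "a \<in> (\<Union>C\<in>\<C>. {a. a permutes R \<and> (\<forall>k\<in>C. a k = f k)})" using a by (auto simp: \<C>_def)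
  qed
  then have "card {a. a permutes R \<and> v \<le> card {k\<in>R. a k = f k}}
      \<le> card (\<Union>C\<in>\<C>. {a. a permutes R \<and> (\<forall>k\<in>C. a k = f k)})"
    by (rule card_mono[OF finite_UN_I[OF fin finite_perms_filter[OF R]]])
  also have "\<dots> \<le> (\<Sum>C\<in>\<C>. card {a. a permutes R \<and> (\<forall>k\<in>C. a k = f k)})" by (rule card_UN_le[OF fin])
  also have "\<dots> \<le> (\<Sum>C\<in>\<C>. fact (card R - v))"
  proof (rule sum_mono)
    fix C assume "C \<in> \<C>"
    then have "C \<subseteq> R" "card C = v" by (auto simp: \<C>_def)
    then show "card {a. a permutes R \<and> (\<forall>k\<in>C. a k = f k)} \<le> fact (card R - v)"
      using card_perms_prescribed_le[OF R, of C f] by simp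
  qed
  also have "\<dots> = (card R choose v) * fact (card R - v)"
    using n_subsets[OF R] by (simp add: \<C>_def)
  finally show ?thesis .
qed

lemma card_perms_hitting:
  assumes R: "finite R" "u \<in> R" and w: "w permutes R"
  shows "real (card {a. a permutes R \<and> (\<exists>k\<in>R - {u}. a k = w k)})
       = fact (card R) - avoid_count (card R) (card R - 1)"
proof -
  let ?H = "{a. a permutes R \<and> (\<exists>k\<in>R - {u}. a k = w k)}"
  let ?A = "{a. a permutes R \<and> (\<forall>k\<in>R - {u}. a k \<noteq> w k)}"
  have U: "{a. a permutes R} = ?H \<union> ?A" and I: "?H \<inter> ?A = {}" by blast+
  have "card {a. a permutes R} = card ?H + card ?A"
    unfolding U by (rule card_Un_disjoint[OF finite_perms_filter[OF R(1)] finite_perms_filter[OF R(1)] I])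
  moreover have "card {a. a permutes R} = fact (card R)" using R by (intro card_permutations) auto
  moreover have "real (card ?A) = avoid_count (card R) (card R - 1)"
  proof -
    have "w ` (R - {u}) \<subseteq> R" "inj_on w (R - {u})"
      using permutes_image[OF w] permutes_inj_on[OF w] by auto
    moreover have "{k \<in> R. k \<noteq> u} = R - {u}" by auto
    ultimately show ?thesis
      using card_perms_prescribed_avoiding[OF R(1) empty_subsetI permutes_id, of "R - {u}" w] R by simp
  qed
  ultimately have "real (fact (card R)) = real (card ?H) + avoid_count (card R) (card R - 1)"
    by linarith
  then show ?thesis unfolding of_nat_fact by linarith
qed

text \<open>
  The second Bonferroni inequality with uniform bounds on the single and the pairwise terms.
\<close>
lemma card_Union_ge_bonferroni:
  fixes p q :: real
  assumes "finite E" "\<And>k. k \<in> E \<Longrightarrow> finite (W k)" "\<And>k. k \<in> E \<Longrightarrow> p \<le> card (W k)"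
    and "\<And>k l. k \<in> E \<Longrightarrow> l \<in> E \<Longrightarrow> k \<noteq> l \<Longrightarrow> card (W k \<inter> W l) \<le> q"
  shows "card E * p - card E * (real (card E) - 1) / 2 * q \<le> card (\<Union>k\<in>E. W k)"
  using assms
proof (induction E rule: finite_induct)
  case (insert e E)
  let ?U = "\<Union>k\<in>E. W k"
  have fin: "finite ?U" "finite (W e)" using insert by auto
  have "real (card (W e \<union> ?U)) = real (card (W e)) + real (card ?U) - real (card (W e \<inter> ?U))"
    using card_Un_Int[OF fin(2,1)] by linarith
  moreover have "card (W e \<inter> ?U) \<le> (\<Sum>k\<in>E. card (W e \<inter> W k))"
    unfolding Int_UN_distrib by (rule card_UN_le[OF insert.hyps(1)])
  then have "real (card (W e \<inter> ?U)) \<le> (\<Sum>k\<in>E. real (card (W e \<inter> W k)))"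
    unfolding of_nat_sum[symmetric] of_nat_le_iff .
  moreover have "(\<Sum>k\<in>E. real (card (W e \<inter> W k))) \<le> (\<Sum>k\<in>E. q)"
    by (rule sum_mono) (use insert in auto)
  moreover have "card E * p - card E * (real (card E) - 1) / 2 * q \<le> card ?U"
    using insert by auto
  moreover have "p \<le> card (W e)" using insert by auto
  ultimately have "card E * p - card E * (real (card E) - 1) / 2 * q + p - card E * q \<le> card (W e \<union> ?U)"
    by simp
  then show ?case using insert.hyps by (simp add: field_simps)
qed simp

lemma avoid_count_near_full_upper:
  assumes "M \<ge> 200"
  shows "avoid_count M (M - 3) \<le> (38/100) * fact M"
proof -
  define j where "j = M - 3"
  have j: "M = Suc (Suc (Suc j))" "j \<ge> 197" using assms by (auto simp: j_def)
  have rec: "avoid_count (Suc a) b = avoid_count (Suc a) (Suc b) + avoid_count a b" for a b by simp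
  have "avoid_count M (M - 3) = derangement_number (Suc (Suc (Suc j))) + 3 * derangement_number (Suc (Suc j))
      + 3 * derangement_number (Suc j) + derangement_number j"
    using rec[of "Suc (Suc j)" j] rec[of "Suc (Suc j)" "Suc j"] rec[of "Suc (Suc j)" "Suc (Suc j)"]
      rec[of "Suc j" j] rec[of "Suc j" "Suc j"] rec[of j j]
    by (simp add: j(1) del: avoid_count.simps flip: avoid_count_full)
  also have "\<dots> \<le> (37/100) * (fact (Suc (Suc (Suc j))) + 3 * fact (Suc (Suc j)) + 3 * fact (Suc j) + fact j)"
  proof -
    have "derangement_number i \<le> (37/100) * fact i" if "i \<ge> j" for i
      using derangement_ratio_bounds(2)[of i] that j(2) by linarith
    from this[of j] this[of "Suc j"] this[of "Suc (Suc j)"] this[of "Suc (Suc (Suc j))"]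
    show ?thesis unfolding distrib_left by linarith
  qed
  also have "\<dots> \<le> (38/100) * fact M"
  proof -
    define x where "x = real j"
    define f where "f = (fact j :: real)"
    have x: "x \<ge> 197" "f > 0" using j(2) by (auto simp: x_def f_def)
    have e: "fact (Suc j) = (x + 1) * f" "fact (Suc (Suc j)) = (x + 2) * ((x + 1) * f)"
      "fact (Suc (Suc (Suc j))) = (x + 3) * ((x + 2) * ((x + 1) * f))"
      by (auto simp: x_def f_def add.commute)
    define g where "g = (x + 1) * f"
    define h where "h = (x + 2) * g"
    have "198 * f \<le> g" "f \<ge> 0" unfolding g_def using x by (auto intro: mult_right_mono)
    moreover from this have "199 * g \<le> h" "g \<ge> 0" unfolding h_def using x by (auto intro: mult_right_mono)
    moreover define H where "H = (x + 3) * h"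
    moreover from calculation have "200 * h \<le> H" unfolding H_def using x by (intro mult_right_mono) auto
    ultimately have "(37/100) * (H + 3 * h + 3 * g + f) \<le> (38/100) * H" by argo
    then have "(37/100) * ((x + 3) * h + 3 * h + 3 * g + f) \<le> (38/100) * ((x + 3) * h)"
      unfolding H_def .
    then show ?thesis unfolding j(1) e f_def[symmetric] by (simp only: g_def h_def)
  qed
  finally show ?thesis .
qed

lemma fact_ge_power: "k ^ j \<le> fact (k + j)"
proof (induction j)
  case (Suc j)
  have "k ^ Suc j \<le> Suc (k + j) * fact (k + j)" using Suc by (simp add: mult_le_mono del: mult_Suc)
  then show ?case by simp
qed simp

lemma fact_le_power_mult_fact: "fact (k + j) \<le> (k + j) ^ j * fact k"
proof (induction j)
  case (Suc j)
  have "fact (k + Suc j) = Suc (k + j) * fact (k + j)" by simp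
  also have "\<dots> \<le> Suc (k + j) * ((k + j) ^ j * fact k)" using Suc by (rule mult_le_mono2)
  also have "\<dots> \<le> Suc (k + j) * (Suc (k + j) ^ j * fact k)"
    by (intro mult_le_mono2 mult_le_mono1 power_mono) auto
  finally show ?case by (simp only: add_Suc_right power_Suc mult.assoc)
qed simp

section \<open>Families with more than half of a coset\<close>

text \<open>
  The family after composition with a permutation that moves its dense \<open>t\<close>-coset to the pointwise
  stabilizer of \<open>D\<close>. Then \<open>A\<close> consists of the members inside this stabilizer, which are permutations
  of the remaining points \<open>R\<close>, and \<open>G\<close> consists of the outsiders.
\<close>
locale dense_coset =
  fixes n t :: nat and D :: "nat set" and F :: "(nat \<Rightarrow> nat) set"
  assumes t1: "t \<ge> 1" and nt: "n \<ge> 400 * t"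
    and F: "F \<subseteq> Sym n" "t_intersecting n t F"
    and D: "D \<subseteq> {1..n}" "card D = t"
    and dense: "(1/2) * fact (n - t) < real (card {\<sigma>\<in>F. \<sigma> permutes {1..n} - D})"
begin

definition "R = {1..n} - D"
definition "m = n - t"
definition "A = {\<sigma>\<in>F. \<sigma> permutes R}"
definition "G = F - A"

lemma finite_R: "finite R" and card_R: "card R = m" and m_ge: "m \<ge> 399"
  and R_sub: "R \<subseteq> {1..n}" and finite_D: "finite D" and disj: "D \<inter> R = {}"
  and nm: "n = m + t" and finite_A: "finite A" and finite_G: "finite G"
proof -
  show fD: "finite D" using D finite_subset by blast
  show "finite R" "R \<subseteq> {1..n}" "D \<inter> R = {}" by (auto simp: R_def)
  show "card R = m" using D fD by (simp add: R_def m_def card_Diff_subset)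
  show "m \<ge> 399" "n = m + t" using t1 nt by (auto simp: m_def)
  show "finite A" "finite G" using finite_family[OF F(1)] by (auto simp: A_def G_def)
qed

lemma dense_A: "(1/2) * fact m < real (card A)"
  using dense by (simp add: A_def R_def m_def)

lemma agreements_off_D:
  assumes "a \<in> A" "b \<in> F"
  shows "card {i\<in>D. b i \<noteq> i} \<le> card {k\<in>R. a k = b k}"
proof -
  have fixD: "a i = i" if "i \<in> D" for i
  proof -
    have "i \<notin> R" using that disj by blast
    then show ?thesis using assms(1) by (auto simp: A_def intro: permutes_not_in)
  qed
  have "{x \<in> {1..n}. a x = b x} = {i\<in>D. b i = i} \<union> {k\<in>R. a k = b k}"
    using D(1) fixD by (auto simp: R_def)
  then have "card {x \<in> {1..n}. a x = b x} \<le> card {i\<in>D. b i = i} + card {k\<in>R. a k = b k}"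
    by (simp only: card_Un_le)
  moreover have "t \<le> card {x \<in> {1..n}. a x = b x}"
    using assms F(2) by (auto simp: t_intersecting_def A_def)
  moreover have "card D = card {i\<in>D. b i = i} + card {i\<in>D. b i \<noteq> i}"
  proof -
    have "D = {i\<in>D. b i = i} \<union> {i\<in>D. b i \<noteq> i}" by blast
    then have "card D = card ({i\<in>D. b i = i} \<union> {i\<in>D. b i \<noteq> i})" by simp
    also have "\<dots> = card {i\<in>D. b i = i} + card {i\<in>D. b i \<noteq> i}"
      using finite_D by (intro card_Un_disjoint) auto
    finally show ?thesis .
  qed
  ultimately show ?thesis using D(2) by linarith
qed

text \<open>
  If an outsider moved two points of \<open>D\<close>, every member of \<open>A\<close> would agree with it at least twice on
  \<open>R\<close>; the union bound over pairs leaves at most half of the permutations of \<open>R\<close>.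
\<close>
lemma outsider_moves_one_point:
  assumes b: "b \<in> G"
  shows "card {i\<in>D. b i \<noteq> i} = 1"
proof -
  have bF: "b \<in> F" and bp: "b permutes {1..n}" using b F by (auto simp: G_def Sym_def)
  have "card {i\<in>D. b i \<noteq> i} \<noteq> 0"
  proof
    assume "card {i\<in>D. b i \<noteq> i} = 0"
    then have "\<forall>i\<in>D. b i = i" using finite_D by auto
    then have "b permutes R" using bp by (auto intro: permutes_superset simp: R_def)
    then show False using b by (auto simp: G_def A_def)
  qed
  moreover have "\<not> 2 \<le> card {i\<in>D. b i \<noteq> i}"
  proof
    assume "2 \<le> card {i\<in>D. b i \<noteq> i}"
    then have "A \<subseteq> {a. a permutes R \<and> 2 \<le> card {k\<in>R. a k = b k}}"
      using agreements_off_D[OF _ bF] by (force simp: A_def)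
    then have "card A \<le> card {a. a permutes R \<and> 2 \<le> card {k\<in>R. a k = b k}}"
      by (rule card_mono[OF finite_perms_filter[OF finite_R]])
    also have "\<dots> \<le> (m choose 2) * fact (m - 2)"
      using card_perms_agreeing_often_le[OF finite_R, of 2 b] by (simp add: card_R)
    finally have "card A \<le> (m choose 2) * fact (m - 2)" .
    then have "2 * card A \<le> 2 * ((m choose 2) * fact (m - 2))" by simp
    also have "\<dots> = fact m" using binomial_fact_lemma[of 2 m] m_ge by (simp add: mult.commute)
    finally have "2 * card A \<le> fact m" .
    then have "real (2 * card A) \<le> real (fact m)" by (simp only: of_nat_le_iff)
    then have "2 * real (card A) \<le> fact m" by simp
    then show False using dense_A by linarith
  qed
  ultimately show ?thesis by linarith
qed

text \<open>
  An outsider sends one point \<open>u \<in> R\<close> to the point \<open>i\<close> of \<open>D\<close> that it moves, and \<open>i\<close> back into \<open>R\<close>.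
  Undoing this detour gives a permutation \<open>w\<close> of \<open>R\<close>.
\<close>
lemma outsider_form:
  assumes b: "b \<in> G"
  obtains i u w where "i \<in> D" "u \<in> R" "w permutes R" "b = w \<circ> Transposition.transpose i u"
proof -
  have bp: "b permutes {1..n}" using b F by (auto simp: G_def Sym_def)
  obtain i where i: "{i\<in>D. b i \<noteq> i} = {i}"
    using outsider_moves_one_point[OF b] by (auto simp: card_Suc_eq One_nat_def)
  then have iD: "i \<in> D" "b i \<noteq> i" and fixD: "\<And>j. j \<in> D \<Longrightarrow> j \<noteq> i \<Longrightarrow> b j = j" by auto
  define u where "u = inv b i"
  have bu: "b u = i" using permutes_inverses(1)[OF bp] by (simp add: u_def)
  have "u \<in> {1..n}"
    using permutes_in_image[OF permutes_inv[OF bp], of i] iD(1) D(1) unfolding u_def by blast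
  moreover have "u \<noteq> i" using bu iD(2) by metis
  then have "u \<notin> D" using bu fixD[of u] by auto
  ultimately have uR: "u \<in> R" by (simp add: R_def)
  define w where "w = b \<circ> Transposition.transpose i u"
  have "w permutes {1..n}" unfolding w_def
    using bp iD D(1) \<open>u \<in> {1..n}\<close> by (intro permutes_compose permutes_swap_id) auto
  moreover have "w j = j" if "j \<in> D" for j
    using that fixD[of j] bu \<open>u \<notin> D\<close> by (cases "j = i") (auto simp: w_def Transposition.transpose_def)
  ultimately have "w permutes R" by (auto intro: permutes_superset simp: R_def)
  moreover have "b = w \<circ> Transposition.transpose i u" by (simp add: w_def comp_assoc)
  ultimately show thesis using that iD uR by blast
qed

lemma outsider_values:
  assumes "i \<in> D" "u \<in> R" "w permutes R"
  shows "(w \<circ> Transposition.transpose i u) u = i"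
    "k \<in> R \<Longrightarrow> k \<noteq> u \<Longrightarrow> (w \<circ> Transposition.transpose i u) k = w k"
proof -
  have "i \<notin> R" using assms disj by auto
  then show "(w \<circ> Transposition.transpose i u) u = i" using assms(3) by (simp add: permutes_not_in)
  show "k \<in> R \<Longrightarrow> k \<noteq> u \<Longrightarrow> (w \<circ> Transposition.transpose i u) k = w k"
    using \<open>i \<notin> R\<close> by (auto simp: Transposition.transpose_def)
qed

lemma members_hit_outsider:
  assumes "a \<in> A" "w \<circ> Transposition.transpose i u \<in> G" "i \<in> D" "u \<in> R" "w permutes R"
  shows "\<exists>k\<in>R - {u}. a k = w k"
proof -
  let ?b = "w \<circ> Transposition.transpose i u"
  have "?b \<in> F" using assms by (simp add: G_def)
  then have "1 \<le> card {k\<in>R. a k = ?b k}"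
    using agreements_off_D[OF assms(1), of ?b] outsider_moves_one_point[OF assms(2)] by simp
  then have "0 < card {k\<in>R. a k = ?b k}" by linarith
  then have "{k\<in>R. a k = ?b k} \<noteq> {}" unfolding card_gt_0_iff by (rule conjunct1)
  then obtain k where k: "k \<in> R" "a k = ?b k" by blast
  have "a permutes R" using assms(1) by (simp add: A_def)
  then have "a k \<in> R" using k(1) by (simp only: permutes_in_image)
  then have "k \<noteq> u" using k outsider_values(1)[OF assms(3-5)] assms(3) disj by auto
  then show ?thesis using k outsider_values(2)[OF assms(3-5) k(1)] by auto
qed

text \<open>
  The rows of \<open>R\<close> in which the outsider \<open>w \<circ> transpose i u\<close> takes a value in \<open>R\<close> that the outsider
  \<open>w' \<circ> transpose i' u'\<close> does not take there. In row \<open>u'\<close> the latter leaves \<open>R\<close>.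
\<close>
definition differ :: "nat \<Rightarrow> (nat \<Rightarrow> nat) \<Rightarrow> nat \<Rightarrow> (nat \<Rightarrow> nat) \<Rightarrow> nat set" where
  "differ u w u' w' = {k\<in>R - {u}. k = u' \<or> w k \<noteq> w' k}"

text \<open>
  Members of \<open>A\<close> agree with both outsiders somewhere on \<open>R\<close>. Among the permutations of \<open>R\<close> that agree
  with the first one, those that agree with it in a row of \<open>E\<close> and avoid the second one are lost; the
  Bonferroni inequality bounds their number from below, each single term being close to
  \<open>(m - 1)! / e\<close> and each pairwise term close to \<open>(m - 2)! / e\<close>. The subtracted quantity
  \<open>avoid_count m (m - 1)\<close> counts the permutations of \<open>R\<close> avoiding the first outsider, whose part inside
  \<open>R\<close> is a partial bijection of size \<open>m - 1\<close>.
\<close>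
lemma card_A_le_of_two_outsiders:
  assumes b: "w \<circ> Transposition.transpose i u \<in> G" "i \<in> D" "u \<in> R" "w permutes R"
    and b': "w' \<circ> Transposition.transpose i' u' \<in> G" "i' \<in> D" "u' \<in> R" "w' permutes R"
    and E: "E \<subseteq> differ u w u' w'"
  shows "card A + (card E * derangement_number (m - 1)
      - card E * (real (card E) - 1) / 2 * ((38/100) * fact (m - 2)))
    \<le> fact m - avoid_count m (m - 1)"
proof -
  define W where "W = (\<lambda>k. {a. a permutes R \<and> (\<forall>c\<in>{k}. a c = w c) \<and> (\<forall>l\<in>R - {u'} - {k}. a l \<noteq> w' l)})"
  have ER: "E \<subseteq> R - {u}" using E by (auto simp: differ_def)
  have finE: "finite E" using ER finite_R finite_subset by blast
  have finW: "finite (W k)" for k unfolding W_def by (rule finite_perms_filter[OF finite_R])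
  have w'inj: "inj_on w' S" for S using permutes_inj_on[OF b'(4)] .
  have w'img: "w' ` S \<subseteq> R" if "S \<subseteq> R" for S using that permutes_image[OF b'(4)] by auto
  have one: "derangement_number (m - 1) \<le> card (W k)" if k: "k \<in> E" for k
  proof -
    have kR: "k \<in> R" using k ER by auto
    let ?X = "{l \<in> R - {u'} - {k}. w' l \<notin> w ` {k}}"
    have "card ?X \<le> card (R - {k})" using finite_R by (intro card_mono) auto
    then have X: "card ?X \<le> m - 1" using kR by (simp add: card_R)
    have "real (card (W k)) = avoid_count (card R - card {k}) (card ?X)"
      unfolding W_def
      by (rule card_perms_prescribed_avoiding[OF finite_R _ b(4)]) (use kR w'inj w'img in auto)
    also have "\<dots> \<ge> avoid_count (m - 1) (m - 1)"
      using avoid_count_antimono[OF X] by (simp add: card_R)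
    finally show ?thesis by (simp add: avoid_count_full)
  qed
  have two: "card (W k \<inter> W l) \<le> (38/100) * fact (m - 2)" if kl: "k \<in> E" "l \<in> E" "k \<noteq> l" for k l
  proof -
    have klR: "{k, l} \<subseteq> R" using kl ER by auto
    let ?Y = "R - {u'} - {k, l}"
    let ?X = "{x \<in> ?Y. w' x \<notin> w ` {k, l}}"
    have "W k \<inter> W l \<subseteq> {a. a permutes R \<and> (\<forall>c\<in>{k, l}. a c = w c) \<and> (\<forall>x\<in>?Y. a x \<noteq> w' x)}"
      by (auto simp: W_def)
    then have "card (W k \<inter> W l) \<le> card {a. a permutes R \<and> (\<forall>c\<in>{k, l}. a c = w c) \<and> (\<forall>x\<in>?Y. a x \<noteq> w' x)}"
      by (rule card_mono[OF finite_perms_filter[OF finite_R]])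
    then have "real (card (W k \<inter> W l)) \<le> card {a. a permutes R \<and> (\<forall>c\<in>{k, l}. a c = w c) \<and> (\<forall>x\<in>?Y. a x \<noteq> w' x)}"
      by (rule of_nat_mono)
    also have "\<dots> = avoid_count (card R - card {k, l}) (card ?X)"
      by (rule card_perms_prescribed_avoiding[OF finite_R klR b(4)]) (use w'inj w'img in auto)
    also have "\<dots> = avoid_count (m - 2) (card ?X)" using kl(3) by (simp add: card_R numeral_2_eq_2)
    also have "\<dots> \<le> avoid_count (m - 2) (m - 2 - 3)"
    proof (rule avoid_count_antimono)
      have "card ?X \<le> card (R - {k, l})" using finite_R by (intro card_mono) auto
      also have "\<dots> = m - 2" using klR kl(3) by (simp add: card_Diff_subset card_R numeral_2_eq_2)
      finally show "card ?X \<le> m - 2" .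
      have "card ?Y \<ge> m - 3"
      proof -
        have "card {u', k, l} \<le> 3" by (simp add: card_insert_if)
        then have "card R - 3 \<le> card (R - {u', k, l})"
          using diff_card_le_card_Diff[of "{u', k, l}" R] by simp
        moreover have "R - {u', k, l} = ?Y" by auto
        ultimately show ?thesis by (simp add: card_R)
      qed
      moreover have "card ?Y - 2 \<le> card ?X"
      proof -
        let ?Z = "{x \<in> ?Y. w' x \<in> w ` {k, l}}"
        have "card ?Z = card (w' ` ?Z)" by (rule card_image[symmetric]) (rule w'inj)
        also have "\<dots> \<le> card (w ` {k, l})" by (rule card_mono) auto
        also have "\<dots> \<le> 2" by (simp add: card_insert_if)
        finally have "card ?Z \<le> 2" .
        moreover have "card ?Y = card (?X \<union> ?Z)" by (rule arg_cong[where f = card]) blast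
        then have "card ?Y \<le> card ?X + card ?Z" using card_Un_le[of ?X ?Z] by simp
        ultimately show ?thesis by linarith
      qed
      ultimately show "m - 2 - 3 \<le> card ?X" by linarith
    qed
    also have "\<dots> \<le> (38/100) * fact (m - 2)"
      using m_ge by (intro avoid_count_near_full_upper) auto
    finally show ?thesis .
  qed
  let ?H = "{a. a permutes R \<and> (\<exists>k\<in>R - {u}. a k = w k)}"
  have WH: "(\<Union>k\<in>E. W k) \<subseteq> ?H" using ER by (auto simp: W_def)
  have AH: "A \<subseteq> ?H" using members_hit_outsider[OF _ b] by (auto simp: A_def)
  have disj: "A \<inter> (\<Union>k\<in>E. W k) = {}"
  proof (rule ccontr)
    assume "\<not> ?thesis"
    then obtain a k where ak: "a \<in> A" "k \<in> E" "a \<in> W k" by blast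
    obtain l where l: "l \<in> R - {u'}" "a l = w' l" using members_hit_outsider[OF ak(1) b'] by blast
    have "l = k" using ak(3) l by (auto simp: W_def)
    moreover have "a k = w k" using ak(3) by (auto simp: W_def)
    moreover have "k = u' \<or> w k \<noteq> w' k" using ak(2) E by (auto simp: differ_def)
    ultimately show False using l by auto
  qed
  have "card A + card (\<Union>k\<in>E. W k) = card (A \<union> (\<Union>k\<in>E. W k))"
    using finE finW finite_A disj by (intro card_Un_disjoint[symmetric]) auto
  also have "\<dots> \<le> card ?H"
    using AH WH by (intro card_mono finite_perms_filter finite_R) auto
  finally have "real (card A) + real (card (\<Union>k\<in>E. W k)) \<le> real (card ?H)" by linarith
  also have "real (card ?H) = fact m - avoid_count m (m - 1)"
    using card_perms_hitting[OF finite_R b(3,4)] by (simp add: card_R)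
  finally show ?thesis
    using card_Union_ge_bonferroni[of E W "derangement_number (m - 1)" "(38/100) * fact (m - 2)", OF finE finW one two]
    by linarith
qed

end

context dense_coset
begin

text \<open>
  With nearly disjoint outsiders \<open>A\<close> would have proportion close to \<open>(1 - 1/e)\<^sup>2 < 1/2\<close>. In the
  Bonferroni bound already \<open>0.8 m\<close> rows of difference push the proportion below one half.
\<close>
lemma outsiders_differ_little:
  assumes b: "w \<circ> Transposition.transpose i u \<in> G" "i \<in> D" "u \<in> R" "w permutes R"
    and b': "w' \<circ> Transposition.transpose i' u' \<in> G" "i' \<in> D" "u' \<in> R" "w' permutes R"
  shows "card (differ u w u' w') < 4 * m div 5"
proof (rule ccontr)
  define e where "e = 4 * m div 5"
  assume "\<not> ?thesis"
  then have "e \<le> card (differ u w u' w')" by (simp add: e_def)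
  then obtain E where E: "E \<subseteq> differ u w u' w'" "card E = e"
    using obtain_subset_with_card_n by metis
  \<comment> \<open>Everything is compared in units of \<open>f = (m - 2)!\<close>.\<close>
  define M where "M = real m"
  define f where "f = (fact (m - 2) :: real)"
  have f: "f > 0" by (simp add: f_def)
  have M: "M \<ge> 399" using m_ge by (simp add: M_def)
  have m1: "m - 1 = Suc (m - 2)" "m = Suc (Suc (m - 2))" using m_ge by auto
  have f1: "fact (m - 1) = (M - 1) * f" unfolding m1(1) fact_Suc using m_ge by (simp add: M_def f_def of_nat_diff)
  have f2: "fact m = M * ((M - 1) * f)"
  proof -
    have "(fact m :: real) = of_nat m * fact (m - 1)" by (rule fact_reduce) (use m_ge in simp)
    then show ?thesis unfolding f1 M_def .
  qed
  have e: "real e \<le> (8/10) * M" "(8/10) * M - 1 \<le> real e" unfolding e_def M_def by linarith+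
  have e1: "(797/1000) * M \<le> real e" using e M by linarith
  define X where "X = (e * (real e - 1)) * f"
  have Xeq: "e * (real e - 1) / 2 * ((38/100) * f) = (19/100) * X" by (simp add: X_def)
  have "real (card A) + (e * derangement_number (m - 1) - (19/100) * X)
      \<le> fact m - avoid_count m (m - 1)"
    using card_A_le_of_two_outsiders[OF b b' E(1)] unfolding E(2) f_def[symmetric] Xeq .
  moreover have "avoid_count m (m - 1) \<ge> (366/1000) * fact m"
    using avoid_count_antimono[of "m - 1" m m] derangement_ratio_bounds(1)[of m] m_ge
    by (simp add: avoid_count_full)
  moreover have "e * ((366/1000) * fact (m - 1)) \<le> e * derangement_number (m - 1)"
    using derangement_ratio_bounds(1)[of "m - 1"] m_ge by (intro mult_left_mono) auto
  ultimately have "e * ((366/1000) * fact (m - 1)) - (19/100) * X < (134/1000) * fact m"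
    using dense_A by argo
  moreover have "X \<le> ((64/100) * M * (M - 1)) * f" unfolding X_def
  proof -
    have "e * (real e - 1) \<le> ((8/10) * M) * ((8/10) * (M - 1))"
      using e e1 M by (intro mult_mono) auto
    also have "\<dots> = (64/100) * M * (M - 1)" by simp
    finally show "real e * (real e - 1) * f \<le> (64/100) * M * (M - 1) * f"
      using f by (intro mult_right_mono) auto
  qed
  moreover have "(797/1000) * M * fact (m - 1) \<le> real e * fact (m - 1)"
    using e1 by (intro mult_right_mono) auto
  moreover define Y where "Y = M * ((M - 1) * f)"
  then have "((64/100) * M * (M - 1)) * f = (64/100) * Y" "(797/1000) * M * fact (m - 1) = (797/1000) * Y"
    "fact m = Y" unfolding f1 f2 by simp_all
  ultimately have "(366/1000) * ((797/1000) * Y) - (19/100) * ((64/100) * Y) < (134/1000) * Y"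
    by argo
  moreover have "Y > 0" unfolding Y_def using M f by simp
  ultimately show False by linarith
qed

text \<open>
  All outsiders agree with a fixed one in at least \<open>m / 5\<close> points, which leaves at most \<open>n! / v!\<close> of them
  with \<open>v \<ge> m / 5\<close>. This is far less than \<open>(m - 1)!\<close>, because \<open>v!\<close> beats \<open>n\<close> to the power \<open>t + 1\<close>.
\<close>
lemma few_outsiders: "card G < derangement_number (m - 1)"
proof (cases "G = {}")
  case True
  have "(183/500) * fact (m - 1) \<le> derangement_number (m - 1)"
    using derangement_ratio_bounds(1)[of "m - 1"] m_ge by simp
  moreover have "(fact (m - 1) :: real) > 0" by simp
  ultimately have "0 < derangement_number (m - 1)" by linarith
  then show ?thesis using True by simp
next
  case False
  then obtain b where bG: "b \<in> G" by blast
  obtain i u w where b: "i \<in> D" "u \<in> R" "w permutes R" "b = w \<circ> Transposition.transpose i u"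
    using outsider_form[OF bG] .
  define v where "v = m - 4 * m div 5"
  have "G \<subseteq> {a. a permutes {1..n} \<and> v \<le> card {k\<in>{1..n}. a k = b k}}"
  proof
    fix b' assume b'G: "b' \<in> G"
    obtain i' u' w' where b': "i' \<in> D" "u' \<in> R" "w' permutes R" "b' = w' \<circ> Transposition.transpose i' u'"
      using outsider_form[OF b'G] .
    let ?S = "(R - {u}) - differ u w u' w'"
    have "?S \<subseteq> {k\<in>{1..n}. b' k = b k}"
    proof
      fix k assume k: "k \<in> ?S"
      then have "k \<in> R" "k \<noteq> u" "k \<noteq> u'" "w k = w' k" by (auto simp: differ_def)
      then show "k \<in> {k\<in>{1..n}. b' k = b k}"
        using outsider_values(2)[OF b(1-3)] outsider_values(2)[OF b'(1-3)] R_sub unfolding b(4) b'(4) by auto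
    qed
    then have "card ?S \<le> card {k\<in>{1..n}. b' k = b k}" by (intro card_mono) auto
    moreover have "card ?S \<ge> card (R - {u}) - card (differ u w u' w')"
      by (rule diff_card_le_card_Diff) (use finite_R in \<open>auto simp: differ_def\<close>)
    moreover have "card (R - {u}) = m - 1" using b(2) card_R by simp
    moreover have "card (differ u w u' w') < 4 * m div 5"
      using outsiders_differ_little[of w i u w' i' u'] b b' bG b'G by simp
    ultimately have "v \<le> card {k\<in>{1..n}. b' k = b k}" unfolding v_def by linarith
    then show "b' \<in> {a. a permutes {1..n} \<and> v \<le> card {k\<in>{1..n}. a k = b k}}"
      using b'G F by (auto simp: G_def Sym_def)
  qed
  then have "card G \<le> card {a. a permutes {1..n} \<and> v \<le> card {k\<in>{1..n}. a k = b k}}"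
    by (rule card_mono[OF finite_perms_filter[OF finite_atLeastAtMost]])
  also have "\<dots> \<le> (n choose v) * fact (n - v)"
    using card_perms_agreeing_often_le[of "{1..n}" v b] by simp
  finally have G: "card G \<le> (n choose v) * fact (n - v)" .
  have vn: "v \<le> n" using nm by (simp add: v_def)
  have "card G * fact v \<le> (n choose v) * fact (n - v) * fact v" using G by (rule mult_le_mono1)
  also have "\<dots> = fact n" using binomial_fact_lemma[OF vn] by (simp add: mult_ac)
  also have "\<dots> \<le> n ^ (t + 1) * fact (m - 1)"
    using fact_le_power_mult_fact[of "m - 1" "t + 1"] nm m_ge by simp
  finally have "real (card G * fact v) \<le> real (n ^ (t + 1) * fact (m - 1))" by (simp only: of_nat_le_iff)
  then have 1: "real (card G) * fact v \<le> real n ^ (t + 1) * fact (m - 1)"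
    by (simp only: of_nat_mult of_nat_power of_nat_fact)
  \<comment> \<open>The top \<open>4 t\<close> factors of \<open>v!\<close> all exceed \<open>k \<ge> n / 12\<close>, and \<open>(n / 12)\<^sup>4 \<ge> 3 n\<^sup>2\<close>.\<close>
  define k where "k = v - 4 * t"
  have n400: "real n \<ge> 400 * real t" "real t \<ge> 1" using nt t1 by auto
  have v5: "real m / 5 \<le> real v" unfolding v_def by linarith
  have mn: "real m = real n - real t" using nm by simp
  have "real (4 * t) \<le> real v" using v5 mn n400 by simp
  then have vk: "v = k + 4 * t" "real k = real v - 4 * real t" unfolding k_def by auto
  have "real n / 12 \<le> real k" using vk(2) v5 mn n400 by simp
  have "real (k ^ (4 * t)) \<le> real (fact v)"
    using fact_ge_power[of k "4 * t"] unfolding vk(1) by (simp only: of_nat_le_iff)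
  then have "real k ^ (4 * t) \<le> fact v" by (simp only: of_nat_power of_nat_fact)
  have "3 * real n ^ (t + 1) \<le> 3 ^ t * (real n ^ 2) ^ t"
  proof (rule mult_mono)
    show "3 \<le> (3::real) ^ t" using t1 power_increasing[of 1 t "3::real"] by simp
    have "real n ^ (t + 1) \<le> real n ^ (2 * t)" using n400 t1 by (intro power_increasing) auto
    then show "real n ^ (t + 1) \<le> (real n ^ 2) ^ t" by (simp add: power_mult)
  qed auto
  also have "\<dots> = (3 * real n ^ 2) ^ t" by (simp add: power_mult_distrib)
  also have "\<dots> \<le> ((real n / 12) ^ 4) ^ t"
  proof (rule power_mono)
    have "250 * 250 \<le> real n * real n" using n400 by (intro mult_mono) auto
    then have "real n ^ 2 * (3 * 20736) \<le> real n ^ 2 * real n ^ 2"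
      by (intro mult_left_mono) (auto simp: power2_eq_square)
    then show "3 * real n ^ 2 \<le> (real n / 12) ^ 4"
      by (simp add: power_divide eval_nat_numeral)
  qed auto
  also have "\<dots> \<le> (real k ^ 4) ^ t"
    using \<open>real n / 12 \<le> real k\<close> by (intro power_mono) auto
  also have "\<dots> = real k ^ (4 * t)" by (simp add: power_mult)
  also have "\<dots> \<le> fact v" by fact
  finally have 2: "3 * real n ^ (t + 1) \<le> fact v" .
  have "real (card G) * (3 * real n ^ (t + 1)) \<le> real (card G) * fact v" using 2 by (intro mult_left_mono) auto
  also have "\<dots> \<le> real n ^ (t + 1) * fact (m - 1)" by (rule 1)
  finally have "real n ^ (t + 1) * (3 * real (card G)) \<le> real n ^ (t + 1) * fact (m - 1)"
    by (simp add: mult_ac)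
  moreover have "real n ^ (t + 1) > 0" using n400 by simp
  ultimately have "3 * real (card G) \<le> fact (m - 1)" by (rule mult_left_le_imp_le)
  moreover have "(183/500) * fact (m - 1) \<le> derangement_number (m - 1)"
    using derangement_ratio_bounds(1)[of "m - 1"] m_ge by simp
  moreover have "(fact (m - 1) :: real) > 0" by simp
  ultimately show ?thesis by linarith
qed

text \<open>
  A single row of difference already costs \<open>A\<close> a derangement number of members, more than all
  outsiders can make up for.
\<close>
lemma outsiders_share_permutation:
  assumes large: "fact m - avoid_count m (m - 1) \<le> card F"
    and b: "w \<circ> Transposition.transpose i u \<in> G" "i \<in> D" "u \<in> R" "w permutes R"
    and b': "w' \<circ> Transposition.transpose i' u' \<in> G" "i' \<in> D" "u' \<in> R" "w' permutes R"
  shows "u' = u" "w' = w"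
proof -
  have cF: "card F = card A + card G"
  proof -
    have "F = A \<union> G" "A \<inter> G = {}" by (auto simp: A_def G_def)
    then show ?thesis using card_Un_disjoint[OF finite_A finite_G] by simp
  qed
  have "differ u w u' w' = {}"
  proof (rule ccontr)
    assume "differ u w u' w' \<noteq> {}"
    then obtain k where "{k} \<subseteq> differ u w u' w'" by blast
    from card_A_le_of_two_outsiders[OF b b' this]
    have "real (card A) + derangement_number (m - 1) \<le> fact m - avoid_count m (m - 1)" by simp
    then show False using few_outsiders large cF by linarith
  qed
  then have same: "k \<noteq> u'" "w k = w' k" if "k \<in> R - {u}" for k using that by (auto simp: differ_def)
  show u: "u' = u" using same(1) b'(3) by auto
  have img: "w' ` (R - {u}) = w ` (R - {u})" by (rule image_cong[OF refl]) (rule same(2)[symmetric])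
  have "w x = w' x" for x
  proof (cases "x \<in> R - {u}")
    case False
    show ?thesis
    proof (cases "x = u")
      case True
      have "w ` R = R" "w' ` R = R" using permutes_image b(4) b'(4) by blast+
      moreover have "w ` R - w ` (R - {u}) = {w u}" "w' ` R - w' ` (R - {u}) = {w' u}"
        using b(3) permutes_inj[OF b(4)] permutes_inj[OF b'(4)] by (auto dest: injD)
      ultimately have "{w u} = {w' u}" using img by simp
      then show ?thesis using True by simp
    next
      case False
      then have "x \<notin> R" using \<open>x \<notin> R - {u}\<close> by auto
      then show ?thesis using b(4) b'(4) by (simp add: permutes_not_in)
    qed
  qed (use same in auto)
  then show "w' = w" by auto
qed

text \<open>
  All outsiders are \<open>w \<circ> transpose i u\<close> with common \<open>w\<close> and \<open>u\<close>; hence there are at most \<open>t\<close> of them,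
  and \<open>A\<close> is contained in the set of permutations of \<open>R\<close> agreeing with \<open>w\<close> off \<open>u\<close>. In a family of the
  given size both inclusions are equalities.
\<close>
lemma structure_of_maximum:
  assumes G: "G \<noteq> {}" and large: "fact m - avoid_count m (m - 1) + real t \<le> card F"
  obtains u w where "u \<in> R" "w permutes R"
    "F = (\<lambda>\<sigma>. w \<circ> \<sigma>) ` ({\<sigma>. \<sigma> permutes R \<and> (\<exists>k\<in>R - {u}. \<sigma> k = k)} \<union> (\<lambda>i. Transposition.transpose i u) ` D)"
    "real (card F) = fact m - avoid_count m (m - 1) + t"
proof -
  have large': "fact m - avoid_count m (m - 1) \<le> card F" using large by linarith
  obtain b where bG: "b \<in> G" using G by blast
  obtain i u w where b: "i \<in> D" "u \<in> R" "w permutes R" "b = w \<circ> Transposition.transpose i u"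
    using outsider_form[OF bG] .
  define G0 where "G0 = (\<lambda>j. w \<circ> Transposition.transpose j u) ` D"
  define A0 where "A0 = {a. a permutes R \<and> (\<exists>k\<in>R - {u}. a k = w k)}"
  have GG0: "G \<subseteq> G0"
  proof
    fix b' assume b'G: "b' \<in> G"
    obtain i' u' w' where b': "i' \<in> D" "u' \<in> R" "w' permutes R" "b' = w' \<circ> Transposition.transpose i' u'"
      using outsider_form[OF b'G] .
    have "u' = u" "w' = w"
      using outsiders_share_permutation[OF large', of w i u w' i' u'] b b' bG b'G by auto
    then show "b' \<in> G0" using b' by (auto simp: G0_def)
  qed
  have finG0: "finite G0" using finite_D by (simp add: G0_def)
  have cG0: "card G0 \<le> t" unfolding G0_def using card_image_le[OF finite_D] D(2) by metis
  have AA0: "A \<subseteq> A0"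
    using members_hit_outsider[of _ w i u] b bG by (auto simp: A0_def A_def)
  have finA0: "finite A0" unfolding A0_def by (rule finite_perms_filter[OF finite_R])
  have cA0: "real (card A0) = fact m - avoid_count m (m - 1)"
    using card_perms_hitting[OF finite_R b(2,3)] by (simp add: A0_def card_R)
  have "F = A \<union> G" "A \<inter> G = {}" by (auto simp: A_def G_def)
  then have cF: "card F = card A + card G" using card_Un_disjoint[OF finite_A finite_G] by simp
  have le: "card A \<le> card A0" "card G \<le> card G0" using AA0 GG0 finA0 finG0 by (auto intro: card_mono)
  have eq: "card A = card A0" "card G = card G0" "card G = t"
    using le cG0 cF large cA0 by linarith+
  have "A = A0" "G = G0" using card_subset_eq[OF finA0 AA0 eq(1)] card_subset_eq[OF finG0 GG0 eq(2)] .
  moreover have "A0 = (\<lambda>\<sigma>. w \<circ> \<sigma>) ` {\<sigma>. \<sigma> permutes R \<and> (\<exists>k\<in>R - {u}. \<sigma> k = k)}"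
  proof (intro set_eqI iffI)
    fix a assume a: "a \<in> A0"
    have "inv w \<circ> a permutes R" using a b(3) by (auto simp: A0_def intro: permutes_compose permutes_inv)
    moreover have "\<exists>k\<in>R - {u}. (inv w \<circ> a) k = k"
    proof -
      obtain k where "k \<in> R - {u}" "a k = w k" using a by (auto simp: A0_def)
      then show ?thesis using permutes_inverses(2)[OF b(3), of k] by (intro bexI[of _ k]) auto
    qed
    moreover have "a = w \<circ> (inv w \<circ> a)" using permutes_inverses(1)[OF b(3)] by (simp add: fun_eq_iff)
    ultimately show "a \<in> (\<lambda>\<sigma>. w \<circ> \<sigma>) ` {\<sigma>. \<sigma> permutes R \<and> (\<exists>k\<in>R - {u}. \<sigma> k = k)}" by blast
  next
    fix a assume "a \<in> (\<lambda>\<sigma>. w \<circ> \<sigma>) ` {\<sigma>. \<sigma> permutes R \<and> (\<exists>k\<in>R - {u}. \<sigma> k = k)}"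
    then obtain \<sigma> k where s: "a = w \<circ> \<sigma>" "\<sigma> permutes R" "k \<in> R - {u}" "\<sigma> k = k" by blast
    then have "a permutes R" "a k = w k" using permutes_compose[OF s(2) b(3)] by simp_all
    then show "a \<in> A0" using s(3) by (auto simp: A0_def)
  qed
  moreover have "G0 = (\<lambda>\<sigma>. w \<circ> \<sigma>) ` (\<lambda>i. Transposition.transpose i u) ` D"
    by (simp add: G0_def image_image)
  ultimately have "F = (\<lambda>\<sigma>. w \<circ> \<sigma>) ` ({\<sigma>. \<sigma> permutes R \<and> (\<exists>k\<in>R - {u}. \<sigma> k = k)} \<union> (\<lambda>i. Transposition.transpose i u) ` D)"
    using \<open>F = A \<union> G\<close> by (simp add: image_Un)
  moreover have "real (card F) = fact m - avoid_count m (m - 1) + t" using cF eq cA0 by linarith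
  ultimately show thesis using that b(2,3) by blast
qed

end

section \<open>The Hilton-Milner family and the extremal theorem\<close>

text \<open>
  The Hilton-Milner family in the shape produced by the structural analysis, with \<open>n\<close> in the role of
  the exceptional point and the identity in the role of the common permutation.
\<close>
lemma HM_family_eq:
  assumes "t < n"
  shows "HM_family n t = {\<sigma>. \<sigma> permutes {t+1..n} \<and> (\<exists>k\<in>{t+1..n} - {n}. \<sigma> k = k)}
    \<union> (\<lambda>i. Transposition.transpose i n) ` {1..t}"
proof -
  have "\<sigma> \<in> Sym n \<and> (\<forall>i\<in>{1..t}. \<sigma> i = i) \<longleftrightarrow> \<sigma> permutes {t+1..n}" for \<sigma>
  proof
    assume s: "\<sigma> \<in> Sym n \<and> (\<forall>i\<in>{1..t}. \<sigma> i = i)"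
    then have "\<sigma> permutes {1..n}" by (simp add: Sym_def)
    then show "\<sigma> permutes {t+1..n}" by (rule permutes_superset) (use s in auto)
  next
    assume s: "\<sigma> permutes {t+1..n}"
    then have "\<sigma> permutes {1..n}" by (rule permutes_subset) auto
    moreover have "\<sigma> i = i" if "i \<in> {1..t}" for i using that by (intro permutes_not_in[OF s]) auto
    ultimately show "\<sigma> \<in> Sym n \<and> (\<forall>i\<in>{1..t}. \<sigma> i = i)" by (simp add: Sym_def)
  qed
  moreover have "{t+1..n-1} = {t+1..n} - {n}" using assms by auto
  moreover have "{Transposition.transpose i n | i. i \<in> {1..t}} = (\<lambda>i. Transposition.transpose i n) ` {1..t}" by blast
  ultimately show ?thesis unfolding HM_family_def by (simp only: conj_assoc[symmetric])
qed

lemma card_HM_family: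
  assumes "t < n"
  shows "real (card (HM_family n t)) = fact (n - t) - avoid_count (n - t) (n - t - 1) + t"
proof -
  let ?X = "{\<sigma>. \<sigma> permutes {t+1..n} \<and> (\<exists>k\<in>{t+1..n} - {n}. \<sigma> k = k)}"
  let ?Y = "(\<lambda>i. Transposition.transpose i n) ` {1..t}"
  have "inj_on (\<lambda>i. Transposition.transpose i n) {1..t}"
    by (rule inj_onI) (metis transpose_apply_second)
  then have Y: "card ?Y = t" by (simp add: card_image)
  have disj: "?X \<inter> ?Y = {}"
  proof (rule ccontr)
    assume "\<not> ?thesis"
    then obtain i where i: "i \<in> {1..t}" "Transposition.transpose i n permutes {t+1..n}" by blast
    then have "Transposition.transpose i n i = i" by (intro permutes_not_in[OF i(2)]) auto
    then show False using i(1) assms by simp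
  qed
  have "card (?X \<union> ?Y) = card ?X + card ?Y"
    by (rule card_Un_disjoint[OF finite_perms_filter _ disj]) auto
  moreover have "real (card ?X) = fact (n - t) - avoid_count (n - t) (n - t - 1)"
    using card_perms_hitting[of "{t+1..n}" n id] assms permutes_id[of "{t+1..n}"] by simp
  ultimately show ?thesis unfolding HM_family_eq[OF assms] Y by simp
qed

lemma isomorphic_families_card:
  assumes "isomorphic_families n F1 F2"
  shows "card F2 = card F1"
proof -
  obtain \<rho> \<pi> where p: "\<rho> permutes {1..n}" "\<pi> permutes {1..n}" "F2 = {\<rho> \<circ> \<sigma> \<circ> \<pi> | \<sigma>. \<sigma> \<in> F1}"
    using assms by (auto simp: isomorphic_families_def Sym_def)
  have "inj_on (\<lambda>\<sigma>. \<rho> \<circ> \<sigma> \<circ> \<pi>) F1"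
  proof (rule inj_onI)
    fix \<sigma> \<tau> assume e: "\<rho> \<circ> \<sigma> \<circ> \<pi> = \<rho> \<circ> \<tau> \<circ> \<pi>"
    have "\<sigma> x = \<tau> x" for x
    proof -
      have "\<rho> (\<sigma> (\<pi> (inv \<pi> x))) = \<rho> (\<tau> (\<pi> (inv \<pi> x)))" using fun_cong[OF e, of "inv \<pi> x"] by simp
      then show ?thesis using permutes_inverses(1)[OF p(2)] permutes_inj[OF p(1)] by (simp add: inj_eq)
    qed
    then show "\<sigma> = \<tau>" by auto
  qed
  moreover have "F2 = (\<lambda>\<sigma>. \<rho> \<circ> \<sigma> \<circ> \<pi>) ` F1" unfolding p(3) by blast
  ultimately show ?thesis by (simp add: card_image)
qed

lemma conjugate_permutes:
  assumes p: "p permutes S" and s: "s permutes R"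
  shows "p \<circ> s \<circ> inv p permutes p ` R"
proof -
  have "bij (p \<circ> s \<circ> inv p)"
    using p s by (intro bij_comp) (auto intro: permutes_bij permutes_inv)
  then have "p \<circ> s \<circ> inv p permutes UNIV" by (simp add: permutes_univ bij_iff)
  then show ?thesis
  proof (rule permutes_superset)
    fix x assume x: "x \<in> UNIV - p ` R"
    then have "inv p x \<notin> R" using permutes_inverses(1)[OF p, of x] by force
    then show "(p \<circ> s \<circ> inv p) x = x" using s permutes_inverses(1)[OF p] by (simp add: permutes_not_in)
  qed
qed

lemma conjugate_transpose:
  assumes p: "p permutes S"
  shows "p \<circ> Transposition.transpose a b \<circ> inv p = Transposition.transpose (p a) (p b)"
proof
  fix x
  have "(inv p x = a) = (x = p a)" "(inv p x = b) = (x = p b)"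
    using permutes_inverses[OF p] by auto
  then show "(p \<circ> Transposition.transpose a b \<circ> inv p) x = Transposition.transpose (p a) (p b) x"
    using permutes_inverses(1)[OF p] by (simp add: Transposition.transpose_def)
qed

text \<open>
  Composition with the inverse of a member \<open>\<tau>\<close> of the dense coset and with the inverse of the common
  permutation \<open>w\<close> of the outsiders brings \<open>F\<close> into the standard form, except that \<open>D\<close> and \<open>u\<close> take the
  places of \<open>{1..t}\<close> and \<open>n\<close>; a conjugation by \<open>\<pi>\<close> corrects this.
\<close>
lemma maximum_families_isomorphic:
  assumes t: "t \<ge> 1" "n \<ge> 400 * t" and F: "F \<subseteq> Sym n" "nontrivial n t F" "t_intersecting n t F"
    and large: "fact (n - t) - avoid_count (n - t) (n - t - 1) + real t \<le> card F"
  shows "real (card F) = fact (n - t) - avoid_count (n - t) (n - t - 1) + t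
    \<and> isomorphic_families n F (HM_family n t)"
proof -
  define m where "m = n - t"
  have m: "m \<ge> 399" "t < n" using t by (auto simp: m_def)
  have f0: "(fact m :: real) > 0" by simp
  have "avoid_count m (m - 1) \<le> (371/1000) * fact m"
  proof -
    have "derangement_number m \<le> (37/100) * fact m" "derangement_number (m - 1) \<le> (37/100) * fact (m - 1)"
      using m derangement_ratio_bounds(2)[of m] derangement_ratio_bounds(2)[of "m - 1"] by simp_all
    moreover have "(fact m :: real) = of_nat m * fact (m - 1)" by (rule fact_reduce) (use m in simp)
    then have "399 * fact (m - 1) \<le> (fact m :: real)" using m by simp
    moreover have "avoid_count m (m - 1) = derangement_number m + derangement_number (m - 1)"
      using avoid_count_all_but_one[of m] m by simp
    ultimately show ?thesis using f0 by linarith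
  qed
  then have "(62/100) * fact (n - t) \<le> real (card F)"
    using large f0 unfolding m_def[symmetric] by linarith
  from large_family_concentrates_on_coset[OF F(1,3) t this] obtain T where
    T: "card T = t" "(1/2) * fact m < real (card (link n F T))" unfolding m_def by blast
  have "link n F T \<noteq> {}" using T(2) f0 by (intro notI) simp
  then obtain \<tau> where \<tau>: "\<tau> \<in> F" "T \<subseteq> gr n \<tau>" by (auto simp: link_def)
  have \<tau>p: "\<tau> permutes {1..n}" using \<tau> F(1) by (auto simp: Sym_def)
  define D where "D = fst ` T"
  have D: "D \<subseteq> {1..n}" "card D = t"
    using \<tau>(2) card_fst_image_gr[OF \<tau>(2)] T(1) by (auto simp: D_def gr_def)
  define F1 where "F1 = (\<lambda>\<sigma>. inv \<tau> \<circ> \<sigma>) ` F"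
  have inj: "inj_on (\<lambda>\<sigma>. inv \<tau> \<circ> \<sigma>) X" for X
    using inj_on_comp_left_permutes[OF permutes_inv[OF \<tau>p]] .
  have cF1: "card F1 = card F" unfolding F1_def by (rule card_image[OF inj])
  have F1p: "\<sigma> permutes {1..n}" if "\<sigma> \<in> F1" for \<sigma>
    using that F(1) permutes_compose[OF _ permutes_inv[OF \<tau>p]] by (auto simp: F1_def Sym_def)
  have fixes_D: "inv \<tau> \<circ> \<sigma> permutes {1..n} - D \<longleftrightarrow> (\<forall>d\<in>D. \<sigma> d = \<tau> d)" if "\<sigma> \<in> F" for \<sigma>
  proof
    assume p: "inv \<tau> \<circ> \<sigma> permutes {1..n} - D"
    show "\<forall>d\<in>D. \<sigma> d = \<tau> d"
    proof
      fix d assume "d \<in> D"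
      then have "(inv \<tau> \<circ> \<sigma>) d = d" by (intro permutes_not_in[OF p]) auto
      then show "\<sigma> d = \<tau> d" using permutes_inverses(1)[OF \<tau>p, of "\<sigma> d"] by simp
    qed
  next
    assume d: "\<forall>d\<in>D. \<sigma> d = \<tau> d"
    have "inv \<tau> \<circ> \<sigma> permutes {1..n}" using F1p that by (simp add: F1_def)
    then show "inv \<tau> \<circ> \<sigma> permutes {1..n} - D"
      by (rule permutes_superset) (use d permutes_inverses(2)[OF \<tau>p] in auto)
  qed
  interpret N: dense_coset n t D F1
  proof
    show "F1 \<subseteq> Sym n" using F1p by (auto simp: Sym_def)
    have "(inv \<tau> a = inv \<tau> b) = (a = b)" for a b
      using permutes_inj[OF permutes_inv[OF \<tau>p]] by (simp add: inj_eq)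
    then show "t_intersecting n t F1" using F(3) by (auto simp: t_intersecting_def F1_def)
    have "(\<lambda>\<sigma>. inv \<tau> \<circ> \<sigma>) ` link n F T \<subseteq> {\<sigma> \<in> F1. \<sigma> permutes {1..n} - D}"
    proof
      fix s assume "s \<in> (\<lambda>\<sigma>. inv \<tau> \<circ> \<sigma>) ` link n F T"
      then obtain \<sigma> where s: "s = inv \<tau> \<circ> \<sigma>" "\<sigma> \<in> F" "T \<subseteq> gr n \<sigma>" by (auto simp: link_def)
      have "\<sigma> d = \<tau> d" if d: "d \<in> D" for d
      proof -
        obtain v where "(d, v) \<in> T" using d by (auto simp: D_def)
        then have "(d, v) \<in> gr n \<sigma>" "(d, v) \<in> gr n \<tau>" using s(3) \<tau>(2) by blast+
        then show ?thesis by simp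
      qed
      then show "s \<in> {\<sigma> \<in> F1. \<sigma> permutes {1..n} - D}" using s fixes_D[OF s(2)] by (auto simp: F1_def)
    qed
    moreover have "finite F1" using finite_family[OF F(1)] by (simp add: F1_def)
    ultimately have "card ((\<lambda>\<sigma>. inv \<tau> \<circ> \<sigma>) ` link n F T) \<le> card {\<sigma> \<in> F1. \<sigma> permutes {1..n} - D}"
      by (intro card_mono) auto
    then show "1 / 2 * fact (n - t) < real (card {\<sigma> \<in> F1. \<sigma> permutes {1..n} - D})"
      using T(2) by (simp add: card_image[OF inj] m_def)
  qed (use t D in auto)
  have outside: "N.G \<noteq> {}"
  proof
    assume "N.G = {}"
    then have all: "\<sigma> d = \<tau> d" if "\<sigma> \<in> F" "d \<in> D" for \<sigma> d
    proof -
      have "inv \<tau> \<circ> \<sigma> \<in> F1" using that(1) by (simp add: F1_def)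
      then have "inv \<tau> \<circ> \<sigma> \<in> N.A" using \<open>N.G = {}\<close> unfolding N.G_def by blast
      then have "inv \<tau> \<circ> \<sigma> permutes {1..n} - D" by (simp only: N.A_def N.R_def mem_Collect_eq)
      then show ?thesis using fixes_D[OF that(1)] that(2) by blast
    qed
    have "finite D" using D(1) finite_subset by blast
    then obtain i where i: "bij_betw i {1..t} D"
      using finite_same_card_bij[of "{1..t}" D] D(2) by auto
    have imgi: "i ` {1..t} = D" "inj_on i {1..t}" using i by (auto simp: bij_betw_def)
    have "t_coset n t {\<sigma> \<in> Sym n. \<forall>k\<in>{1..t}. \<sigma> (i k) = (\<tau> \<circ> i) k}"
      unfolding t_coset_def
    proof (rule exI[of _ i], rule exI[of _ "\<tau> \<circ> i"], intro conjI refl)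
      show "inj_on (\<tau> \<circ> i) {1..t}" using imgi(2) permutes_inj_on[OF \<tau>p] by (intro comp_inj_on)
      show "(\<tau> \<circ> i) ` {1..t} \<subseteq> {1..n}"
        using D(1) permutes_image[OF \<tau>p] imgi(1) by (auto simp: image_comp[symmetric])
    qed (use imgi D in auto)
    moreover have "F \<subseteq> {\<sigma> \<in> Sym n. \<forall>k\<in>{1..t}. \<sigma> (i k) = (\<tau> \<circ> i) k}"
      using F(1) all imgi(1) by auto
    ultimately show False using F(2) by (auto simp: nontrivial_def)
  qed
  have large1: "fact N.m - avoid_count N.m (N.m - 1) + real t \<le> card F1"
    using large cF1 by (simp add: N.m_def)
  obtain u w where uw: "u \<in> N.R" "w permutes N.R"
    and F1: "F1 = (\<lambda>\<sigma>. w \<circ> \<sigma>) ` ({\<sigma>. \<sigma> permutes N.R \<and> (\<exists>k\<in>N.R - {u}. \<sigma> k = k)}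
        \<union> (\<lambda>i. Transposition.transpose i u) ` D)"
    and cF: "real (card F1) = fact N.m - avoid_count N.m (N.m - 1) + t"
    by (rule N.structure_of_maximum[OF outside large1])
  let ?X = "{\<sigma>. \<sigma> permutes N.R \<and> (\<exists>k\<in>N.R - {u}. \<sigma> k = k)}"
  let ?Y = "(\<lambda>i. Transposition.transpose i u) ` D"
  let ?HX = "{\<sigma>. \<sigma> permutes {t+1..n} \<and> (\<exists>k\<in>{t+1..n} - {n}. \<sigma> k = k)}"
  let ?HY = "(\<lambda>i. Transposition.transpose i n) ` {1..t}"
  have wn: "w permutes {1..n}" using uw(2) N.R_sub by (rule permutes_subset)
  obtain h where h: "bij_betw h D {1..t}"
    using finite_same_card_bij[OF N.finite_D, of "{1..t}"] D(2) by auto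
  then have himg: "h ` D = {1..t}" "inj_on h D" by (auto simp: bij_betw_def)
  define g where "g = (\<lambda>x. if x = u then n else h x)"
  have uD: "u \<notin> D" using uw(1) by (simp add: N.R_def)
  have gD: "g d = h d" if "d \<in> D" for d using that uD by (auto simp: g_def)
  have "inj_on g (insert u D)"
  proof (rule inj_onI)
    fix x y assume xy: "x \<in> insert u D" "y \<in> insert u D" "g x = g y"
    have hn: "h d \<noteq> n" if "d \<in> D" for d
    proof -
      have "h d \<in> {1..t}" using that himg(1) by blast
      then show ?thesis using m(2) by auto
    qed
    show "x = y"
    proof (cases "x = u \<or> y = u")
      case True
      show ?thesis
      proof (rule ccontr)
        assume "x \<noteq> y"
        then have "\<exists>d\<in>D. h d = n" using True xy unfolding g_def by (cases "x = u") auto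
        then show False using hn by blast
      qed
    next
      case False
      then have "x \<in> D" "y \<in> D" using xy by blast+
      moreover from this have "h x = h y" using xy(3) gD by simp
      ultimately show ?thesis using inj_onD[OF himg(2)] by blast
    qed
  qed
  moreover have "g ` insert u D \<subseteq> {1..n}"
  proof
    fix y assume "y \<in> g ` insert u D"
    then consider "y = g u" | d where "d \<in> D" "y = h d" using gD by auto
    then show "y \<in> {1..n}"
    proof cases
      case 1
      then show ?thesis using m(2) by (simp add: g_def)
    next
      case 2
      then have "y \<in> {1..t}" using himg(1) by blast
      then show ?thesis using m(2) by simp
    qed
  qed
  moreover have "insert u D \<subseteq> {1..n}" using uw(1) D(1) N.R_sub by auto
  ultimately obtain \<pi> where \<pi>: "\<pi> permutes {1..n}" "\<forall>x\<in>insert u D. \<pi> x = g x"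
    using partial_injection_extends_to_permutation[of "{1..n}" "insert u D" g] by auto
  have \<pi>u: "\<pi> u = n" using \<pi>(2) by (simp add: g_def)
  have "\<pi> ` D = h ` D" by (rule image_cong[OF refl]) (use \<pi>(2) gD in simp)
  then have \<pi>D: "\<pi> ` D = {1..t}" by (simp only: himg(1))
  have inj\<pi>: "inj \<pi>" using permutes_inj[OF \<pi>(1)] .
  have \<pi>R: "\<pi> ` N.R = {t+1..n}"
  proof -
    have "\<pi> ` N.R = \<pi> ` {1..n} - \<pi> ` D" unfolding N.R_def by (rule image_set_diff[OF inj\<pi>])
    then show ?thesis using permutes_image[OF \<pi>(1)] \<pi>D by auto
  qed
  define c where "c = (\<lambda>s. \<pi> \<circ> s \<circ> inv \<pi>)"
  have cX: "c ` ?X = ?HX"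
  proof (intro set_eqI iffI)
    fix s assume "s \<in> c ` ?X"
    then obtain \<sigma> k where s: "s = c \<sigma>" "\<sigma> permutes N.R" "k \<in> N.R - {u}" "\<sigma> k = k" by blast
    have "s permutes {t+1..n}" using conjugate_permutes[OF \<pi>(1) s(2)] by (simp add: s(1) c_def \<pi>R)
    moreover have "s (\<pi> k) = \<pi> k" using s(4) permutes_inverses(2)[OF \<pi>(1)] by (simp add: s(1) c_def)
    moreover have "\<pi> k \<in> {t+1..n} - {n}"
    proof -
      have "\<pi> k \<in> {t+1..n}" using s(3) \<pi>R by blast
      moreover have "\<pi> k \<noteq> \<pi> u" using s(3) injD[OF inj\<pi>, of k u] by blast
      ultimately show ?thesis using \<pi>u by simp
    qed
    ultimately show "s \<in> ?HX" by blast
  next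
    fix s assume "s \<in> ?HX"
    then obtain k where s: "s permutes {t+1..n}" "k \<in> {t+1..n} - {n}" "s k = k" by blast
    define \<sigma> where "\<sigma> = inv \<pi> \<circ> s \<circ> \<pi>"
    have "inv \<pi> ` {t+1..n} = N.R"
      unfolding \<pi>R[symmetric] using permutes_inverses(2)[OF \<pi>(1)] by (simp add: image_image)
    then have "\<sigma> permutes N.R"
      using conjugate_permutes[OF permutes_inv[OF \<pi>(1)] s(1)] permutes_inv_inv[OF \<pi>(1)] by (simp add: \<sigma>_def)
    moreover have "\<sigma> (inv \<pi> k) = inv \<pi> k" using s(3) permutes_inverses(1)[OF \<pi>(1)] by (simp add: \<sigma>_def)
    moreover have "inv \<pi> k \<in> N.R - {u}"
      using s(2) \<open>inv \<pi> ` {t+1..n} = N.R\<close> \<pi>u permutes_inverses(1)[OF \<pi>(1), of k] by auto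
    moreover have "s = c \<sigma>" using permutes_inverses(1)[OF \<pi>(1)] by (simp add: c_def \<sigma>_def fun_eq_iff)
    ultimately show "s \<in> c ` ?X" by blast
  qed
  have "c ` ?Y = (\<lambda>i. Transposition.transpose i n) ` \<pi> ` D"
    unfolding c_def image_image conjugate_transpose[OF \<pi>(1)] \<pi>u ..
  then have cY: "c ` ?Y = ?HY" by (simp only: \<pi>D)
  have HM: "HM_family n t = c ` (?X \<union> ?Y)"
    unfolding HM_family_eq[OF m(2)] image_Un cX cY ..
  define \<rho> where "\<rho> = \<pi> \<circ> inv w \<circ> inv \<tau>"
  have "?X \<union> ?Y = (\<lambda>s. inv w \<circ> s) ` F1"
    unfolding F1 image_image using permutes_inverses(2)[OF uw(2)] by (simp add: comp_def)
  also have "\<dots> = (\<lambda>\<sigma>. inv w \<circ> (inv \<tau> \<circ> \<sigma>)) ` F" unfolding F1_def image_image ..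
  finally have "HM_family n t = (\<lambda>\<sigma>. c (inv w \<circ> (inv \<tau> \<circ> \<sigma>))) ` F" unfolding HM by (simp only: image_image)
  also have "\<dots> = {\<rho> \<circ> \<sigma> \<circ> inv \<pi> | \<sigma>. \<sigma> \<in> F}" by (auto simp: c_def \<rho>_def comp_assoc)
  finally have "HM_family n t = {\<rho> \<circ> \<sigma> \<circ> inv \<pi> | \<sigma>. \<sigma> \<in> F}" .
  moreover have "\<rho> \<in> Sym n" "inv \<pi> \<in> Sym n"
    using \<pi>(1) wn \<tau>p by (auto simp: \<rho>_def Sym_def intro!: permutes_compose permutes_inv)
  ultimately have "isomorphic_families n F (HM_family n t)" by (auto simp: isomorphic_families_def)
  then show ?thesis using cF cF1 by (simp add: N.m_def)
qed

theorem corollary1p6: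
  fixes t n :: nat and F :: "(nat \<Rightarrow> nat) set"
  assumes "t \<ge> 1" and "n \<ge> 400 * t"
    and "F \<subseteq> Sym n" and "nontrivial n t F" and "t_intersecting n t F"
  shows "real (card F) \<le>
           fact (n - t) - derangement_number (n - t) - derangement_number (n - t - 1) + real t \<and>
         (real (card F) =
           fact (n - t) - derangement_number (n - t) - derangement_number (n - t - 1) + real t
          \<longleftrightarrow> isomorphic_families n F (HM_family n t))"
proof -
  define M where "M = fact (n - t) - derangement_number (n - t) - derangement_number (n - t - 1) + real t"
  have tn: "t < n" using assms(1,2) by linarith
  have M: "M = fact (n - t) - avoid_count (n - t) (n - t - 1) + t"
    using avoid_count_all_but_one[of "n - t"] tn by (simp add: M_def)
  have iso: "real (card F) = M" if "isomorphic_families n F (HM_family n t)"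
    using isomorphic_families_card[OF that] card_HM_family[OF tn] by (simp add: M)
  have "real (card F) = M \<and> isomorphic_families n F (HM_family n t)" if "M \<le> card F"
    using maximum_families_isomorphic[OF assms] that by (simp add: M)
  then have "real (card F) \<le> M \<and> (real (card F) = M \<longleftrightarrow> isomorphic_families n F (HM_family n t))"
    using iso by (cases "M \<le> card F") auto
  then show ?thesis unfolding M_def .
qed

end
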